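(* Let $d\ge 2$, $\mu>0$, $s\in\mathbb{R}$ and $1\le p\le\infty$ satisfy: $s\ge 0$ if $p=1$; $s>-\min\{\frac{d}{p'},\,1+\frac{d}{p}\}$ if $1<p<\infty$; $s\ge -1$ if $p=\infty$. Let $u_0\in\widehat{\dot B}{}^{-1}_{\infty,2}(\mathbb{R}^d)\cap\widehat{\dot B}{}^{0}_{1,\infty}(\mathbb{R}^d)$ be an $\mathbb{R}^d$-valued initial velocity with $\operatorname{div}u_0=0$ in $\mathcal{S}'$ and with $\|u_0\|_{\widehat{\dot B}{}^{-1}_{\infty,2}}$ sufficiently small. Suppose moreover that there exists a non-zero vector $M_0\in\mathbb{R}^d$ such that $$\lim_{|\xi|\to0}\left|\widehat{u}_0(\xi)-P(\xi)M_0\right|=0 .$$ Then the global mild solution $u$ of the incompressible Navier--Stokes equations with initial velocity $u_0$ satisfies $$\lim_{t\to\infty}t^{\frac d2\left(1-\frac1p\right)+\frac s2}\left\||\nabla|^s\left(u(t)-S_\mu(t)M_0\right)\right\|_{\widehat{L}^p}=0 .$$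
   Context: Fourier transform: $\widehat f(\xi)=\mathcal{F}[f](\xi)=(2\pi)^{-d/2}\int_{\mathbb{R}^d}e^{-ix\cdot\xi}f(x)\,dx$, $\mathcal{F}^{-1}[g](x)=(2\pi)^{-d/2}\int_{\mathbb{R}^d}e^{ix\cdot\xi}g(\xi)\,d\xi$. $p'$ is the Hölder conjugate of $p$. $|\nabla|^sf=\mathcal{F}^{-1}[|\xi|^s\widehat f]$, $e^{\mu t\Delta}f=\mathcal{F}^{-1}[e^{-\mu t|\xi|^2}\widehat f]$. Fourier--Lebesgue norm: $\|f\|_{\widehat L^p}=\|\widehat f\|_{L^{p'}}$ (for $f\in\mathcal{S}'$ with $\widehat f\in L^1_{loc}$). Thus $\||\nabla|^sf\|_{\widehat L^p}=\||\xi|^s\widehat f\|_{L^{p'}_\xi}$. Homogeneous Fourier--Herz space $\widehat{\dot B}{}^{s}_{p,\sigma}(\mathbb{R}^d)$: the $f\in\mathcal{S}'$ with $\widehat f\in L^1_{loc}$ and $\|f\|_{\widehat{\dot B}{}^{s}_{p,\sigma}}=\big\|\{2^{sj}\|\dot\Delta_jf\|_{\widehat L^p}\}_{j\in\mathbb{Z}}\big\|_{\ell^\sigma}<\infty$, where $\dot\Delta_jf=\mathcal{F}^{-1}[\widehat\phi(2^{-j}\xi)\widehat f]$ and $\widehat\phi\ge0$ is smooth, radial, supported in $\{1/2\le|\xi|\le2\}$ with $\sum_{j\in\mathbb{Z}}\widehat\phi(2^{-j}\xi)=1$ for $\xi\ne0$. One has $\widehat{\dot B}{}^0_{1,\infty}\simeq\widehat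 L^1$ (i.e. $\widehat u_0\in L^\infty$); pointwise statements on $\widehat u_0$ are understood up to null sets. $P(\xi)=\left(\delta_{lm}-\xi_l\xi_m/|\xi|^2\right)_{1\le l,m\le d}$ for $\xi\neq0$; the (matrix-valued) Oseen kernel is $S_\mu(x,t)=\mathcal{F}^{-1}[e^{-\mu t|\xi|^2}P(\xi)](x)$. Navier--Stokes: $\partial_tu-\mu\Delta u+\operatorname{div}(u\otimes u)+\nabla p=0$, $\operatorname{div}u=0$, $u|_{t=0}=u_0$ on $\mathbb{R}^d\times(0,\infty)$. A global mild solution is $u\in L^2(\mathbb{R}_+;\widehat L^\infty)$ with $$u(t)=e^{\mu t\Delta}u_0-\int_0^te^{\mu(t-\tau)\Delta}\mathcal{P}_\sigma\operatorname{div}(u\otimes u)(\tau)\,d\tau,$$ where $\mathcal{P}_\sigma$ is the Fourier multiplier with symbol $P(\xi)$. It is known that if $u_0\in\widehat{\dot B}{}^{-1}_{\infty,2}$, $\operatorname{div}u_0=0$, and $\|u_0\|_{\widehat{\dot B}{}^{-1}_{\infty,2}}$ is sufficiently small, there is a unique global mild solution; "the global mild solution" refers to it, and "sufficiently small" means below this kind of threshold (a positive constant not depending on $u_0$). *)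

theory Defs
  imports "HOL-Analysis.Analysis" "HOL-Probability.Essential_Supremum"
begin

section \<open>Smooth functions, Schwartz functions, tempered distributions\<close>

definition partial_deriv :: "'d::finite \<Rightarrow> (real^'d \<Rightarrow> 'b::real_normed_vector) \<Rightarrow> real^'d \<Rightarrow> 'b" where
  "partial_deriv i f = (\<lambda>x. frechet_derivative f (at x) (axis i 1))"

text \<open>Multi-indices are lists of coordinate directions: \<open>iter_partial [i\<^sub>1, \<dots>, i\<^sub>n] f\<close> is
  \<open>\<partial>\<^bsub>i\<^sub>1\<^esub> \<dots> \<partial>\<^bsub>i\<^sub>n\<^esub> f\<close>.\<close>

definition iter_partial :: "'d::finite list \<Rightarrow> (real^'d \<Rightarrow> 'b::real_normed_vector) \<Rightarrow> real^'d \<Rightarrow> 'b" where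
  "iter_partial is f = foldr partial_deriv is f"

definition smooth_fun :: "(real^'d::finite \<Rightarrow> 'b::real_normed_vector) \<Rightarrow> bool" where
  "smooth_fun f \<longleftrightarrow> (\<forall>is x. iter_partial is f differentiable (at x))"

definition test_function :: "(real^'d::finite \<Rightarrow> complex) \<Rightarrow> bool" where
  "test_function f \<longleftrightarrow> smooth_fun f \<and> bounded {x. f x \<noteq> 0}"

definition schwartz :: "(real^'d::finite \<Rightarrow> complex) \<Rightarrow> bool" where
  "schwartz f \<longleftrightarrow> smooth_fun f \<and>
     (\<forall>is N. bounded (range (\<lambda>x. (1 + norm x) ^ N *\<^sub>R iter_partial is f x)))"

definition schwartz_seminorm :: "nat \<Rightarrow> (real^'d::finite \<Rightarrow> complex) \<Rightarrow> real" where
  "schwartz_seminorm N f =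
     (\<Sum>is\<in>{is. length is \<le> N}. SUP x. (1 + norm x) ^ N * norm (iter_partial is f x))"

text \<open>A distribution is a functional of which only the values on Schwartz functions matter.
  A vector field whose components are distributions is an element of \<open>('d dist)^'d\<close>.\<close>

type_synonym 'd dist = "(real^'d \<Rightarrow> complex) \<Rightarrow> complex"

definition tempered :: "'d::finite dist \<Rightarrow> bool" where
  "tempered T \<longleftrightarrow>
     (\<forall>f g a b. schwartz f \<longrightarrow> schwartz g \<longrightarrow> T (\<lambda>x. a * f x + b * g x) = a * T f + b * T g) \<and>
     (\<exists>N C. \<forall>f. schwartz f \<longrightarrow> norm (T f) \<le> C * schwartz_seminorm N f)"

definition dist_of_fun :: "(real^'d::finite \<Rightarrow> complex) \<Rightarrow> 'd dist" where
  "dist_of_fun g = (\<lambda>f. LINT x|lborel. g x * f x)"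

section \<open>Fourier transform\<close>

definition fourier :: "(real^'d::finite \<Rightarrow> complex) \<Rightarrow> real^'d \<Rightarrow> complex" where
  "fourier f \<xi> = of_real ((2 * pi) powr (- real CARD('d) / 2)) *
     (LINT x|lborel. exp (- (\<i> * of_real (x \<bullet> \<xi>))) * f x)"

definition inv_fourier :: "(real^'d::finite \<Rightarrow> complex) \<Rightarrow> real^'d \<Rightarrow> complex" where
  "inv_fourier g x = of_real ((2 * pi) powr (- real CARD('d) / 2)) *
     (LINT \<xi>|lborel. exp (\<i> * of_real (x \<bullet> \<xi>)) * g \<xi>)"

definition locally_integrable :: "(real^'d::finite \<Rightarrow> complex) \<Rightarrow> bool" where
  "locally_integrable g \<longleftrightarrow> (\<forall>K. compact K \<longrightarrow> set_integrable lborel K g)"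

text \<open>The Fourier transform of the distribution \<open>T\<close> is \<open>f \<mapsto> T (fourier f)\<close>. It is the
  locally integrable function \<open>g\<close> if both agree on test functions (a locally integrable
  function representing a tempered distribution need not be absolutely integrable against
  every Schwartz function).\<close>

definition has_hat :: "'d::finite dist \<Rightarrow> (real^'d \<Rightarrow> complex) \<Rightarrow> bool" where
  "has_hat T g \<longleftrightarrow> locally_integrable g \<and>
     (\<forall>f. test_function f \<longrightarrow> T (fourier f) = (LINT \<xi>|lborel. g \<xi> * f \<xi>))"

definition hat :: "'d::finite dist \<Rightarrow> real^'d \<Rightarrow> complex" where
  "hat T = (SOME g. has_hat T g)"

definition vhat :: "('d::finite dist)^'d \<Rightarrow> real^'d \<Rightarrow> complex^'d" where
  "vhat u \<xi> = (\<chi> i. hat (u $ i) \<xi>)"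

text \<open>The ambient class: vector fields in \<open>\<S>'\<close> with locally integrable Fourier transform.\<close>

definition hat_class :: "('d::finite dist)^'d \<Rightarrow> bool" where
  "hat_class u \<longleftrightarrow> (\<forall>i. tempered (u $ i) \<and> (\<exists>g. has_hat (u $ i) g))"

text \<open>\<open>\<F>\<^sup>-\<^sup>1[g]\<close> as a tempered distribution, for functions \<open>g\<close> that are integrable against
  Schwartz functions.\<close>

definition inv_fourier_dist :: "(real^'d::finite \<Rightarrow> complex) \<Rightarrow> 'd dist" where
  "inv_fourier_dist g = (\<lambda>f. LINT \<xi>|lborel. g \<xi> * inv_fourier f \<xi>)"

definition fourier_mult :: "(real^'d::finite \<Rightarrow> complex) \<Rightarrow> 'd dist \<Rightarrow> 'd dist" where
  "fourier_mult m T = inv_fourier_dist (\<lambda>\<xi>. m \<xi> * hat T \<xi>)"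

section \<open>Norms\<close>

definition ennpow :: "ennreal \<Rightarrow> real \<Rightarrow> ennreal" where
  "ennpow x a = (if x = \<infinity> then \<infinity> else ennreal (enn2real x powr a))"

text \<open>\<open>L\<^sup>q\<close> norm, \<open>1 \<le> q \<le> \<infinity>\<close>, of a function with modulus \<open>h\<close>. Over the counting measure
  this is the \<open>\<ell>\<^sup>q\<close> norm.\<close>

definition Lq_norm :: "'a measure \<Rightarrow> ennreal \<Rightarrow> ('a \<Rightarrow> ennreal) \<Rightarrow> ennreal" where
  "Lq_norm M q h =
     (if q = \<infinity> then esssup M h
      else ennpow (\<integral>\<^sup>+ x. ennpow (h x) (enn2real q) \<partial>M) (1 / enn2real q))"

text \<open>In \<open>ennreal\<close>, \<open>inverse 0 = \<infinity>\<close> and \<open>inverse \<infinity> = 0\<close>, so the endpoints are covered.\<close>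

definition hconj :: "ennreal \<Rightarrow> ennreal" where
  "hconj p = inverse (1 - inverse p)"

text \<open>The Fourier--Lebesgue norms of \<open>f\<close> and of \<open>|\<nabla>|\<^sup>s f\<close>; infinite outside the ambient class.\<close>

definition hatL_norm :: "ennreal \<Rightarrow> ('d::finite dist)^'d \<Rightarrow> ennreal" where
  "hatL_norm p f =
     (if hat_class f then Lq_norm lborel (hconj p) (\<lambda>\<xi>. ennreal (norm (vhat f \<xi>))) else \<infinity>)"

definition hatL_deriv_norm :: "real \<Rightarrow> ennreal \<Rightarrow> ('d::finite dist)^'d \<Rightarrow> ennreal" where
  "hatL_deriv_norm s p f =
     (if hat_class f
      then Lq_norm lborel (hconj p) (\<lambda>\<xi>. ennreal (norm \<xi> powr s * norm (vhat f \<xi>))) else \<infinity>)"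

text \<open>\<open>\<phi>\<close> is the Fourier-side cut-off, written with a hat on paper.\<close>

definition littlewood_paley :: "(real^'d::finite \<Rightarrow> real) \<Rightarrow> bool" where
  "littlewood_paley \<phi> \<longleftrightarrow> smooth_fun \<phi> \<and> (\<forall>\<xi>. \<phi> \<xi> \<ge> 0) \<and>
     (\<forall>\<xi> \<eta>. norm \<xi> = norm \<eta> \<longrightarrow> \<phi> \<xi> = \<phi> \<eta>) \<and>
     (\<forall>\<xi>. \<phi> \<xi> \<noteq> 0 \<longrightarrow> 1 / 2 \<le> norm \<xi> \<and> norm \<xi> \<le> 2) \<and>
     (\<forall>\<xi>. \<xi> \<noteq> 0 \<longrightarrow> ((\<lambda>j::int. \<phi> ((2 powi (- j)) *\<^sub>R \<xi>)) has_sum 1) UNIV)"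

definition dyadic_block :: "(real^'d::finite \<Rightarrow> real) \<Rightarrow> int \<Rightarrow> ('d dist)^'d \<Rightarrow> ('d dist)^'d" where
  "dyadic_block \<phi> j f =
     (\<chi> i. fourier_mult (\<lambda>\<xi>. of_real (\<phi> ((2 powi (- j)) *\<^sub>R \<xi>))) (f $ i))"

definition herz_norm ::
  "(real^'d::finite \<Rightarrow> real) \<Rightarrow> real \<Rightarrow> ennreal \<Rightarrow> ennreal \<Rightarrow> ('d dist)^'d \<Rightarrow> ennreal" where
  "herz_norm \<phi> s p \<sigma> f = Lq_norm (count_space UNIV) \<sigma>
     (\<lambda>j::int. ennreal (2 powr (s * of_int j)) * hatL_norm p (dyadic_block \<phi> j f))"

definition herz_space ::
  "(real^'d::finite \<Rightarrow> real) \<Rightarrow> real \<Rightarrow> ennreal \<Rightarrow> ennreal \<Rightarrow> (('d dist)^'d) set" where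
  "herz_space \<phi> s p \<sigma> = {f. hat_class f \<and> herz_norm \<phi> s p \<sigma> f < \<infinity>}"

section \<open>Operators of the Navier--Stokes equations\<close>

definition div_free :: "('d::finite dist)^'d \<Rightarrow> bool" where
  "div_free u \<longleftrightarrow> (\<forall>f. schwartz f \<longrightarrow> - (\<Sum>i\<in>UNIV. (u $ i) (partial_deriv i f)) = 0)"

definition real_valued :: "('d::finite dist)^'d \<Rightarrow> bool" where
  "real_valued u \<longleftrightarrow> (\<forall>i f. schwartz f \<longrightarrow> (\<forall>x. f x \<in> \<real>) \<longrightarrow> (u $ i) f \<in> \<real>)"

definition vdiff :: "('d::finite dist)^'d \<Rightarrow> ('d dist)^'d \<Rightarrow> ('d dist)^'d" where
  "vdiff u v = (\<chi> i. (\<lambda>f. (u $ i) f - (v $ i) f))"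

definition leray_symbol :: "real^'d::finite \<Rightarrow> real^'d^'d" where
  "leray_symbol \<xi> = (\<chi> l m. (if l = m then 1 else 0) - \<xi> $ l * \<xi> $ m / (norm \<xi>)\<^sup>2)"

definition complex_vec :: "real^'d::finite \<Rightarrow> complex^'d" where
  "complex_vec v = (\<chi> i. of_real (v $ i))"

definition heat :: "real \<Rightarrow> real \<Rightarrow> ('d::finite dist)^'d \<Rightarrow> ('d dist)^'d" where
  "heat \<mu> t f = (\<chi> i. fourier_mult (\<lambda>\<xi>. of_real (exp (- (\<mu> * t * (norm \<xi>)\<^sup>2)))) (f $ i))"

definition leray_proj :: "('d::finite dist)^'d \<Rightarrow> ('d dist)^'d" where
  "leray_proj f = (\<chi> l. inv_fourier_dist
     (\<lambda>\<xi>. \<Sum>m\<in>UNIV. of_real (leray_symbol \<xi> $ l $ m) * hat (f $ m) \<xi>))"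

text \<open>A field with integrable Fourier transform is identified with the bounded continuous
  function \<open>\<F>\<^sup>-\<^sup>1\<close> of that transform; products are pointwise products of these functions.\<close>

definition tensor_square :: "('d::finite dist)^'d \<Rightarrow> ('d dist)^'d^'d" where
  "tensor_square u =
     (\<chi> l m. dist_of_fun (\<lambda>x. inv_fourier (hat (u $ l)) x * inv_fourier (hat (u $ m)) x))"

definition div_tensor :: "('d::finite dist)^'d^'d \<Rightarrow> ('d dist)^'d" where
  "div_tensor W = (\<chi> l. (\<lambda>f. - (\<Sum>m\<in>UNIV. (W $ l $ m) (partial_deriv m f))))"

definition oseen_kernel :: "real \<Rightarrow> real \<Rightarrow> real^'d::finite \<Rightarrow> complex^'d^'d" where
  "oseen_kernel \<mu> t x = (\<chi> l m. inv_fourier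
     (\<lambda>\<xi>. of_real (exp (- (\<mu> * t * (norm \<xi>)\<^sup>2)) * leray_symbol \<xi> $ l $ m)) x)"

definition oseen_apply :: "real \<Rightarrow> real \<Rightarrow> real^'d::finite \<Rightarrow> ('d dist)^'d" where
  "oseen_apply \<mu> t M = (\<chi> i. dist_of_fun (\<lambda>x. (oseen_kernel \<mu> t x *v complex_vec M) $ i))"

section \<open>Global mild solutions\<close>

text \<open>Bochner measurability of a function from \<open>(0, \<infinity>)\<close> to the space with norm \<open>hatL_norm p\<close>:
  it is almost everywhere the limit of simple functions.\<close>

definition strongly_measurable :: "ennreal \<Rightarrow> (real \<Rightarrow> ('d::finite dist)^'d) \<Rightarrow> bool" where
  "strongly_measurable p u \<longleftrightarrow>
     (\<exists>s :: nat \<Rightarrow> real \<Rightarrow> ('d dist)^'d.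
        (\<forall>n. finite (range (s n)) \<and> (\<forall>v. s n -` {v} \<in> sets lebesgue) \<and>
             (\<forall>t. hatL_norm p (s n t) < \<infinity>)) \<and>
        (AE t in lebesgue. t > 0 \<longrightarrow> (\<lambda>n. hatL_norm p (vdiff (u t) (s n t))) \<longlonglongrightarrow> 0))"

definition time_L2 :: "ennreal \<Rightarrow> (real \<Rightarrow> ('d::finite dist)^'d) \<Rightarrow> bool" where
  "time_L2 p u \<longleftrightarrow> strongly_measurable p u \<and>
     Lq_norm (restrict_space lebesgue {0<..}) 2 (\<lambda>t. hatL_norm p (u t)) < \<infinity>"

text \<open>The time integral in the mild formulation is taken in the weak sense in \<open>\<S>'\<close>, i.e. after
  pairing with Schwartz functions.\<close>

definition global_mild_solution ::
  "real \<Rightarrow> ('d::finite dist)^'d \<Rightarrow> (real \<Rightarrow> ('d dist)^'d) \<Rightarrow> bool" where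
  "global_mild_solution \<mu> u0 u \<longleftrightarrow>
     time_L2 \<infinity> u \<and>
     (\<forall>t>0. \<forall>i. tempered (u t $ i) \<and>
        (\<forall>f. schwartz f \<longrightarrow>
          set_integrable lebesgue {0<..<t}
            (\<lambda>\<tau>. (heat \<mu> (t - \<tau>) (leray_proj (div_tensor (tensor_square (u \<tau>)))) $ i) f) \<and>
          (u t $ i) f = (heat \<mu> t u0 $ i) f -
            (LINT \<tau>:{0<..<t}|lebesgue.
               (heat \<mu> (t - \<tau>) (leray_proj (div_tensor (tensor_square (u \<tau>)))) $ i) f)))"

end

theory Submission
  imports Defs "HOL-Probability.Characteristic_Functions" "HOL-Probability.Sinc_Integral"
    "HOL-Probability.Distribution_Functions"
begin

text \<open>
  Let \<open>U(t, \<xi>)\<close> be the Fourier transform of the mild solution. At almost every frequency it is the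
  heat flow \<open>e\<^sup>-\<^sup>\<mu>\<^sup>t\<^sup>|\<^sup>\<xi>\<^sup>|\<^sup>2\<close> of the transformed datum minus a Duhamel term \<open>B(t, \<xi>)\<close>, the time integral
  of \<open>e\<^sup>-\<^sup>\<mu>\<^sup>(\<^sup>t\<^sup>-\<^sup>\<tau>\<^sup>)\<^sup>|\<^sup>\<xi>\<^sup>|\<^sup>2 P(\<xi>) (i\<xi> \<cdot> (U * U)(\<tau>))\<close> up to a constant (\<open>mild_solution_fourier\<close>). Hence
  \<open>V = \<bar>U\<bar>\<close> satisfies a scalar inequality: it is at most \<open>K0 e\<^sup>-\<^sup>\<mu>\<^sup>t\<^sup>|\<^sup>\<xi>\<^sup>|\<^sup>2\<close>, where \<open>K0\<close> bounds the
  transformed datum (\<open>herz_bound\<close>), plus \<open>c \<bar>\<xi>\<bar>\<close> times the Duhamel integral of \<open>V * V\<close>. Moreover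
  \<open>N(t)\<close>, the \<open>L\<^sup>1\<close> norm of \<open>V(t, \<cdot>)\<close>, is square integrable in time.

  The heart of the proof is the bound \<open>V \<le> C (1 + t\<bar>\<xi>\<bar>\<^sup>2)\<^sup>-\<^sup>k\<close> for every \<open>k\<close> (\<open>decay_bound\<close>). It is
  obtained by comparison with the right side as a barrier. In \<open>V(\<eta>) V(\<xi> - \<eta>)\<close> one frequency has
  modulus at least \<open>\<bar>\<xi>\<bar>/2\<close>, where the barrier is comparable to its value at \<open>\<xi>\<close>, and the other
  factor integrates to \<open>N\<close>. Since \<open>\<bar>\<xi>\<bar> e\<^sup>-\<^sup>\<mu>\<^sup>s\<^sup>|\<^sup>\<xi>\<^sup>|\<^sup>2\<close> is square integrable in \<open>s\<close> uniformly in \<open>\<xi>\<close>, the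
  barrier reproduces itself with a small factor on a time interval where the energy, the integral of
  \<open>N\<^sup>2\<close>, is small. The part of \<open>V\<close> above the barrier then satisfies a linear inequality that is a
  strict contraction in \<open>L\<^sup>2\<close> in time and \<open>L\<^sup>1\<close> in frequency, so it vanishes (\<open>barrier_step\<close>). As the
  total energy is finite, finitely many such intervals cover the time axis.

  Feeding the bound back into the Duhamel term gives \<open>\<bar>B(t, \<xi>)\<bar> \<le> C (1 + t\<bar>\<xi>\<bar>\<^sup>2)\<^sup>-\<^sup>k\<close> times
  \<open>t\<^sup>-\<^sup>1\<^sup>/\<^sup>2\<close> times the integral of \<open>N\<close> over \<open>(0, t)\<close>, and this factor tends to \<open>0\<close> for every square
  integrable \<open>N\<close>. The linear part of
  the difference to the Oseen field is \<open>e\<^sup>-\<^sup>\<mu>\<^sup>t\<^sup>|\<^sup>\<xi>\<^sup>|\<^sup>2\<close> times a bounded function that is small near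
  frequency zero. Altogether the difference is at most \<open>o(1) (1 + t\<bar>\<xi>\<bar>\<^sup>2)\<^sup>-\<^sup>k\<close> (\<open>difference_decay\<close>). For
  large \<open>k\<close> the weighted \<open>L\<^sup>p\<^sup>'\<close> norm of this profile is finite, because \<open>s p' > -d\<close>, and by scaling
  it is a constant times the inverse of the power of \<open>t\<close> in the theorem (\<open>hatL_deriv_norm_decay\<close>).

  The passage from distributions to functions of frequency rests on Fourier inversion for test
  functions (\<open>inv_fourier_fourier\<close>), the uniqueness of locally integrable transforms (\<open>has_hat_unique\<close>),
  the transform of the nonlinearity (\<open>hat_nonlinearity\<close>), and a version of \<open>U\<close> that is jointly
  measurable (\<open>jointly_measurable_representative\<close>), with which Fubini makes sense of the weakly
  defined time integral frequency by frequency.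
\<close>

section \<open>Smooth functions\<close>

text \<open>By induction on the multi-index, its derivative of \<open>f\<close> stays in the class. Every smoothness
  proof below exhibits such a class, which keeps multi-indices out of sight.\<close>

lemma smooth_fun_coinduct:
  assumes "P f"
    and step: "\<And>g. P g \<Longrightarrow> (\<forall>x. g differentiable (at x)) \<and> (\<forall>i. P (partial_deriv i g))"
  shows "smooth_fun f"
proof -
  have "P (iter_partial is f)" for "is"
    using assms by (induction "is") (auto simp: iter_partial_def)
  then show ?thesis
    using step by (auto simp: smooth_fun_def)
qed

lemma smooth_fun_differentiable: "smooth_fun f \<Longrightarrow> f differentiable (at x)"
  unfolding smooth_fun_def by (auto dest: spec[of _ "[]"] simp: iter_partial_def)

lemma smooth_fun_partial: "smooth_fun f \<Longrightarrow> smooth_fun (partial_deriv i f)"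
  unfolding smooth_fun_def
proof (intro allI)
  fix "is" x assume "\<forall>is x. iter_partial is f differentiable (at x)"
  then have "iter_partial (is @ [i]) f differentiable (at x)" by blast
  then show "iter_partial is (partial_deriv i f) differentiable (at x)"
    by (simp add: iter_partial_def)
qed

lemma partial_deriv_eq: "(f has_derivative f') (at x) \<Longrightarrow> partial_deriv i f x = f' (axis i 1)"
  unfolding partial_deriv_def by (metis frechet_derivative_at)

lemma smooth_fun_has_derivative:
  "smooth_fun f \<Longrightarrow> (f has_derivative frechet_derivative f (at x)) (at x)"
  using frechet_derivative_works smooth_fun_differentiable by blast

lemma smooth_fun_continuous: "smooth_fun f \<Longrightarrow> continuous_on UNIV f"
  by (simp add: continuous_at_imp_continuous_on differentiable_imp_continuous_within smooth_fun_differentiable)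

text \<open>The Leibniz rule turns a product into a sum of products; this is the closure of the smooth
  functions under both operations, hence closed under differentiation.\<close>

inductive smooth_alg :: "(real^'d::finite \<Rightarrow> complex) \<Rightarrow> bool" where
  base: "smooth_fun f \<Longrightarrow> smooth_alg f"
| add: "smooth_alg f \<Longrightarrow> smooth_alg g \<Longrightarrow> smooth_alg (\<lambda>x. f x + g x)"
| mult: "smooth_alg f \<Longrightarrow> smooth_alg g \<Longrightarrow> smooth_alg (\<lambda>x. f x * g x)"

lemma smooth_alg_step:
  "smooth_alg f \<Longrightarrow> (\<forall>x. f differentiable (at x)) \<and> (\<forall>i. smooth_alg (partial_deriv i f))"
proof (induction rule: smooth_alg.induct)
  case (base f)
  then show ?case using smooth_fun_differentiable smooth_fun_partial smooth_alg.base by blast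
next
  case (add f g)
  have D: "((\<lambda>x. f x + g x) has_derivative (\<lambda>h. frechet_derivative f (at x) h + frechet_derivative g (at x) h)) (at x)" for x
    using add.IH frechet_derivative_works by (intro derivative_intros) blast+
  have eq: "partial_deriv i (\<lambda>x. f x + g x) = (\<lambda>x. partial_deriv i f x + partial_deriv i g x)" for i
    by (rule ext) (subst partial_deriv_eq[OF D], simp add: partial_deriv_def)
  have "smooth_alg (\<lambda>x. partial_deriv i f x + partial_deriv i g x)" for i
    using add.IH by (intro smooth_alg.intros(2)) blast+
  then show ?case using D unfolding differentiable_def eq by blast
next
  case (mult f g)
  have D: "((\<lambda>x. f x * g x) has_derivative (\<lambda>h. f x * frechet_derivative g (at x) h + frechet_derivative f (at x) h * g x)) (at x)" for x
    using mult.IH frechet_derivative_works by (intro derivative_intros) blast+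
  have eq: "partial_deriv i (\<lambda>x. f x * g x) = (\<lambda>x. f x * partial_deriv i g x + partial_deriv i f x * g x)" for i
    by (rule ext) (subst partial_deriv_eq[OF D], simp add: partial_deriv_def)
  have "smooth_alg (\<lambda>x. f x * partial_deriv i g x + partial_deriv i f x * g x)" for i
    using mult.IH mult.hyps by (intro smooth_alg.intros(2,3)) blast+
  then show ?case using D unfolding differentiable_def eq by blast
qed

lemma smooth_fun_mult:
  fixes f g :: "real^'d::finite \<Rightarrow> complex"
  assumes "smooth_fun f" "smooth_fun g" shows "smooth_fun (\<lambda>x. f x * g x)"
  by (rule smooth_fun_coinduct[of smooth_alg, OF _ smooth_alg_step])
     (use assms in \<open>auto intro: smooth_alg.intros\<close>)

lemma smooth_fun_const: "smooth_fun (\<lambda>x::real^'d::finite. c::'b::real_normed_vector)"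
proof (rule smooth_fun_coinduct[of "\<lambda>f. \<exists>c. f = (\<lambda>x. c)"])
  fix g :: "real^'d \<Rightarrow> 'b" assume "\<exists>c. g = (\<lambda>x. c)"
  then obtain c where g: "g = (\<lambda>x. c)" by blast
  have "(g has_derivative (\<lambda>h. 0)) (at x)" for x unfolding g by (rule derivative_intros)
  then have "partial_deriv i g = (\<lambda>x. 0)" for i using partial_deriv_eq by blast
  then show "(\<forall>x. g differentiable at x) \<and> (\<forall>i. \<exists>c. partial_deriv i g = (\<lambda>x. c))"
    unfolding g by auto
qed blast

lemma smooth_fun_coord: "smooth_fun (\<lambda>x::real^'d::finite. complex_of_real (x $ m))"
proof (rule smooth_fun_coinduct[of "\<lambda>f. smooth_fun f \<or> f = (\<lambda>x::real^'d. complex_of_real (x $ m))"])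
  fix g assume g: "smooth_fun g \<or> g = (\<lambda>x::real^'d. complex_of_real (x $ m))"
  have D: "((\<lambda>x::real^'d. complex_of_real (x $ m)) has_derivative (\<lambda>h. complex_of_real (h $ m))) (at x)" for x
    by (intro derivative_intros bounded_linear.has_derivative[OF bounded_linear_of_real] bounded_linear_imp_has_derivative) (simp add: bounded_linear_vec_nth)
  have "partial_deriv i (\<lambda>x::real^'d. complex_of_real (x $ m)) = (\<lambda>x. complex_of_real (axis i 1 $ m))" for i
    by (rule ext) (rule partial_deriv_eq[OF D])
  then show "(\<forall>x. g differentiable at x) \<and> (\<forall>i. smooth_fun (partial_deriv i g) \<or> partial_deriv i g = (\<lambda>x. complex_of_real (x $ m)))"
    using g D unfolding differentiable_def by (metis smooth_fun_const smooth_fun_partial smooth_fun_differentiable differentiable_def)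
qed blast

lemma smooth_fun_of_real_affine:
  fixes \<phi> :: "real^'d::finite \<Rightarrow> real"
  assumes "smooth_fun \<phi>"
  shows "smooth_fun (\<lambda>x. complex_of_real (\<phi> (r *\<^sub>R (x - y))))"
proof (rule smooth_fun_coinduct[of "\<lambda>f. \<exists>c g. smooth_fun g \<and> f = (\<lambda>x. complex_of_real (c * g (r *\<^sub>R (x - y))))"])
  fix f :: "real^'d \<Rightarrow> complex" 
  assume "\<exists>c g. smooth_fun g \<and> f = (\<lambda>x. complex_of_real (c * g (r *\<^sub>R (x - y))))"
  then obtain c g where g: "smooth_fun g" and f: "f = (\<lambda>x. complex_of_real (c * g (r *\<^sub>R (x - y))))" by blast
  have D: "(f has_derivative (\<lambda>h. complex_of_real (c * frechet_derivative g (at (r *\<^sub>R (x - y))) (r *\<^sub>R h)))) (at x)" for x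
    unfolding f
    apply (rule has_derivative_of_real, rule has_derivative_mult_right)
    apply (rule has_derivative_compose[of "\<lambda>x. r *\<^sub>R (x - y)" _ x UNIV g, simplified])
     apply (auto intro!: derivative_eq_intros smooth_fun_has_derivative[OF g])
    done
  have "partial_deriv i f = (\<lambda>x. complex_of_real (c * r * partial_deriv i g (r *\<^sub>R (x - y))))" for i
  proof
    fix x
    interpret linear "frechet_derivative g (at (r *\<^sub>R (x - y)))"
      using linear_frechet_derivative smooth_fun_differentiable[OF g] by blast
    show "partial_deriv i f x = complex_of_real (c * r * partial_deriv i g (r *\<^sub>R (x - y)))"
      unfolding partial_deriv_eq[OF D] by (simp add: scale partial_deriv_def)
  qed
  then show "(\<forall>x. f differentiable at x) \<and> (\<forall>i. \<exists>c g. smooth_fun g \<and> partial_deriv i f = (\<lambda>x. complex_of_real (c * g (r *\<^sub>R (x - y)))))"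
    using D smooth_fun_partial[OF g] unfolding differentiable_def by blast
qed (use assms in \<open>auto intro!: exI[of _ 1] exI[of _ \<phi>]\<close>)

section \<open>Test functions\<close>

lemma test_function_support:
  assumes "test_function f"
  obtains R where "R > 0" "\<And>x. norm x \<ge> R \<Longrightarrow> f x = 0"
proof -
  obtain B where "\<And>x. f x \<noteq> 0 \<Longrightarrow> norm x \<le> B"
    using assms unfolding test_function_def bounded_iff by blast
  then have "f x = 0" if "norm x \<ge> \<bar>B\<bar> + 1" for x
    using that by (smt (verit))
  then show thesis using that[of "\<bar>B\<bar> + 1"] by force
qed

lemma test_functionI:
  assumes "smooth_fun f" "\<And>x. norm x > R \<Longrightarrow> f x = 0" shows "test_function f"
  using assms unfolding test_function_def bounded_iff by (metis (mono_tags, lifting) mem_Collect_eq not_le)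

lemma test_function_continuous: "test_function f \<Longrightarrow> continuous_on UNIV f"
  using smooth_fun_continuous test_function_def by blast

lemma test_function_coord:
  assumes "test_function f" shows "test_function (\<lambda>x. c * of_real (x $ m) * f x)"
proof -
  obtain R where R: "R > 0" "\<And>x. norm x \<ge> R \<Longrightarrow> f x = 0" using test_function_support[OF assms] by blast
  show ?thesis
    by (rule test_functionI[of _ R]) (use assms R in \<open>auto intro!: smooth_fun_mult smooth_fun_const smooth_fun_coord simp: test_function_def\<close>)
qed

lemma test_function_partial:
  assumes "test_function f" shows "test_function (partial_deriv i f)"
proof -
  obtain R where R: "R > 0" "\<And>x. norm x \<ge> R \<Longrightarrow> f x = 0" using test_function_support[OF assms] by blast
  show ?thesis
  proof (rule test_functionI[of _ R])
    fix x :: "real^'a" assume x: "norm x > R"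
    have "(f has_derivative (\<lambda>h. 0)) (at x)"
    proof (rule has_derivative_transform_within_open[of "\<lambda>_. 0"])
      show "open (- cball 0 R)" by (simp add: open_Compl)
      show "x \<in> - cball 0 R" using x by simp
    qed (use R in auto)
    then show "partial_deriv i f x = 0" using partial_deriv_eq by fastforce
  qed (use assms smooth_fun_partial in \<open>auto simp: test_function_def\<close>)
qed

text \<open>The Littlewood--Paley cut-off is smooth with compact support, so its dilates and translates
  supply all the test functions that the uniqueness of Fourier transforms requires.\<close>

lemma test_function_bump:
  assumes "littlewood_paley \<phi>" "r \<noteq> 0"
  shows "test_function (\<lambda>x. complex_of_real (\<phi> (r *\<^sub>R (x - y))))"
proof (rule test_functionI)
  show "smooth_fun (\<lambda>x. complex_of_real (\<phi> (r *\<^sub>R (x - y))))"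
    using assms smooth_fun_of_real_affine by (auto simp: littlewood_paley_def)
  show "complex_of_real (\<phi> (r *\<^sub>R (x - y))) = 0" if "norm x > norm y + 2 / \<bar>r\<bar>" for x
  proof -
    have "norm (x - y) > 2 / \<bar>r\<bar>" using that norm_triangle_ineq2[of x y] by linarith
    then have "norm (r *\<^sub>R (x - y)) > 2" using assms(2) unfolding norm_scaleR by (simp add: field_simps)
    then show ?thesis using assms(1) unfolding littlewood_paley_def by (metis not_less of_real_eq_0_iff)
  qed
qed

lemma test_function_integrable_mult:
  fixes h :: "real^'d::finite \<Rightarrow> complex"
  assumes "test_function f" "continuous_on UNIV h"
  shows "integrable lborel (\<lambda>x. h x * f x)"
proof -
  obtain R where R: "R > 0" "\<And>x. norm x \<ge> R \<Longrightarrow> f x = 0" using test_function_support[OF assms(1)] by blast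
  have "integrable lborel (\<lambda>x. indicator (cball 0 R) x *\<^sub>R (h x * f x))"
    by (rule borel_integrable_compact)
       (auto intro!: continuous_intros continuous_on_subset[OF assms(2)] continuous_on_subset[OF test_function_continuous[OF assms(1)]])
  also have "(\<lambda>x. indicator (cball 0 R) x *\<^sub>R (h x * f x)) = (\<lambda>x. h x * f x)"
    using R by (auto simp: indicator_def fun_eq_iff)
  finally show ?thesis .
qed

lemma test_function_integrable: "test_function f \<Longrightarrow> integrable lborel f"
  using test_function_integrable_mult[of f "\<lambda>_. 1"] by simp

lemma test_function_borel: "test_function f \<Longrightarrow> f \<in> borel_measurable borel"
  using test_function_continuous borel_measurable_continuous_onI by blast

lemma test_function_bounded:
  assumes "test_function f" obtains B where "\<And>x. norm (f x) \<le> B" "B \<ge> 0"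
proof -
  obtain R where R: "R > 0" "\<And>x. norm x \<ge> R \<Longrightarrow> f x = 0" using test_function_support[OF assms(1)] by blast
  have "compact (f ` cball 0 R)"
    by (intro compact_continuous_image continuous_on_subset[OF test_function_continuous[OF assms]]) auto
  then obtain B where B: "\<forall>y\<in>f ` cball 0 R. norm y \<le> B" using compact_imp_bounded bounded_iff by meson
  then have "norm (f x) \<le> \<bar>B\<bar>" for x
    by (cases "norm x \<le> R") (use R in \<open>force+\<close>)
  then show thesis using that by force
qed

section \<open>Fourier transforms of test functions\<close>

lemma norm_wave [simp]: "norm (exp (\<i> * complex_of_real t)) = 1"
  by (simp add: norm_exp_eq_Re)

lemma norm_cwave [simp]: "norm (exp (- (\<i> * complex_of_real t))) = 1"
  by (simp add: norm_exp_eq_Re)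

lemma wave_measurable [measurable]:
  "(\<lambda>x. exp (\<i> * complex_of_real (x \<bullet> \<xi>))) \<in> borel_measurable borel"
  "(\<lambda>x. exp (- (\<i> * complex_of_real (x \<bullet> \<xi>)))) \<in> borel_measurable borel"
  "(\<lambda>x. exp (\<i> * complex_of_real (\<xi> \<bullet> x))) \<in> borel_measurable borel"
  "(\<lambda>x. exp (- (\<i> * complex_of_real (\<xi> \<bullet> x)))) \<in> borel_measurable borel"
  by (intro borel_measurable_continuous_onI continuous_intros)+

abbreviation wave :: "'a::real_inner \<Rightarrow> 'a \<Rightarrow> complex" where
  "wave x \<xi> \<equiv> exp (\<i> * of_real (x \<bullet> \<xi>))"

abbreviation cwave :: "'a::real_inner \<Rightarrow> 'a \<Rightarrow> complex" where
  "cwave x \<xi> \<equiv> exp (- (\<i> * of_real (x \<bullet> \<xi>)))"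

abbreviation fourier_const :: "'d::finite itself \<Rightarrow> real" where
  "fourier_const _ \<equiv> (2 * pi) powr (- real CARD('d) / 2)"

lemma integrable_wave_mult:
  fixes f :: "real^'d::finite \<Rightarrow> complex"
  assumes "integrable lborel f"
  shows "integrable lborel (\<lambda>x. cwave x \<xi> * f x)"
    and "integrable lborel (\<lambda>x. wave x \<xi> * f x)"
    and "integrable lborel (\<lambda>x. wave \<xi> x * f x)"
proof -
  have [measurable]: "f \<in> borel_measurable borel" using assms borel_measurable_integrable by force
  show "integrable lborel (\<lambda>x. cwave x \<xi> * f x)"
    by (rule Bochner_Integration.integrable_bound[OF assms]) (auto simp: norm_mult)
  show "integrable lborel (\<lambda>x. exp ((\<i> * of_real (x \<bullet> \<xi>))) * f x)"
    by (rule Bochner_Integration.integrable_bound[OF assms]) (auto simp: norm_mult)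
  then show "integrable lborel (\<lambda>x. exp ((\<i> * of_real (\<xi> \<bullet> x))) * f x)"
    by (simp add: inner_commute)
qed

lemma fourier_bound:
  fixes f :: "real^'d::finite \<Rightarrow> complex"
  shows "norm (fourier f \<xi>) \<le> fourier_const TYPE('d) * (LINT x|lborel. norm (f x))"
    "norm (inv_fourier f \<xi>) \<le> fourier_const TYPE('d) * (LINT x|lborel. norm (f x))"
  unfolding fourier_def inv_fourier_def norm_mult norm_of_real
  by (auto intro!: mult_left_mono integral_norm_bound[THEN order_trans] simp: norm_mult)

text \<open>The quadratic remainder is what makes differentiation under the Fourier integral a direct
  estimate; \<open>a\<close> and \<open>b\<close> stand for \<open>x \<bullet> \<xi>\<close> and \<open>x \<bullet> h\<close>.\<close>

lemma exp_taylor2: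
  "norm (exp (- (\<i> * of_real (a + b))) - exp (- (\<i> * of_real a)) - exp (- (\<i> * of_real a)) * (- \<i> * of_real b)) \<le> b\<^sup>2 / 2"
proof -
  have "cmod (iexp (-b) - (\<Sum>k\<le>1. (\<i> * of_real (-b))^k / fact k)) \<le> \<bar>-b\<bar>^(Suc 1) / fact (Suc 1)"
    by (rule iexp_approx1)
  then have *: "cmod (exp (- (\<i> * of_real b)) - 1 + \<i> * of_real b) \<le> b\<^sup>2 / 2"
    by (simp add: algebra_simps power2_eq_square numeral_2_eq_2)
  have "exp (- (\<i> * of_real (a + b))) - exp (- (\<i> * of_real a)) - exp (- (\<i> * of_real a)) * (- \<i> * of_real b)
     = exp (- (\<i> * complex_of_real a)) * (exp (- (\<i> * of_real b)) - 1 + \<i> * of_real b)"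
    by (simp add: algebra_simps exp_add exp_diff exp_minus divide_inverse)
  then show ?thesis using * by (simp add: norm_mult)
qed

lemma fourier_has_derivative:
  fixes f :: "real^'d::finite \<Rightarrow> complex"
  assumes "test_function f"
  shows "(fourier f has_derivative (\<lambda>h. of_real (fourier_const TYPE('d)) *
      (LINT x|lborel. cwave x \<xi> * ((- \<i> * of_real (x \<bullet> h)) * f x)))) (at \<xi>)"
    (is "(_ has_derivative ?D) _")
proof -
  let ?c = "fourier_const TYPE('d)"
  have int0: "integrable lborel (\<lambda>x. cwave x \<xi> * f x)" for \<xi>
    by (intro integrable_wave_mult test_function_integrable assms)
  have int1: "integrable lborel (\<lambda>x. cwave x \<xi> * ((- \<i> * of_real (x \<bullet> h)) * f x))" for h
    by (intro integrable_wave_mult test_function_integrable_mult assms continuous_intros)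
  have int2: "integrable lborel (\<lambda>x. (of_real ((norm x)\<^sup>2 / 2) * f x))"
    by (intro test_function_integrable_mult assms continuous_intros) simp
  define C where "C = ?c * (LINT x|lborel. norm (of_real ((norm x)\<^sup>2 / 2) * f x))"
  have "linear ?D"
  proof (rule linearI)
    fix h k :: "real^'d"
    have "(LINT x|lborel. cwave x \<xi> * ((- \<i> * of_real (x \<bullet> (h + k))) * f x))
      = (LINT x|lborel. cwave x \<xi> * ((- \<i> * of_real (x \<bullet> h)) * f x)
         + cwave x \<xi> * ((- \<i> * of_real (x \<bullet> k)) * f x))"
      by (simp add: inner_add_right algebra_simps)
    also have "\<dots> = (LINT x|lborel. cwave x \<xi> * ((- \<i> * of_real (x \<bullet> h)) * f x))
       + (LINT x|lborel. cwave x \<xi> * ((- \<i> * of_real (x \<bullet> k)) * f x))"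
      by (rule Bochner_Integration.integral_add[OF int1 int1])
    finally show "?D (h + k) = ?D h + ?D k" by (simp only: distrib_left)
  next
    fix r :: real and h :: "real^'d"
    have "(LINT x|lborel. cwave x \<xi> * ((- \<i> * of_real (x \<bullet> (r *\<^sub>R h))) * f x))
      = (LINT x|lborel. of_real r * (cwave x \<xi> * ((- \<i> * of_real (x \<bullet> h)) * f x)))"
      by (simp add: algebra_simps)
    also have "\<dots> = of_real r * (LINT x|lborel. (cwave x \<xi> * ((- \<i> * of_real (x \<bullet> h)) * f x)))"
      by (rule integral_mult_right_zero)
    finally show "?D (r *\<^sub>R h) = r *\<^sub>R ?D h" by (simp add: algebra_simps scaleR_conv_of_real)
  qed
  then have bl: "bounded_linear ?D" by (simp add: linear_conv_bounded_linear)
  have rem: "norm (fourier f \<eta> - fourier f \<xi> - ?D (\<eta> - \<xi>)) \<le> C * (norm (\<eta> - \<xi>))\<^sup>2" for \<eta>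
  proof -
    have "fourier f \<eta> - fourier f \<xi> - ?D (\<eta> - \<xi>) = of_real ?c * (LINT x|lborel.
       cwave x \<eta> * f x - cwave x \<xi> * f x
       - cwave x \<xi> * ((- \<i> * of_real (x \<bullet> (\<eta> - \<xi>))) * f x))"
      using int0 int1 by (simp add: fourier_def algebra_simps)
    also have "norm \<dots> \<le> ?c * (LINT x|lborel. (norm (\<eta> - \<xi>))\<^sup>2 * norm (of_real ((norm x)\<^sup>2 / 2) * f x))"
      unfolding norm_mult norm_of_real abs_of_nonneg[OF powr_ge_zero]
    proof (intro mult_left_mono integral_norm_bound[THEN order_trans] integral_mono)
      fix x
      have "norm (exp (- (\<i> * of_real (x \<bullet> \<xi> + x \<bullet> (\<eta> - \<xi>)))) - cwave x \<xi>
            - cwave x \<xi> * (- \<i> * of_real (x \<bullet> (\<eta> - \<xi>)))) \<le> (x \<bullet> (\<eta> - \<xi>))\<^sup>2 / 2"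
        by (rule exp_taylor2)
      also have "(x \<bullet> (\<eta> - \<xi>))\<^sup>2 \<le> (norm x * norm (\<eta> - \<xi>))\<^sup>2"
        by (rule abs_le_square_iff[THEN iffD1]) (simp add: Cauchy_Schwarz_ineq2)
      finally have b: "norm (exp (- (\<i> * of_real (x \<bullet> \<xi> + x \<bullet> (\<eta> - \<xi>)))) - cwave x \<xi>
            - cwave x \<xi> * (- \<i> * of_real (x \<bullet> (\<eta> - \<xi>)))) \<le> (norm x * norm (\<eta> - \<xi>))\<^sup>2 / 2"
        by simp
      have "norm ((exp (- (\<i> * of_real (x \<bullet> \<xi> + x \<bullet> (\<eta> - \<xi>)))) - cwave x \<xi>
            - cwave x \<xi> * (- \<i> * of_real (x \<bullet> (\<eta> - \<xi>)))) * f x)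
          \<le> (norm x * norm (\<eta> - \<xi>))\<^sup>2 / 2 * norm (f x)"
        unfolding norm_mult[of _ "f x"] by (rule mult_right_mono[OF b]) simp
      also have "x \<bullet> \<xi> + x \<bullet> (\<eta> - \<xi>) = x \<bullet> \<eta>" by (simp add: inner_diff_right)
      also have "(norm x * norm (\<eta> - \<xi>))\<^sup>2 / 2 * norm (f x) = (norm (\<eta> - \<xi>))\<^sup>2 * (\<bar>(norm x)\<^sup>2 / 2\<bar> * norm (f x))"
        by (simp add: power_mult_distrib)
      finally show "norm (cwave x \<eta> * f x - cwave x \<xi> * f x
       - cwave x \<xi> * ((- \<i> * of_real (x \<bullet> (\<eta> - \<xi>))) * f x)) 
        \<le> (norm (\<eta> - \<xi>))\<^sup>2 * (\<bar>(norm x)\<^sup>2 / 2\<bar> * norm (f x))"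
        by (simp only: left_diff_distrib mult.assoc)
    next
      show "integrable lborel (\<lambda>x. (norm (\<eta> - \<xi>))\<^sup>2 * (\<bar>(norm x)\<^sup>2 / 2\<bar> * norm (f x)))"
        using integrable_mult_right[OF integrable_norm[OF int2], of "(norm (\<eta> - \<xi>))\<^sup>2"] by (simp only: norm_mult norm_of_real)
    qed (rule powr_ge_zero | intro integrable_norm Bochner_Integration.integrable_diff int0 int1)+
    also have "\<dots> = C * (norm (\<eta> - \<xi>))\<^sup>2" unfolding C_def by simp
    finally show ?thesis .
  qed
  show ?thesis
    unfolding has_derivative_iff_norm
  proof (intro conjI bl, rule Lim_null_comparison)
    show "((\<lambda>\<eta>. C * norm (\<eta> - \<xi>)) \<longlongrightarrow> 0) (at \<xi>)"
      by (auto intro!: tendsto_eq_intros)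
    show "\<forall>\<^sub>F \<eta> in at \<xi>. norm (norm (fourier f \<eta> - fourier f \<xi> - ?D (\<eta> - \<xi>)) / norm (\<eta> - \<xi>)) \<le> C * norm (\<eta> - \<xi>)"
      unfolding eventually_at_filter using rem by (intro always_eventually) (auto simp: field_simps power2_eq_square)
  qed
qed

lemma partial_deriv_fourier:
  fixes f :: "real^'d::finite \<Rightarrow> complex"
  assumes "test_function f"
  shows "partial_deriv i (fourier f) = fourier (\<lambda>x. - \<i> * of_real (x $ i) * f x)"
  by (rule ext) (subst partial_deriv_eq[OF fourier_has_derivative[OF assms]],
      simp add: fourier_def inner_axis mult.assoc)

text \<open>Each derivative only multiplies the test function by a coordinate, so the iterated derivatives
  of a transform are again transforms of test functions.\<close>

lemma iter_partial_fourier: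
  fixes f :: "real^'d::finite \<Rightarrow> complex"
  assumes "test_function f"
  shows "\<exists>g. test_function g \<and> iter_partial is (fourier f) = fourier g"
proof (induction "is")
  case (Cons i "is")
  then obtain g where "test_function g" "iter_partial is (fourier f) = fourier g" by blast
  then show ?case using partial_deriv_fourier[of g i] test_function_coord[of g "- \<i>" i]
    by (auto simp: iter_partial_def)
qed (use assms in \<open>auto simp: iter_partial_def\<close>)

text \<open>For a function that is not measurable both integrals take the default value \<open>0\<close>, so
  measurability need not be tracked at each translation.\<close>

lemma lborel_integral_translate:
  fixes f :: "'a::euclidean_space \<Rightarrow> 'b::{banach, second_countable_topology}"
  shows "(LINT x|lborel. f (x + a)) = (LINT x|lborel. f x)"
proof -
  have "(LINT x|lborel. f x) = (LINT x|distr lborel borel ((+) a). f x)"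
    by (simp add: lborel_distr_plus)
  also have "\<dots> = (LINT x|lborel. f (a + x))"
  proof (cases "f \<in> borel_measurable borel")
    case True then show ?thesis by (intro integral_distr) auto
  next
    case False
    have "(\<lambda>x. f (a + x)) \<notin> borel_measurable borel"
    proof
      assume "(\<lambda>x. f (a + x)) \<in> borel_measurable borel"
      then have "(\<lambda>x. f (a + (x - a))) \<in> borel_measurable borel" by measurable
      then show False using False by simp
    qed
    then have "\<not> integrable lborel (\<lambda>x. f (a + x))" "\<not> integrable lborel f"
      using False borel_measurable_integrable by force+
    then show ?thesis by (simp add: not_integrable_integral_eq lborel_distr_plus)
  qed
  finally show ?thesis by (simp add: add.commute)
qed

text \<open>Translating by \<open>h\<close> in direction \<open>i\<close> multiplies the transform by \<open>e\<^sup>i\<^sup>h\<^sup>\<xi>\<close> (\<open>\<xi>\<close> for the \<open>i\<close>-th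
  component), so the difference quotients of \<open>f\<close> have explicit transforms; dominated convergence
  as \<open>h\<close> tends to \<open>0\<close> gives the formula without integration by parts.\<close>

lemma fourier_partial_deriv:
  fixes f :: "real^'d::finite \<Rightarrow> complex"
  assumes f: "test_function f"
  shows "fourier (partial_deriv i f) \<xi> = \<i> * of_real (\<xi> $ i) * fourier f \<xi>"
proof -
  define e :: "real^'d" where "e = axis i 1"
  define h where "h n = 1 / real (Suc n)" for n
  have h: "h \<longlonglongrightarrow> 0" "\<And>n. h n > 0" "\<And>n. h n \<le> 1"
    unfolding h_def using LIMSEQ_inverse_real_of_nat by (auto simp: inverse_eq_divide)
  have [simp]: "norm e = 1" by (simp add: e_def)
  obtain R where R: "R > 0" "\<And>x. norm x \<ge> R \<Longrightarrow> f x = 0" using test_function_support[OF f] by blast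
  have sf: "smooth_fun f" using f test_function_def by blast
  have D: "(f has_derivative frechet_derivative f (at x)) (at x)" for x
    using smooth_fun_has_derivative[OF sf] .
  have De: "((\<lambda>s. f (x + s *\<^sub>R e)) has_vector_derivative partial_deriv i f (x + s *\<^sub>R e)) (at s within S)" for x s S
  proof -
    interpret linear "frechet_derivative f (at (x + s *\<^sub>R e))"
      using linear_frechet_derivative smooth_fun_differentiable[OF sf] by blast
    have "((\<lambda>s. f (x + s *\<^sub>R e)) has_derivative (\<lambda>r. frechet_derivative f (at (x + s *\<^sub>R e)) (r *\<^sub>R e))) (at s within S)"
      by (rule has_derivative_compose[of "\<lambda>s. x + s *\<^sub>R e" _ s S f, OF _ D]) (auto intro!: derivative_eq_intros)
    then show ?thesis unfolding has_vector_derivative_def partial_deriv_def e_def[symmetric] by (simp add: scale)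
  qed
  obtain B where B: "\<And>x. norm (partial_deriv i f x) \<le> B" "B \<ge> 0"
    using test_function_bounded[OF test_function_partial[OF f]] by blast
  define q where "q n x = (f (x + h n *\<^sub>R e) - f x) / of_real (h n)" for n x
  have q_lim: "(\<lambda>n. q n x) \<longlonglongrightarrow> partial_deriv i f x" for x
  proof -
    have "((\<lambda>s. norm (f (x + (0 + s) *\<^sub>R e) - f (x + 0 *\<^sub>R e) - s *\<^sub>R partial_deriv i f (x + 0 *\<^sub>R e)) / norm s) \<longlongrightarrow> 0) (at 0)"
      by (rule conjunct2[OF De[of x 0 UNIV, unfolded has_vector_derivative_def has_derivative_at]])
    moreover have "filterlim h (at 0) sequentially"
      using h by (simp add: filterlim_at less_imp_neq[symmetric] order.strict_implies_not_eq)
    ultimately have "(\<lambda>n. norm (f (x + (0 + h n) *\<^sub>R e) - f (x + 0 *\<^sub>R e) - h n *\<^sub>R partial_deriv i f (x + 0 *\<^sub>R e)) / norm (h n)) \<longlonglongrightarrow> 0"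
      by (rule filterlim_compose)
    also have "(\<lambda>n. norm (f (x + (0 + h n) *\<^sub>R e) - f (x + 0 *\<^sub>R e) - h n *\<^sub>R partial_deriv i f (x + 0 *\<^sub>R e)) / norm (h n))
       = (\<lambda>n. norm (q n x - partial_deriv i f x))"
    proof
      fix n
      have "q n x - partial_deriv i f x = (f (x + (0 + h n) *\<^sub>R e) - f (x + 0 *\<^sub>R e) - h n *\<^sub>R partial_deriv i f (x + 0 *\<^sub>R e)) / of_real (h n)"
        using h(2)[of n] by (simp add: q_def scaleR_conv_of_real diff_divide_distrib)
      then show "norm (f (x + (0 + h n) *\<^sub>R e) - f (x + 0 *\<^sub>R e) - h n *\<^sub>R partial_deriv i f (x + 0 *\<^sub>R e)) / norm (h n) = norm (q n x - partial_deriv i f x)"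
        by (simp only: norm_divide norm_of_real real_norm_def)
    qed
    finally have "(\<lambda>n. q n x - partial_deriv i f x) \<longlonglongrightarrow> 0" by (rule tendsto_norm_zero_cancel)
    then show ?thesis by (rule LIM_zero_cancel)
  qed
  have q_bound: "norm (q n x) \<le> B * indicator (cball 0 (R + 1)) x" for n x
  proof (cases "norm x \<le> R + 1")
    case True
    have "norm (f (x + h n *\<^sub>R e) - f (x + 0 *\<^sub>R e)) \<le> B * norm (h n - 0)"
    proof (rule differentiable_bound[of "{0..h n}" "\<lambda>s. f (x + s *\<^sub>R e)" "\<lambda>s r. r *\<^sub>R partial_deriv i f (x + s *\<^sub>R e)"])
      show "((\<lambda>s. f (x + s *\<^sub>R e)) has_derivative (\<lambda>r. r *\<^sub>R partial_deriv i f (x + s *\<^sub>R e))) (at s within {0..h n})" for s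
        using De unfolding has_vector_derivative_def .
      show "onorm (\<lambda>r. r *\<^sub>R partial_deriv i f (x + s *\<^sub>R e)) \<le> B" for s
        
      proof (rule onorm_bound[OF B(2)])
        fix r :: real
        have "norm (r *\<^sub>R partial_deriv i f (x + s *\<^sub>R e)) = norm (partial_deriv i f (x + s *\<^sub>R e)) * norm r" by simp
        also have "\<dots> \<le> B * norm r" by (rule mult_right_mono[OF B(1)]) simp
        finally show "norm (r *\<^sub>R partial_deriv i f (x + s *\<^sub>R e)) \<le> B * norm r" .
      qed
    qed (use h(2)[of n] in auto)
    then have "norm (q n x) \<le> B" using h(2)[of n] by (simp add: q_def norm_divide field_simps)
    then show ?thesis using True by simp
  next
    case False
    then have "norm (x + h n *\<^sub>R e) \<ge> R" using norm_triangle_ineq2[of x "- (h n *\<^sub>R e)"] h(2,3)[of n] by simp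
    then show ?thesis using False R by (simp add: q_def)
  qed
  have fm [measurable]: "f \<in> borel_measurable borel" using test_function_borel[OF f] .
  have [measurable]: "partial_deriv i f \<in> borel_measurable borel"
    using test_function_borel[OF test_function_partial[OF f]] .
  have "(\<lambda>n. LINT x|lborel. cwave x \<xi> * q n x) \<longlonglongrightarrow> (LINT x|lborel. cwave x \<xi> * partial_deriv i f x)"
  proof (rule integral_dominated_convergence[where w="\<lambda>x. B * indicator (cball 0 (R + 1)) x"])
    show "integrable lborel (\<lambda>x. B * indicator (cball 0 (R + 1)) x)"
      by (intro integrable_mult_right integrable_real_indicator emeasure_lborel_cball_finite) simp
    show "AE x in lborel. (\<lambda>n. cwave x \<xi> * q n x) \<longlonglongrightarrow> cwave x \<xi> * partial_deriv i f x"
      using q_lim by (auto intro!: tendsto_intros)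
    show "AE x in lborel. norm (cwave x \<xi> * q n x) \<le> B * indicator (cball 0 (R + 1)) x" for n
      using q_bound by (simp add: norm_mult)
  qed (auto simp: q_def[abs_def])
  moreover have "(LINT x|lborel. cwave x \<xi> * q n x)
     = (exp (\<i> * of_real (h n * \<xi> $ i)) - 1) / of_real (h n) * (LINT x|lborel. cwave x \<xi> * f x)" for n
  proof -
    let ?F = "LINT x|lborel. cwave x \<xi> * f x"
    have 1: "integrable lborel (\<lambda>x. cwave x \<xi> * f x)"
      by (intro integrable_wave_mult test_function_integrable f)
    have 2: "integrable lborel (\<lambda>x. cwave (x + h n *\<^sub>R e) \<xi> * f (x + h n *\<^sub>R e))"
    proof -
      have "integrable (distr lborel borel ((+) (h n *\<^sub>R e))) (\<lambda>x. cwave x \<xi> * f x)"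
        using 1 by (simp add: lborel_distr_plus)
      then show ?thesis by (subst (asm) integrable_distr_eq) (auto simp: add.commute)
    qed
    have "cwave x \<xi> * q n x = 
       (exp (\<i> * of_real (h n * \<xi> $ i)) * (cwave (x + h n *\<^sub>R e) \<xi> * f (x + h n *\<^sub>R e))
        - cwave x \<xi> * f x) / of_real (h n)" for x
      by (simp add: q_def e_def inner_add_left inner_axis' exp_add[symmetric] algebra_simps diff_divide_distrib add_divide_distrib)
    then have "(LINT x|lborel. cwave x \<xi> * q n x) =
       (exp (\<i> * of_real (h n * \<xi> $ i)) * (LINT x|lborel. (cwave (x + h n *\<^sub>R e) \<xi> * f (x + h n *\<^sub>R e))) - ?F) / of_real (h n)"
      using 1 2 by simp
    also have "(LINT x|lborel. (cwave (x + h n *\<^sub>R e) \<xi> * f (x + h n *\<^sub>R e))) = ?F"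
      by (rule lborel_integral_translate)
    finally show ?thesis by (simp add: algebra_simps diff_divide_distrib)
  qed
  moreover have "(\<lambda>n. (exp (\<i> * of_real (h n * \<xi> $ i)) - 1) / of_real (h n) * (LINT x|lborel. cwave x \<xi> * f x))
     \<longlonglongrightarrow> \<i> * of_real (\<xi> $ i) * (LINT x|lborel. cwave x \<xi> * f x)"
  proof (intro tendsto_intros)
    have "((\<lambda>z. exp (\<i> * of_real (\<xi> $ i) * z)) has_field_derivative \<i> * of_real (\<xi> $ i)) (at 0)"
      by (auto intro!: derivative_eq_intros)
    then have "((\<lambda>z. (exp (\<i> * of_real (\<xi> $ i) * z) - 1) / z) \<longlongrightarrow> \<i> * of_real (\<xi> $ i)) (at 0)"
      by (simp add: has_field_derivative_iff)
    moreover have "filterlim (\<lambda>n. complex_of_real (h n)) (at 0) sequentially"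
      using h(1) h(2) by (auto simp: filterlim_at less_imp_neq[symmetric] tendsto_of_real_iff[symmetric, where 'a=complex] order.strict_implies_not_eq)
    ultimately have "(\<lambda>n. (exp (\<i> * of_real (\<xi> $ i) * of_real (h n)) - 1) / of_real (h n)) \<longlonglongrightarrow> \<i> * of_real (\<xi> $ i)"
      by (rule filterlim_compose)
    then show "(\<lambda>n. (exp (\<i> * of_real (h n * \<xi> $ i)) - 1) / of_real (h n)) \<longlonglongrightarrow> \<i> * of_real (\<xi> $ i)"
      by (simp add: ac_simps)
  qed
  ultimately have "(LINT x|lborel. cwave x \<xi> * partial_deriv i f x) = \<i> * of_real (\<xi> $ i) * (LINT x|lborel. cwave x \<xi> * f x)"
    using LIMSEQ_unique by simp
  then show ?thesis by (simp add: fourier_def)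
qed

text \<open>Each power of \<open>\<bar>\<xi>\<bar>\<close> is absorbed by a derivative of \<open>f\<close>, since \<open>\<bar>\<xi>\<bar>\<close> is at most the sum of the
  \<open>\<bar>\<xi>\<^sub>i\<bar>\<close>.\<close>

lemma fourier_test_decay:
  fixes f :: "real^'d::finite \<Rightarrow> complex"
  assumes "test_function f"
  shows "\<exists>C. \<forall>\<xi>. (1 + norm \<xi>) ^ N * norm (fourier f \<xi>) \<le> C"
  using assms
proof (induction N arbitrary: f)
  case 0
  then show ?case using fourier_bound(1)[of f] by auto
next
  case (Suc N)
  have "\<forall>i. \<exists>C. \<forall>\<xi>. (1 + norm \<xi>) ^ N * norm (fourier (partial_deriv i f) \<xi>) \<le> C"
    using Suc.IH[OF test_function_partial[OF Suc.prems]] by blast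
  then obtain C where C: "\<And>i \<xi>. (1 + norm \<xi>) ^ N * norm (fourier (partial_deriv i f) \<xi>) \<le> C i" by metis
  obtain C0 where C0: "\<And>\<xi>. (1 + norm \<xi>) ^ N * norm (fourier f \<xi>) \<le> C0" using Suc by blast
  show ?case
  proof (intro exI allI)
    fix \<xi> :: "real^'d"
    have "(1 + norm \<xi>) ^ Suc N * norm (fourier f \<xi>) = (1 + norm \<xi>) * ((1 + norm \<xi>) ^ N * norm (fourier f \<xi>))"
      by simp
    also have "\<dots> \<le> (1 + (\<Sum>i\<in>UNIV. \<bar>\<xi> $ i\<bar>)) * ((1 + norm \<xi>) ^ N * norm (fourier f \<xi>))"
      using norm_le_l1_cart[of \<xi>] by (intro mult_right_mono) auto
    also have "\<dots> = (1 + norm \<xi>) ^ N * norm (fourier f \<xi>) + (\<Sum>i\<in>UNIV. (1 + norm \<xi>) ^ N * norm (fourier (partial_deriv i f) \<xi>))"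
      by (simp add: fourier_partial_deriv[OF Suc.prems] norm_mult distrib_left sum_distrib_left mult_ac)
    also have "\<dots> \<le> C0 + (\<Sum>i\<in>UNIV. C i)" by (intro add_mono sum_mono C C0)
    finally show "(1 + norm \<xi>) ^ Suc N * norm (fourier f \<xi>) \<le> C0 + (\<Sum>i\<in>UNIV. C i)" .
  qed
qed

text \<open>The Fourier transform of a distribution is read off from its values at \<open>fourier f\<close>, \<open>f\<close> a test
  function, whereas mild solutions are tested against Schwartz functions; this connects the two.\<close>

lemma schwartz_fourier:
  fixes f :: "real^'d::finite \<Rightarrow> complex"
  assumes "test_function f"
  shows "schwartz (fourier f)"
  unfolding schwartz_def
proof (intro conjI allI)
  show "smooth_fun (fourier f)"
  proof (rule smooth_fun_coinduct[of "\<lambda>h. \<exists>g. test_function g \<and> h = fourier g"])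
    fix h :: "real^'d \<Rightarrow> complex" assume "\<exists>g. test_function g \<and> h = fourier g"
    then obtain g where g: "test_function g" "h = fourier g" by blast
    then show "(\<forall>x. h differentiable at x) \<and> (\<forall>i. \<exists>g. test_function g \<and> partial_deriv i h = fourier g)"
      using fourier_has_derivative[OF g(1)] partial_deriv_fourier[OF g(1)] test_function_coord[OF g(1), of "- \<i>"]
      unfolding differentiable_def by blast
  qed (use assms in blast)
  fix "is" :: "'d list" and N
  obtain g where g: "test_function g" "iter_partial is (fourier f) = fourier g"
    using iter_partial_fourier[OF assms] by blast
  obtain C where "\<And>\<xi>. (1 + norm \<xi>) ^ N * norm (fourier g \<xi>) \<le> C" using fourier_test_decay[OF g(1)] by blast
  then show "bounded (range (\<lambda>x. (1 + norm x) ^ N *\<^sub>R iter_partial is (fourier f) x))"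
    unfolding g bounded_iff by auto
qed

section \<open>Gaussians and power weights\<close>

lemma lborel_integral_affine:
  fixes f :: "'a::euclidean_space \<Rightarrow> 'b::{banach, second_countable_topology}"
  assumes [measurable]: "f \<in> borel_measurable borel" and "c \<noteq> 0"
  shows "(LINT x|lborel. f x) = \<bar>c\<bar> ^ DIM('a) *\<^sub>R (LINT x|lborel. f (t + c *\<^sub>R x))"
  by (subst lborel_affine[OF assms(2), of t]) (simp add: integral_density integral_distr)

lemma lborel_nn_integral_affine:
  fixes f :: "'a::euclidean_space \<Rightarrow> ennreal"
  assumes [measurable]: "f \<in> borel_measurable borel" and "c \<noteq> 0"
  shows "(\<integral>\<^sup>+x. f x \<partial>lborel) = ennreal (\<bar>c\<bar> ^ DIM('a)) * (\<integral>\<^sup>+x. f (t + c *\<^sub>R x) \<partial>lborel)"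
  by (subst lborel_affine[OF assms(2), of t]) (simp add: nn_integral_density nn_integral_distr nn_integral_cmult)

lemma lborel_integrable_affine:
  fixes f :: "'a::euclidean_space \<Rightarrow> 'b::{banach, second_countable_topology}"
  assumes f: "integrable lborel f" and c: "c \<noteq> 0"
  shows "integrable lborel (\<lambda>x. f (t + c *\<^sub>R x))"
proof -
  have [measurable]: "f \<in> borel_measurable borel" using borel_measurable_integrable[OF f] by simp
  have "integrable (density (distr lborel borel (\<lambda>x. t + c *\<^sub>R x)) (\<lambda>_. \<bar>c\<bar>^DIM('a))) f"
    using f lborel_affine[OF c, of t] by simp
  then have "integrable lborel (\<lambda>x. \<bar>c\<bar>^DIM('a) *\<^sub>R f (t + c *\<^sub>R x))"
    by (simp add: integrable_density integrable_distr_eq)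
  then have "integrable lborel (\<lambda>x. (1 / \<bar>c\<bar>^DIM('a)) *\<^sub>R (\<bar>c\<bar>^DIM('a) *\<^sub>R f (t + c *\<^sub>R x)))"
    by (rule integrable_scaleR_right)
  then show ?thesis using c by simp
qed

lemma lborel_prod_integral:
  fixes f :: "'a::euclidean_space \<Rightarrow> real \<Rightarrow> complex"
  assumes f: "\<And>b. b \<in> Basis \<Longrightarrow> integrable lborel (f b)"
  shows "integrable lborel (\<lambda>x. \<Prod>b\<in>Basis. f b (x \<bullet> b))"
    and "(LINT x|lborel. (\<Prod>b\<in>Basis. f b (x \<bullet> b))) = (\<Prod>b\<in>Basis. LINT s|lborel. f b s)"
proof -
  interpret product_sigma_finite "\<lambda>_::'a. lborel :: real measure"
    by standard
  have [measurable]: "\<And>b. b \<in> Basis \<Longrightarrow> f b \<in> borel_measurable borel"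
    using borel_measurable_integrable[OF f] by simp
  have eq: "(\<Prod>b\<in>Basis. f b ((\<Sum>b\<in>Basis. x b *\<^sub>R b) \<bullet> b)) = (\<Prod>b\<in>Basis. f b (x b))" for x :: "'a \<Rightarrow> real"
    by (intro prod.cong) simp_all
  show "integrable lborel (\<lambda>x. \<Prod>b\<in>Basis. f b (x \<bullet> b))"
    by (subst lborel_eq, subst integrable_distr_eq) (auto simp: eq intro!: product_integrable_prod f)
  show "(LINT x|lborel. (\<Prod>b\<in>Basis. f b (x \<bullet> b))) = (\<Prod>b\<in>Basis. LINT s|lborel. f b s)"
    by (subst lborel_eq, subst integral_distr) (auto simp: eq intro!: product_integral_prod f)
qed

text \<open>The standard Gaussian without its normalising factor, so that it is \<open>1\<close> at the origin.\<close>

definition gauss :: "'a::euclidean_space \<Rightarrow> real" where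
  "gauss x = exp (- (norm x)\<^sup>2 / 2)"

lemma gauss_measurable [measurable]: "gauss \<in> borel_measurable borel"
  unfolding gauss_def[abs_def] by measurable

lemma gauss_props [simp]: "gauss x > 0" "gauss x \<ge> 0" "gauss x \<le> 1" "gauss (- x) = gauss x"
  by (auto simp: gauss_def)

lemma gauss_prod: "gauss x = (\<Prod>b\<in>Basis. gauss (x \<bullet> b))"
proof -
  have "- (norm x)\<^sup>2 / 2 = (\<Sum>b\<in>Basis. - (norm (x \<bullet> b))\<^sup>2 / 2)"
    unfolding power2_norm_eq_inner by (subst euclidean_inner) (simp add: sum_negf sum_divide_distrib power2_eq_square)
  then show ?thesis unfolding gauss_def by (simp add: exp_sum)
qed

text \<open>This is the characteristic function of the standard normal distribution.\<close>

lemma gauss_fourier_1D: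
  "integrable lborel (\<lambda>s::real. exp (\<i> * complex_of_real (x * s)) * complex_of_real (gauss s))"
  "(LINT s|lborel. exp (\<i> * complex_of_real (x * s)) * complex_of_real (gauss s)) = complex_of_real (sqrt (2 * pi) * gauss x)"
proof -
  have g: "std_normal_density s = gauss s / sqrt (2 * pi)" for s
    by (simp add: normal_density_def gauss_def)
  have g': "complex_of_real (gauss s) = complex_of_real (sqrt (2 * pi)) * complex_of_real (std_normal_density s)" for s
    by (simp add: g)
  interpret real_distribution std_normal_distribution by (rule real_dist_normal_dist)
  have "integrable std_normal_distribution (\<lambda>s. iexp (x * s))" by (rule integrable_iexp) auto
  then have i: "integrable lborel (\<lambda>s. std_normal_density s *\<^sub>R iexp (x * s))"
    by (subst (asm) integrable_density) (auto simp: normal_density_nonneg)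
  then have "integrable lborel (\<lambda>s. complex_of_real (sqrt (2 * pi)) * (std_normal_density s *\<^sub>R iexp (x * s)))"
    by (rule integrable_mult_right)
  then show "integrable lborel (\<lambda>s::real. exp (\<i> * complex_of_real (x * s)) * complex_of_real (gauss s))"
    unfolding g' by (simp add: scaleR_conv_of_real mult_ac)
  have "(LINT s|lborel. exp (\<i> * complex_of_real (x * s)) * complex_of_real (gauss s))
     = (LINT s|lborel. complex_of_real (sqrt (2 * pi)) * (std_normal_density s *\<^sub>R iexp (x * s)))"
    unfolding g' by (simp add: scaleR_conv_of_real mult_ac)
  also have "\<dots> = complex_of_real (sqrt (2 * pi)) * (LINT s|lborel. std_normal_density s *\<^sub>R iexp (x * s))"
    by (rule integral_mult_right_zero)
  also have "(LINT s|lborel. std_normal_density s *\<^sub>R iexp (x * s)) = char std_normal_distribution x"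
    unfolding char_def by (subst integral_density) (auto simp: normal_density_nonneg)
  also have "\<dots> = complex_of_real (gauss x)" by (simp add: char_std_normal_distribution gauss_def)
  finally show "(LINT s|lborel. exp (\<i> * complex_of_real (x * s)) * complex_of_real (gauss s)) = complex_of_real (sqrt (2 * pi) * gauss x)"
    by simp
qed

lemma gauss_fourier:
  fixes x :: "'a::euclidean_space"
  shows "integrable lborel (\<lambda>\<xi>. wave x \<xi> * complex_of_real (gauss \<xi>))"
  "(LINT \<xi>|lborel. wave x \<xi> * complex_of_real (gauss \<xi>)) = complex_of_real ((2 * pi) powr (DIM('a) / 2) * gauss x)"
proof -
  have eq: "wave x \<xi> * complex_of_real (gauss \<xi>) = 
    (\<Prod>b\<in>Basis. exp (\<i> * complex_of_real ((x \<bullet> b) * (\<xi> \<bullet> b))) * complex_of_real (gauss (\<xi> \<bullet> b)))" for \<xi>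
    unfolding prod.distrib of_real_prod[symmetric] gauss_prod[symmetric] 
    by (subst euclidean_inner) (simp add: exp_sum[symmetric] sum_distrib_left)
  show "integrable lborel (\<lambda>\<xi>. wave x \<xi> * complex_of_real (gauss \<xi>))"
    unfolding eq by (rule lborel_prod_integral) (rule gauss_fourier_1D)
  have "(LINT \<xi>|lborel. wave x \<xi> * complex_of_real (gauss \<xi>)) 
    = (\<Prod>b\<in>(Basis::'a set). LINT s|lborel. exp (\<i> * complex_of_real ((x \<bullet> b) * s)) * complex_of_real (gauss s))"
    unfolding eq by (rule lborel_prod_integral) (rule gauss_fourier_1D)
  also have "\<dots> = complex_of_real (sqrt (2 * pi) ^ DIM('a) * gauss x)"
    unfolding gauss_fourier_1D(2) of_real_prod[symmetric] prod.distrib gauss_prod[of x] by simp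
  also have "sqrt (2 * pi) ^ DIM('a) = (2 * pi) powr (DIM('a) / 2)"
    by (simp add: powr_half_sqrt[symmetric] powr_realpow[symmetric] powr_powr)
  finally show "(LINT \<xi>|lborel. wave x \<xi> * complex_of_real (gauss \<xi>)) = complex_of_real ((2 * pi) powr (DIM('a) / 2) * gauss x)" .
qed

lemma gauss_integrable: "integrable lborel (gauss :: 'a::euclidean_space \<Rightarrow> real)"
  using integrable_norm[OF gauss_fourier(1)[of "0::'a"]] by simp

lemma integral_gauss: "(LINT x|lborel. gauss (x::'a::euclidean_space)) = (2 * pi) powr (DIM('a) / 2)"
  using gauss_fourier(2)[of "0::'a"] by (simp add: gauss_def[of "0::'a"] integral_complex_of_real flip: of_real_mult)

lemma AE_lborel_coord_nonzero: "AE x in lborel. \<forall>b\<in>Basis. (x::'a::euclidean_space) \<bullet> b \<noteq> 0"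
proof (rule AE_finite_allI)
  fix b :: 'a assume b: "b \<in> Basis"
  have "negligible {x::'a. b \<bullet> x = 0}" using b by (intro negligible_hyperplane) auto
  moreover have "{x::'a. b \<bullet> x = 0} \<in> sets lborel" by measurable
  ultimately have "{x::'a. b \<bullet> x = 0} \<in> null_sets lborel"
    by (simp add: negligible_iff_null_sets null_sets_completion_iff)
  then show "AE x in lborel. x \<bullet> b \<noteq> 0"
    by (rule AE_I') (auto simp: inner_commute)
qed simp

lemma nn_integral_weight_1D:
  assumes "-1 < b" "b \<le> 0"
  shows "(\<integral>\<^sup>+s. ennreal (\<bar>s\<bar> powr b / (1 + s\<^sup>2)) \<partial>lborel) < \<infinity>"
proof -
  have 1: "(\<integral>\<^sup>+s. ennreal (s powr b) * indicator {0..1} s \<partial>lborel) = ennreal (1 / (b + 1))"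
    using has_integral_powr_from_0[of b 1] assms
    by (intro nn_integral_has_integral_lebesgue') auto
  have 2: "(\<integral>\<^sup>+s. ennreal ((-s) powr b) * indicator {0..1} (-s) \<partial>lborel) = ennreal (1 / (b + 1))"
    unfolding 1[symmetric] by (subst lborel_nn_integral_affine[of _ "-1" 0]) auto
  have "integrable lborel (\<lambda>s::real. inverse (1 + s\<^sup>2))"
    using Sinc_Integral.integrable_inverse_1_plus_square by (simp add: set_integrable_def)
  then have 3: "(\<integral>\<^sup>+s. ennreal (inverse (1 + s\<^sup>2)) \<partial>lborel) < \<infinity>"
    by (subst (asm) integrable_iff_bounded) (auto simp: add_nonneg_nonneg)
  have "(\<integral>\<^sup>+s. ennreal (\<bar>s\<bar> powr b / (1 + s\<^sup>2)) \<partial>lborel) \<le> 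
    (\<integral>\<^sup>+s. ennreal (s powr b) * indicator {0..1} s + ennreal ((-s) powr b) * indicator {0..1} (-s) + ennreal (inverse (1 + s\<^sup>2)) \<partial>lborel)"
  proof (rule nn_integral_mono)
    fix s :: real
    have p: "1 + s\<^sup>2 \<ge> 1" by simp
    consider "0 \<le> s" "s \<le> 1" | "s < 0" "-1 \<le> s" | "\<bar>s\<bar> > 1" by linarith
    then show "ennreal (\<bar>s\<bar> powr b / (1 + s\<^sup>2)) \<le> ennreal (s powr b) * indicator {0..1} s + ennreal ((-s) powr b) * indicator {0..1} (-s) + ennreal (inverse (1 + s\<^sup>2))"
    proof cases
      case 1
      have "\<bar>s\<bar> powr b / (1 + s\<^sup>2) \<le> s powr b" using 1 p frac_le[of "s powr b" "s powr b" 1 "1 + s\<^sup>2"] by simp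
      then show ?thesis using 1 by (auto simp: indicator_def intro!: add_increasing2 ennreal_leI)
    next
      case 2
      have "\<bar>s\<bar> powr b / (1 + s\<^sup>2) \<le> (-s) powr b" using 2 p frac_le[of "(-s) powr b" "(-s) powr b" 1 "1 + s\<^sup>2"] by simp
      then show ?thesis using 2 by (auto simp: indicator_def intro!: add_increasing2 ennreal_leI)
    next
      case 3
      have "\<bar>s\<bar> powr b \<le> 1" using 3 assms powr_mono[of b 0 "\<bar>s\<bar>"] by (auto split: if_splits)
      then have "\<bar>s\<bar> powr b / (1 + s\<^sup>2) \<le> inverse (1 + s\<^sup>2)" using p unfolding divide_inverse
        by (intro mult_left_le_one_le) auto
      then show ?thesis by (intro add_increasing ennreal_leI) auto
    qed
  qed
  also have "\<dots> < \<infinity>"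
    using 1 2 3 by (simp add: nn_integral_add)
  finally show ?thesis .
qed

text \<open>A power weight of exponent above \<open>-d\<close> is integrable at the origin because \<open>\<bar>x\<bar>\<close> dominates
  each coordinate: a negative power \<open>\<bar>x\<bar>\<^sup>a\<close> is below the product of the \<open>\<bar>x\<^sub>c\<bar>\<^sup>a\<^sup>/\<^sup>d\<close>, whose
  exponents exceed \<open>-1\<close>. Positive powers and the decay at infinity are handled by the
  denominator.\<close>

lemma nn_integral_weight:
  fixes a :: real
  assumes a: "a > - real DIM('a::euclidean_space)"
  shows "\<exists>k. \<forall>m\<ge>k. (\<integral>\<^sup>+x. ennreal (norm (x::'a) powr a / (1 + (norm x)\<^sup>2) ^ m) \<partial>lborel) < \<infinity>"
proof -
  let ?d = "DIM('a)"
  define b where "b = min a 0 / real ?d"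
  have b: "-1 < b" "b \<le> 0" using a by (auto simp: b_def field_simps min_def)
  define l where "l = nat \<lceil>max a 0\<rceil>"
  have l: "max a 0 \<le> real l" unfolding l_def by linarith
  have main: "(\<integral>\<^sup>+x. ennreal (norm (x::'a) powr a / (1 + (norm x)\<^sup>2) ^ m) \<partial>lborel) < \<infinity>" if m: "m \<ge> l + ?d" for m
  proof -
    have "(\<integral>\<^sup>+x. ennreal (norm (x::'a) powr a / (1 + (norm x)\<^sup>2) ^ m) \<partial>lborel)
      \<le> (\<integral>\<^sup>+x. (\<Prod>c\<in>Basis. ennreal (\<bar>x \<bullet> c\<bar> powr b / (1 + (x \<bullet> c)\<^sup>2))) \<partial>(lborel::'a measure))"
    proof (rule nn_integral_mono_AE)
      show "AE x in (lborel::'a measure). ennreal (norm (x::'a) powr a / (1 + (norm x)\<^sup>2) ^ m) \<le> (\<Prod>c\<in>Basis. ennreal (\<bar>x \<bullet> c\<bar> powr b / (1 + (x \<bullet> c)\<^sup>2)))"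
        using AE_lborel_coord_nonzero
      proof eventually_elim
        case (elim x)
        define w where "w = 1 + (norm x)\<^sup>2"
        have w: "w \<ge> 1" by (simp add: w_def)
        have x: "norm x > 0" using elim nonempty_Basis by fastforce
        have "norm x powr (max a 0) \<le> w ^ l"
        proof (cases "norm x \<le> 1")
          case True
          then have "norm x powr (max a 0) \<le> 1" using x by (intro powr_le1) auto
          also have "1 \<le> w ^ l" using w by simp
          finally show ?thesis .
        next
          case False
          then have "norm x powr (max a 0) \<le> norm x powr (real l)" using l by (intro powr_mono) auto
          also have "\<dots> = norm x ^ l" using x by (simp add: powr_realpow)
          also have "\<dots> \<le> w ^ l"
          proof (rule power_mono)
            show "norm x \<le> w" using False self_le_power[of "norm x" 2] unfolding w_def by simp
          qed simp
          finally show ?thesis .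
        qed
        moreover have "norm x powr a = norm x powr (min a 0) * norm x powr (max a 0)"
          by (simp add: powr_add[symmetric] min_def max_def)
        ultimately have "norm x powr a / w ^ m \<le> norm x powr (min a 0) * w ^ l / w ^ m"
          using w by (intro divide_right_mono) (auto intro: mult_left_mono)
        also have "\<dots> \<le> norm x powr (min a 0) / w ^ ?d"
        proof -
          have "w ^ l * w ^ ?d \<le> w ^ m" unfolding power_add[symmetric] using w m by (intro power_increasing) auto
          then have "norm x powr (min a 0) * (w ^ l * w ^ ?d) \<le> norm x powr (min a 0) * w ^ m"
            by (rule mult_left_mono) simp
          then show ?thesis using w by (simp add: divide_simps mult_ac)
        qed
        also have "\<dots> = (\<Prod>c\<in>(Basis::'a set). norm x powr b / w)"
          using x by (simp add: power_divide powr_power b_def)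
        also have "\<dots> \<le> (\<Prod>c\<in>Basis. \<bar>x \<bullet> c\<bar> powr b / (1 + (x \<bullet> c)\<^sup>2))"
        proof (rule prod_mono, intro conjI)
          fix c :: 'a assume c: "c \<in> Basis"
          show "0 \<le> norm x powr b / w" using w by simp
          have le: "\<bar>x \<bullet> c\<bar> \<le> norm x" using Basis_le_norm[OF c] .
          have "(x \<bullet> c)\<^sup>2 \<le> (norm x)\<^sup>2" using le by (simp add: abs_le_square_iff[symmetric])
          moreover have "norm x powr b \<le> \<bar>x \<bullet> c\<bar> powr b"
            using le b(2) elim c by (intro powr_mono2') auto
          ultimately show "norm x powr b / w \<le> \<bar>x \<bullet> c\<bar> powr b / (1 + (x \<bullet> c)\<^sup>2)"
            unfolding w_def by (intro frac_le) (auto simp: add_pos_nonneg)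
        qed
        finally show ?case unfolding w_def
          by (subst prod_ennreal) (auto intro!: ennreal_leI divide_nonneg_pos add_pos_nonneg)
      qed
    qed
    also have "\<dots> = (\<Prod>c\<in>(Basis::'a set). \<integral>\<^sup>+s. ennreal (\<bar>s\<bar> powr b / (1 + s\<^sup>2)) \<partial>lborel)"
      by (rule nn_integral_lborel_prod) auto
    also have "\<dots> < \<infinity>"
      using nn_integral_weight_1D[OF b] by (simp add: power_less_top_ennreal)
    finally show ?thesis .
  qed
  then show ?thesis by blast
qed

section \<open>Fourier inversion for test functions\<close>

lemma integrable_pair_mult:
  fixes f :: "'a \<Rightarrow> complex" and g :: "'b \<Rightarrow> complex" and K :: "'a \<Rightarrow> 'b \<Rightarrow> complex"
  assumes "sigma_finite_measure M1" "sigma_finite_measure M2"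
  assumes K[measurable]: "(\<lambda>(x, y). K x y) \<in> borel_measurable (M1 \<Otimes>\<^sub>M M2)" and B: "\<And>x y. norm (K x y) \<le> B"
    and f: "integrable M1 f" and g: "integrable M2 g"
  shows "integrable (M1 \<Otimes>\<^sub>M M2) (\<lambda>(x, y). K x y * (f x * g y))"
proof -
  interpret pair_sigma_finite M1 M2 using assms(1,2) by (rule pair_sigma_finite.intro)
  have "B \<ge> 0" using B[of undefined undefined] norm_ge_zero order_trans by blast
  have [measurable]: "f \<in> borel_measurable M1" "g \<in> borel_measurable M2" using f g by auto
  have "integrable (M1 \<Otimes>\<^sub>M M2) (\<lambda>(x, y). f x * g y)"
    by (rule Fubini_integrable) (use f g in \<open>auto simp: norm_mult\<close>)
  then have "integrable (M1 \<Otimes>\<^sub>M M2) (\<lambda>z. B *\<^sub>R (case z of (x, y) \<Rightarrow> f x * g y))"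
    by (rule integrable_scaleR_right)
  then show ?thesis
    by (rule Bochner_Integration.integrable_bound)
       (use B \<open>B \<ge> 0\<close> in \<open>auto simp: norm_mult intro!: mult_right_mono AE_I2\<close>)
qed

interpretation lborel_pair: pair_sigma_finite "lborel :: 'a::euclidean_space measure" "lborel :: 'b::euclidean_space measure" ..

lemma integrable_decay:
  "\<exists>k. integrable lborel (\<lambda>x::'a::euclidean_space. 1 / (1 + norm x) ^ k)"
proof -
  obtain k where k: "(\<integral>\<^sup>+x. ennreal (norm (x::'a) powr 0 / (1 + (norm x)\<^sup>2) ^ k) \<partial>lborel) < \<infinity>"
    using nn_integral_weight[of 0, where 'a='a] by auto
  have le: "1 / (1 + norm x) ^ (2 * k) \<le> 1 / (1 + (norm x)\<^sup>2) ^ k" for x :: 'a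
  proof -
    have "(1 + (norm x)\<^sup>2) ^ k \<le> ((1 + norm x)\<^sup>2) ^ k"
      by (intro power_mono) (auto simp: power2_eq_square algebra_simps)
    then show ?thesis unfolding power_mult by (intro frac_le) (auto simp: add_pos_nonneg)
  qed
  have "(\<integral>\<^sup>+x. ennreal (norm (1 / (1 + norm (x::'a)) ^ (2 * k))) \<partial>lborel) \<le> (\<integral>\<^sup>+x. ennreal (norm (x::'a) powr 0 / (1 + (norm x)\<^sup>2) ^ k) \<partial>lborel)"
    by (rule nn_integral_mono_AE, use AE_lborel_singleton[of "0::'a"] in eventually_elim)
       (use le in \<open>auto intro!: ennreal_leI\<close>)
  then have "integrable lborel (\<lambda>x::'a. 1 / (1 + norm x) ^ (2 * k))"
    using k by (intro integrableI_bounded) auto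
  then show ?thesis by blast
qed

lemma fourier_test_integrable:
  fixes f :: "real^'d::finite \<Rightarrow> complex"
  assumes "test_function f"
  shows "integrable lborel (fourier f)"
proof -
  obtain k where k: "integrable lborel (\<lambda>x::real^'d. 1 / (1 + norm x) ^ k)" using integrable_decay by blast
  obtain C where C: "\<And>\<xi>. (1 + norm \<xi>) ^ k * norm (fourier f \<xi>) \<le> C" using fourier_test_decay[OF assms] by blast
  have "smooth_fun (fourier f)" using schwartz_fourier[OF assms] schwartz_def by blast
  then have [measurable]: "fourier f \<in> borel_measurable borel"
    by (intro borel_measurable_continuous_onI smooth_fun_continuous)
  have "integrable lborel (\<lambda>x::real^'d. C * (1 / (1 + norm x) ^ k))" using k by (rule integrable_mult_right)
  then show ?thesis
  proof (rule Bochner_Integration.integrable_bound)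
    have "norm (fourier f x) \<le> norm (C * (1 / (1 + norm x) ^ k))" for x
    proof -
      have "(1 + norm x) ^ k > 0" by (simp add: add_pos_nonneg)
      then have "norm (fourier f x) \<le> C * (1 / (1 + norm x) ^ k)" using C[of x] by (simp add: field_simps)
      then show ?thesis using abs_ge_self order_trans unfolding real_norm_def by blast
    qed
    then show "AE x in lborel. norm (fourier f x) \<le> norm (C * (1 / (1 + norm x) ^ k))" by simp
  qed measurable
qed

text \<open>Inserting a Gaussian into the inversion integral makes Fubini applicable; the inner integral
  is then the transform of a Gaussian, and what remains is an average of \<open>f\<close> at scale \<open>\<sigma>\<close>.\<close>

lemma fourier_gauss_average:
  fixes f :: "real^'d::finite \<Rightarrow> complex"
  assumes f: "integrable lborel f" and \<sigma>: "\<sigma> > 0"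
  shows "(LINT \<xi>|lborel. wave x \<xi> * of_real (gauss (\<sigma> *\<^sub>R \<xi>)) * fourier f \<xi>)
     = (LINT z|lborel. of_real (gauss z) * f (x + \<sigma> *\<^sub>R z))"
proof -
  let ?c = "fourier_const TYPE('d)" and ?d = "CARD('d)"
  have [measurable]: "f \<in> borel_measurable borel" using borel_measurable_integrable[OF f] by simp
  have g: "integrable lborel (\<lambda>\<xi>::real^'d. complex_of_real (gauss (\<sigma> *\<^sub>R \<xi>)))"
    using lborel_integrable_affine[OF gauss_integrable, of \<sigma> "0::real^'d"] \<sigma> by (simp add: integrable_of_real)
  have int: "integrable (lborel \<Otimes>\<^sub>M lborel) (\<lambda>(\<xi>, y). wave (x - y) \<xi> * (of_real (gauss (\<sigma> *\<^sub>R \<xi>)) * f y))"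
    by (rule integrable_pair_mult[OF _ _ _ _ g f, of _ 1]) (auto intro: sigma_finite_lborel)
  have inner: "(LINT \<xi>|lborel. wave v \<xi> * of_real (gauss (\<sigma> *\<^sub>R \<xi>)))
     = of_real ((1 / \<sigma>) ^ ?d * (2 * pi) powr (?d / 2) * gauss ((1 / \<sigma>) *\<^sub>R v))" for v :: "real^'d"
  proof -
    have "(LINT \<xi>|lborel. wave v \<xi> * of_real (gauss (\<sigma> *\<^sub>R \<xi>)))
     = \<bar>1 / \<sigma>\<bar> ^ ?d *\<^sub>R (LINT \<xi>|lborel. wave v (0 + (1 / \<sigma>) *\<^sub>R \<xi>) * of_real (gauss (\<sigma> *\<^sub>R (0 + (1 / \<sigma>) *\<^sub>R \<xi>))))"
      using \<sigma> by (subst lborel_integral_affine[of _ "1 / \<sigma>" 0]) auto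
    also have "(LINT \<xi>|lborel. wave v (0 + (1 / \<sigma>) *\<^sub>R \<xi>) * of_real (gauss (\<sigma> *\<^sub>R (0 + (1 / \<sigma>) *\<^sub>R \<xi>))))
      = (LINT \<xi>|lborel. wave ((1 / \<sigma>) *\<^sub>R v) \<xi> * of_real (gauss \<xi>))"
      using \<sigma> by simp
    finally show ?thesis using \<sigma> unfolding gauss_fourier by (simp add: scaleR_conv_of_real)
  qed
  have "(LINT \<xi>|lborel. wave x \<xi> * of_real (gauss (\<sigma> *\<^sub>R \<xi>)) * fourier f \<xi>)
    = (LINT \<xi>|lborel. of_real ?c * (LINT y|lborel. wave (x - y) \<xi> * (of_real (gauss (\<sigma> *\<^sub>R \<xi>)) * f y)))"
  proof (intro Bochner_Integration.integral_cong refl)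
    fix \<xi> :: "real^'d"
    have "wave x \<xi> * of_real (gauss (\<sigma> *\<^sub>R \<xi>)) * fourier f \<xi>
      = of_real ?c * (wave x \<xi> * of_real (gauss (\<sigma> *\<^sub>R \<xi>)) * (LINT y|lborel. cwave y \<xi> * f y))"
      by (simp add: fourier_def)
    also have "wave x \<xi> * of_real (gauss (\<sigma> *\<^sub>R \<xi>)) * (LINT y|lborel. cwave y \<xi> * f y)
      = (LINT y|lborel. wave x \<xi> * of_real (gauss (\<sigma> *\<^sub>R \<xi>)) * (cwave y \<xi> * f y))"
      by simp
    also have "\<dots> = (LINT y|lborel. wave (x - y) \<xi> * (of_real (gauss (\<sigma> *\<^sub>R \<xi>)) * f y))"
      by (intro Bochner_Integration.integral_cong refl) (simp add: inner_diff_left algebra_simps exp_diff exp_minus divide_inverse)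
    finally show "wave x \<xi> * of_real (gauss (\<sigma> *\<^sub>R \<xi>)) * fourier f \<xi>
      = of_real ?c * (LINT y|lborel. wave (x - y) \<xi> * (of_real (gauss (\<sigma> *\<^sub>R \<xi>)) * f y))" .
  qed
  also have "\<dots> = of_real ?c * (LINT \<xi>|lborel. (LINT y|lborel. wave (x - y) \<xi> * (of_real (gauss (\<sigma> *\<^sub>R \<xi>)) * f y)))"
    by simp
  also have "\<dots> = of_real ?c * (LINT y|lborel. (LINT \<xi>|lborel. wave (x - y) \<xi> * (of_real (gauss (\<sigma> *\<^sub>R \<xi>)) * f y)))"
    by (subst lborel_pair.Fubini_integral[OF int]) simp
  also have "(\<lambda>y. (LINT \<xi>|lborel. wave (x - y) \<xi> * (of_real (gauss (\<sigma> *\<^sub>R \<xi>)) * f y)))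
    = (\<lambda>y. of_real ((1 / \<sigma>) ^ ?d * (2 * pi) powr (?d / 2) * gauss ((1 / \<sigma>) *\<^sub>R (x - y))) * f y)"
    unfolding mult.assoc[symmetric] inner[symmetric] by simp
  also have "(LINT y|lborel. of_real ((1 / \<sigma>) ^ ?d * (2 * pi) powr (?d / 2) * gauss ((1 / \<sigma>) *\<^sub>R (x - y))) * f y)
    = \<bar>\<sigma>\<bar> ^ ?d *\<^sub>R (LINT z|lborel. of_real ((1 / \<sigma>) ^ ?d * (2 * pi) powr (?d / 2) * gauss ((1 / \<sigma>) *\<^sub>R (x - (x + \<sigma> *\<^sub>R z)))) * f (x + \<sigma> *\<^sub>R z))"
    using \<sigma> by (subst lborel_integral_affine[of _ \<sigma> x]) auto
  also have "(LINT z|lborel. of_real ((1 / \<sigma>) ^ ?d * (2 * pi) powr (?d / 2) * gauss ((1 / \<sigma>) *\<^sub>R (x - (x + \<sigma> *\<^sub>R z)))) * f (x + \<sigma> *\<^sub>R z))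
    = (LINT z|lborel. of_real ((1 / \<sigma>) ^ ?d * (2 * pi) powr (?d / 2)) * (of_real (gauss z) * f (x + \<sigma> *\<^sub>R z)))"
    using \<sigma> by (intro Bochner_Integration.integral_cong refl) simp
  also have "\<dots> = of_real ((1 / \<sigma>) ^ ?d * (2 * pi) powr (?d / 2)) * (LINT z|lborel. (of_real (gauss z) * f (x + \<sigma> *\<^sub>R z)))"
    by (rule integral_mult_right_zero)
  also have "of_real ?c * (\<bar>\<sigma>\<bar> ^ ?d *\<^sub>R (of_real ((1 / \<sigma>) ^ ?d * (2 * pi) powr (?d / 2)) * (LINT z|lborel. (of_real (gauss z) * f (x + \<sigma> *\<^sub>R z)))))
    = of_real (?c * (2 * pi) powr (?d / 2) * (\<bar>\<sigma>\<bar> ^ ?d * (1 / \<sigma>) ^ ?d)) * (LINT z|lborel. (of_real (gauss z) * f (x + \<sigma> *\<^sub>R z)))"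
    by (simp add: scaleR_conv_of_real)
  also have "?c * (2 * pi) powr (?d / 2) * (\<bar>\<sigma>\<bar> ^ ?d * (1 / \<sigma>) ^ ?d) = 1"
    using \<sigma> by (simp add: powr_add[symmetric] power_divide)
  finally show ?thesis by simp
qed

text \<open>Let \<open>\<sigma>\<close> tend to \<open>0\<close> in \<open>fourier_gauss_average\<close>: the left side tends to the inversion integral,
  the Gaussian average to \<open>f x\<close> times the total mass of the Gaussian.\<close>

lemma inv_fourier_fourier:
  fixes f :: "real^'d::finite \<Rightarrow> complex"
  assumes f: "test_function f"
  shows "inv_fourier (fourier f) x = f x"
proof -
  let ?c = "fourier_const TYPE('d)" and ?d = "CARD('d)"
  define h where "h n = 1 / real (Suc n)" for n
  have h: "h \<longlonglongrightarrow> 0" "\<And>n. h n > 0"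
    unfolding h_def using LIMSEQ_inverse_real_of_nat by (auto simp: inverse_eq_divide)
  have [measurable]: "f \<in> borel_measurable borel" using test_function_borel[OF f] .
  have [measurable]: "fourier f \<in> borel_measurable borel" using borel_measurable_integrable[OF fourier_test_integrable[OF f]] by simp
  obtain B where B: "\<And>x. norm (f x) \<le> B" "B \<ge> 0" using test_function_bounded[OF f] by blast
  have cont: "isCont f x" for x using test_function_continuous[OF f] by (simp add: continuous_on_eq_continuous_at)
  have "(\<lambda>n. LINT \<xi>|lborel. wave x \<xi> * of_real (gauss (h n *\<^sub>R \<xi>)) * fourier f \<xi>)
    \<longlonglongrightarrow> (LINT \<xi>|lborel. wave x \<xi> * of_real (gauss (0 *\<^sub>R \<xi>)) * fourier f \<xi>)"
  proof (rule integral_dominated_convergence[where w="\<lambda>\<xi>. norm (fourier f \<xi>)"])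
    show "AE \<xi> in lborel. (\<lambda>n. wave x \<xi> * of_real (gauss (h n *\<^sub>R \<xi>)) * fourier f \<xi>)
       \<longlonglongrightarrow> wave x \<xi> * of_real (gauss (0 *\<^sub>R \<xi>)) * fourier f \<xi>"
      unfolding gauss_def by (intro AE_I2 tendsto_intros h) auto
    show "AE \<xi> in lborel. norm (wave x \<xi> * of_real (gauss (h n *\<^sub>R \<xi>)) * fourier f \<xi>) \<le> norm (fourier f \<xi>)" for n
      by (auto simp: norm_mult mult_left_le_one_le)
  qed (use fourier_test_integrable[OF f] in auto)
  moreover have "(\<lambda>n. LINT z|lborel. of_real (gauss z) * f (x + h n *\<^sub>R z)) \<longlonglongrightarrow> (LINT z|lborel. of_real (gauss z) * f (x + 0 *\<^sub>R z))"
  proof (rule integral_dominated_convergence[where w="\<lambda>z. gauss z * B"])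
    show "AE z in lborel. (\<lambda>n. of_real (gauss z) * f (x + h n *\<^sub>R z)) \<longlonglongrightarrow> of_real (gauss z) * f (x + 0 *\<^sub>R z)"
      by (intro AE_I2 tendsto_intros h isCont_tendsto_compose[OF cont])
    show "AE z in lborel. norm (of_real (gauss z) * f (x + h n *\<^sub>R z)) \<le> gauss z * B" for n
      using B by (auto simp: norm_mult mult_left_mono)
  qed (auto intro: gauss_integrable)
  ultimately have "(LINT \<xi>|lborel. wave x \<xi> * of_real (gauss (0 *\<^sub>R \<xi>)) * fourier f \<xi>) = (LINT z|lborel. of_real (gauss z) * f (x + 0 *\<^sub>R z))"
    unfolding fourier_gauss_average[OF test_function_integrable[OF f] h(2)] by (rule LIMSEQ_unique)
  also have "\<dots> = of_real ((2 * pi) powr (?d / 2)) * f x"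
    using integral_gauss[where 'a="real^'d"] by (simp add: gauss_integrable)
  finally have "(LINT \<xi>|lborel. wave x \<xi> * fourier f \<xi>) = of_real ((2 * pi) powr (?d / 2)) * f x"
    by (simp add: gauss_def)
  then have "inv_fourier (fourier f) x = of_real (?c * (2 * pi) powr (?d / 2)) * f x"
    by (simp add: inv_fourier_def)
  also have "?c * (2 * pi) powr (?d / 2) = 1" by (simp add: powr_add[symmetric])
  finally show ?thesis by simp
qed

section \<open>Vanishing of functions with vanishing test integrals\<close>

text \<open>Boxes generate the Borel sets, so the positive and the negative part of \<open>f\<close> are densities of the
  same measure.\<close>

lemma AE_zero_of_box_integrals:
  fixes f :: "'a::euclidean_space \<Rightarrow> real"
  assumes [measurable]: "f \<in> borel_measurable borel"
    and int: "\<And>a b. integrable lborel (\<lambda>x. indicator (box a b) x * f x)"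
    and zero: "\<And>a b. (LINT x|lborel. indicator (box a b) x * f x) = 0"
  shows "AE x in lborel. f x = 0"
proof -
  let ?p = "\<lambda>x. ennreal (max 0 (f x))" and ?n = "\<lambda>x. ennreal (max 0 (- f x))"
  have em: "emeasure (density lborel ?p) (box a b) = ennreal (LINT x|lborel. indicator (box a b) x * max 0 (f x))"
    "emeasure (density lborel ?n) (box a b) = ennreal (LINT x|lborel. indicator (box a b) x * max 0 (- f x))"
    "(LINT x|lborel. indicator (box a b) x * max 0 (f x)) = (LINT x|lborel. indicator (box a b) x * max 0 (- f x))"
    for a b :: 'a
  proof -
    have ip: "integrable lborel (\<lambda>x. indicator (box a b) x * max 0 (f x))"
      by (rule Bochner_Integration.integrable_bound[OF int[of a b]]) (auto simp: abs_mult intro!: mult_left_mono)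
    have im: "integrable lborel (\<lambda>x. indicator (box a b) x * max 0 (- f x))"
      by (rule Bochner_Integration.integrable_bound[OF int[of a b]]) (auto simp: abs_mult intro!: mult_left_mono)
    show "emeasure (density lborel ?p) (box a b) = ennreal (LINT x|lborel. indicator (box a b) x * max 0 (f x))"
      by (subst nn_integral_eq_integral[OF ip, symmetric])
         (auto simp: emeasure_density ennreal_mult' mult.commute ennreal_indicator intro!: nn_integral_cong)
    show "emeasure (density lborel ?n) (box a b) = ennreal (LINT x|lborel. indicator (box a b) x * max 0 (- f x))"
      by (subst nn_integral_eq_integral[OF im, symmetric])
         (auto simp: emeasure_density ennreal_mult' mult.commute ennreal_indicator intro!: nn_integral_cong)
    have "(LINT x|lborel. indicator (box a b) x * f x) = (LINT x|lborel. indicator (box a b) x * max 0 (f x) - indicator (box a b) x * max 0 (- f x))"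
      by (intro Bochner_Integration.integral_cong refl) (auto simp: max_def)
    also have "\<dots> = (LINT x|lborel. indicator (box a b) x * max 0 (f x)) - (LINT x|lborel. indicator (box a b) x * max 0 (- f x))"
      by (rule Bochner_Integration.integral_diff[OF ip im])
    finally show "(LINT x|lborel. indicator (box a b) x * max 0 (f x)) = (LINT x|lborel. indicator (box a b) x * max 0 (- f x))"
      using zero[of a b] by simp
  qed
  have "density lborel ?p = density lborel ?n"
  proof (rule measure_eqI_generator_eq)
    let ?E = "range (\<lambda>(a, b). box a b::'a set)"
    show "Int_stable ?E" by (auto simp: Int_stable_def box_Int_box)
    show "?E \<subseteq> Pow UNIV" "sets (density lborel ?p) = sigma_sets UNIV ?E" "sets (density lborel ?n) = sigma_sets UNIV ?E"
      by (simp_all add: borel_eq_box)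
    let ?A = "\<lambda>n::nat. box (- (real n *\<^sub>R One)) (real n *\<^sub>R One) :: 'a set"
    show "range ?A \<subseteq> ?E" "(\<Union>i. ?A i) = UNIV" unfolding UN_box_eq_UNIV by auto
    show "emeasure (density lborel ?p) (?A i) \<noteq> \<infinity>" for i unfolding em by simp
    show "emeasure (density lborel ?p) X = emeasure (density lborel ?n) X" if "X \<in> ?E" for X
      using that em by auto
  qed
  then have "AE x in lborel. ?p x = ?n x"
    by (intro sigma_finite_measure.density_unique[OF sigma_finite_lborel]) auto
  then show ?thesis
  proof eventually_elim
    case (elim x)
    then have "max 0 (f x) = max 0 (- f x)" by (subst (asm) ennreal_inj) simp_all
    then show ?case by (simp add: max_def split: if_split_asm)
  qed
qed

lemma locally_integrable_measurable:
  fixes g :: "real^'d::finite \<Rightarrow> complex"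
  assumes "locally_integrable g" shows "g \<in> borel_measurable borel"
proof (rule borel_measurable_LIMSEQ_metric)
  show "(\<lambda>x. indicator (cball 0 (real n)) x *\<^sub>R g x) \<in> borel_measurable borel" for n
  proof -
    have i: "integrable lborel (\<lambda>x. indicator (cball 0 (real n)) x *\<^sub>R g x)"
      using assms unfolding locally_integrable_def set_integrable_def by auto
    show ?thesis using borel_measurable_integrable[OF i] by simp
  qed
  fix x :: "real^'d"
  obtain n where "norm x \<le> real n" using real_arch_simple by blast
  then have "\<forall>\<^sub>F n in sequentially. indicator (cball 0 (real n)) x *\<^sub>R g x = g x"
    by (intro eventually_sequentiallyI[of n]) (auto simp: indicator_def)
  then show "(\<lambda>n. indicator (cball 0 (real n)) x *\<^sub>R g x) \<longlonglongrightarrow> g x"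
    by (rule tendsto_eventually)
qed

lemma locally_integrable_bounded_support:
  fixes g :: "real^'d::finite \<Rightarrow> complex" and f :: "real^'d \<Rightarrow> complex"
  assumes "locally_integrable g" and [measurable]: "f \<in> borel_measurable borel"
    and B: "\<And>x. norm (f x) \<le> B" and R: "\<And>x. norm x > R \<Longrightarrow> f x = 0"
  shows "integrable lborel (\<lambda>x. g x * f x)"
proof -
  have [measurable]: "g \<in> borel_measurable borel" using locally_integrable_measurable[OF assms(1)] .
  have "integrable lborel (\<lambda>x. indicator (cball 0 R) x *\<^sub>R g x)"
    using assms(1) unfolding locally_integrable_def set_integrable_def by auto
  then have "integrable lborel (\<lambda>x. of_real B * (indicator (cball 0 R) x *\<^sub>R g x))"
    by (rule integrable_mult_right)
  then show ?thesis
  proof (rule Bochner_Integration.integrable_bound)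
    show "AE x in lborel. norm (g x * f x) \<le> norm (of_real B * (indicator (cball 0 R) x *\<^sub>R g x))"
    proof (rule AE_I2)
      fix x
      have "norm (f x) \<le> \<bar>B\<bar> * indicator (cball 0 R) x"
        using B[of x] R[of x] by (auto simp: indicator_def not_le)
      then have "norm (g x) * norm (f x) \<le> norm (g x) * (\<bar>B\<bar> * indicator (cball 0 R) x)" by (rule mult_left_mono) simp
      then show "norm (g x * f x) \<le> norm (of_real B * (indicator (cball 0 R) x *\<^sub>R g x))"
        by (simp add: norm_mult mult_ac)
    qed
  qed measurable
qed

lemma locally_integrable_test:
  assumes "locally_integrable g" "test_function f"
  shows "integrable lborel (\<lambda>x. g x * f x)"
proof -
  obtain B where "\<And>x. norm (f x) \<le> B" using test_function_bounded[OF assms(2)] by blast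
  moreover obtain R where "\<And>x. norm x \<ge> R \<Longrightarrow> f x = 0" using test_function_support[OF assms(2)] by blast
  ultimately show ?thesis
    using assms test_function_borel by (intro locally_integrable_bounded_support[of g f B R]) auto
qed

lemma littlewood_paleyD:
  assumes "littlewood_paley \<phi>"
  shows "smooth_fun \<phi>" "\<phi> x \<ge> 0" "norm x > 2 \<Longrightarrow> \<phi> x = 0"
    "x \<noteq> 0 \<Longrightarrow> ((\<lambda>j::int. \<phi> ((2 powi (- j)) *\<^sub>R x)) has_sum 1) UNIV"
proof -
  note lp = assms[unfolded littlewood_paley_def]
  show "smooth_fun \<phi>" "\<phi> x \<ge> 0" using lp by blast+
  show "norm x > 2 \<Longrightarrow> \<phi> x = 0" using lp not_le by blast
  show "x \<noteq> 0 \<Longrightarrow> ((\<lambda>j::int. \<phi> ((2 powi (- j)) *\<^sub>R x)) has_sum 1) UNIV" using lp by blast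
qed

text \<open>The mass is positive because a continuous nonnegative function of zero mass vanishes, and then
  the dyadic pieces could not sum to \<open>1\<close>.\<close>

lemma littlewood_paley_integral:
  fixes \<phi> :: "real^'d::finite \<Rightarrow> real"
  assumes "littlewood_paley \<phi>"
  shows "integrable lborel \<phi>" "(LINT x|lborel. \<phi> x) > 0"
proof -
  have t: "test_function (\<lambda>x. complex_of_real (\<phi> x))"
    using test_function_bump[OF assms, of 1 0] by simp
  have "integrable lborel (\<lambda>x. norm (complex_of_real (\<phi> x)))" using test_function_integrable[OF t] by (rule integrable_norm)
  then show i: "integrable lborel \<phi>" using littlewood_paleyD(2)[OF assms] by simp
  have "continuous_on UNIV \<phi>" using smooth_fun_continuous littlewood_paleyD(1)[OF assms] by blast
  have "(LINT x|lborel. \<phi> x) \<noteq> 0"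
  proof
    assume "(LINT x|lborel. \<phi> x) = 0"
    then have "AE x in lborel. \<phi> x = 0"
      using littlewood_paleyD(2)[OF assms] i by (subst (asm) integral_nonneg_eq_0_iff_AE) auto
    then have "AE x in lebesgue. x \<in> {x. \<phi> x = 0}" by (auto intro: AE_completion)
    moreover have "closed {x. \<phi> x = 0}" using \<open>continuous_on UNIV \<phi>\<close> by (intro closed_Collect_eq continuous_intros)
    ultimately have z: "\<phi> x = 0" for x using mem_closed_if_AE_lebesgue by blast
    have "((\<lambda>j::int. \<phi> ((2 powi (- j)) *\<^sub>R (axis undefined 1))) has_sum 1) UNIV"
      by (rule littlewood_paleyD(4)[OF assms]) (simp add: axis_eq_0_iff)
    moreover have "((\<lambda>j::int. \<phi> ((2 powi (- j)) *\<^sub>R (axis undefined 1))) has_sum 0) UNIV"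
      by (rule has_sum_0) (rule z)
    ultimately show False using has_sum_unique by fastforce
  qed
  moreover have "(LINT x|lborel. \<phi> x) \<ge> 0" using littlewood_paleyD(2)[OF assms] by (intro integral_nonneg_AE) auto
  ultimately show "(LINT x|lborel. \<phi> x) > 0" by simp
qed

text \<open>The integrals of \<open>g\<close> over boxes vanish: the indicator of a box, mollified by \<open>\<phi>\<close> at scale
  \<open>1/r\<close>, is an average of test functions, and it converges to the indicator times the mass of
  \<open>\<phi>\<close> off the boundary of the box, which is a null set.\<close>

lemma AE_zero_of_test_integrals:
  fixes \<phi> :: "real^'d::finite \<Rightarrow> real" and g :: "real^'d \<Rightarrow> complex"
  assumes lp: "littlewood_paley \<phi>" and g: "locally_integrable g"
    and zero: "\<And>f. test_function f \<Longrightarrow> (LINT x|lborel. g x * f x) = 0"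
  shows "AE x in lborel. g x = 0"
proof -
  let ?d = "CARD('d)"
  have gm[measurable]: "g \<in> borel_measurable borel" using locally_integrable_measurable[OF g] .
  have [measurable]: "\<phi> \<in> borel_measurable borel" using littlewood_paley_integral(1)[OF lp] borel_measurable_integrable by force
  have phi0: "\<phi> x \<ge> 0" for x using littlewood_paleyD(2)[OF lp] .
  have phi_supp: "\<phi> x = 0" if "norm x > 2" for x using littlewood_paleyD(3)[OF lp that] .
  obtain B where "\<And>x. norm (complex_of_real (\<phi> (1 *\<^sub>R (x - 0)))) \<le> B"
    using test_function_bounded[OF test_function_bump[OF lp, of 1 0]] by auto
  then have B: "\<And>x. \<phi> x \<le> B" using phi0 by simp
  have box_int: "integrable lborel (\<lambda>x. g x * indicator (box a b) x)" for a b :: "real^'d"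
  proof -
    obtain R where "\<forall>x\<in>box a b. norm x \<le> R" using bounded_box[of a b] bounded_iff by blast
    then show ?thesis
      by (intro locally_integrable_bounded_support[OF g, of _ 1 R]) (auto simp: indicator_def not_le split: if_splits)
  qed
  have box_zero: "(LINT x|lborel. g x * indicator (box a b) x) = 0" for a b :: "real^'d"
  proof -
    let ?\<chi> = "indicat_real (box a b)"
    obtain R where R: "\<And>x. x \<in> box a b \<Longrightarrow> norm x \<le> R" using bounded_box[of a b] bounded_iff by blast
    define X where "X n x = (LINT z|lborel. ?\<chi> (x + (- 1 / real (Suc n)) *\<^sub>R z) * \<phi> z)" for n x
    \<comment> \<open>\<open>X n\<close> is a superposition of rescaled translates of \<open>\<phi>\<close>.\<close>
    have Xzero: "(LINT x|lborel. g x * of_real (X n x)) = 0" for n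
    proof -
      let ?r = "real (Suc n)"
      have gK: "integrable lborel (\<lambda>x. g x * indicator (cball 0 (R + 2)) x)"
        by (rule locally_integrable_bounded_support[OF g, of _ 1 "R + 2"]) (auto simp: indicator_def)
      have ib: "integrable lborel (\<lambda>y. complex_of_real (?\<chi> y))"
        by (intro integrable_of_real integrable_real_indicator emeasure_lborel_box_finite) simp
      have int: "integrable (lborel \<Otimes>\<^sub>M lborel) (\<lambda>(x, y). complex_of_real (\<phi> (?r *\<^sub>R (x - y))) * (g x * indicator (cball 0 (R + 2)) x * of_real (?\<chi> y)))"
        by (rule integrable_pair_mult[OF _ _ _ _ gK ib, of _ B]) (use B phi0 in \<open>auto intro: sigma_finite_lborel\<close>)
      have eq: "complex_of_real (\<phi> (?r *\<^sub>R (x - y))) * (g x * indicator (cball 0 (R + 2)) x * of_real (?\<chi> y))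
         = of_real (?\<chi> y) * (g x * of_real (\<phi> (?r *\<^sub>R (x - y))))" for x y
      proof (cases "y \<in> box a b \<and> norm (?r *\<^sub>R (x - y)) \<le> 2")
        case True
        then have "norm (x - y) \<le> 2 / ?r" unfolding norm_scaleR by (simp add: field_simps)
        also have "\<dots> \<le> 2" by (simp add: divide_le_eq)
        finally have "norm x \<le> R + 2" using R[of y] True norm_triangle_ineq2[of x y] by linarith
        then show ?thesis by simp
      next
        case False
        then show ?thesis using phi_supp[of "?r *\<^sub>R (x - y)"] by (auto simp: indicator_def)
      qed
      have "0 = (LINT y|lborel. of_real (?\<chi> y) * (LINT x|lborel. g x * of_real (\<phi> (?r *\<^sub>R (x - y)))))"
        using zero[OF test_function_bump[OF lp, of ?r]] by simp
      also have "\<dots> = (LINT y|lborel. LINT x|lborel. of_real (?\<chi> y) * (g x * of_real (\<phi> (?r *\<^sub>R (x - y)))))"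
        by simp
      also have "\<dots> = (LINT x|lborel. LINT y|lborel. of_real (?\<chi> y) * (g x * of_real (\<phi> (?r *\<^sub>R (x - y)))))"
        using lborel_pair.Fubini_integral[OF int] unfolding eq .
      also have "(\<lambda>x. LINT y|lborel. of_real (?\<chi> y) * (g x * of_real (\<phi> (?r *\<^sub>R (x - y)))))
         = (\<lambda>x. of_real ((1 / ?r) ^ ?d) * (g x * of_real (X n x)))"
      proof
        fix x
        have "(LINT y|lborel. of_real (?\<chi> y) * (g x * of_real (\<phi> (?r *\<^sub>R (x - y))))) 
          = (LINT y|lborel. g x * of_real (?\<chi> y * \<phi> (?r *\<^sub>R (x - y))))"
          by (simp add: mult_ac)
        also have "\<dots> = g x * of_real (LINT y|lborel. ?\<chi> y * \<phi> (?r *\<^sub>R (x - y)))"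
          by (subst integral_mult_right_zero) (simp only: integral_complex_of_real)
        also have "(LINT y|lborel. ?\<chi> y * \<phi> (?r *\<^sub>R (x - y))) = \<bar>- 1 / ?r\<bar> ^ ?d *\<^sub>R (LINT z|lborel. ?\<chi> (x + (- 1 / ?r) *\<^sub>R z) * \<phi> (?r *\<^sub>R (x - (x + (- 1 / ?r) *\<^sub>R z))))"
          by (subst lborel_integral_affine[of _ "- 1 / ?r" x]) (auto simp del: of_nat_Suc)
        also have "(LINT z|lborel. ?\<chi> (x + (- 1 / ?r) *\<^sub>R z) * \<phi> (?r *\<^sub>R (x - (x + (- 1 / ?r) *\<^sub>R z)))) = X n x"
          unfolding X_def by (intro Bochner_Integration.integral_cong refl) (simp del: of_nat_Suc)
        finally show "(LINT y|lborel. of_real (?\<chi> y) * (g x * of_real (\<phi> (?r *\<^sub>R (x - y))))) = of_real ((1 / ?r) ^ ?d) * (g x * of_real (X n x))"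
          by (simp add: mult_ac del: of_nat_Suc)
      qed
      also have "(LINT x|lborel. of_real ((1 / ?r) ^ ?d) * (g x * of_real (X n x))) = of_real ((1 / ?r) ^ ?d) * (LINT x|lborel. g x * of_real (X n x))"
        by (rule integral_mult_right_zero)
      finally show ?thesis by (simp del: of_nat_Suc)
    qed
    \<comment> \<open>Off the boundary the indicator is locally constant.\<close>
    have Xlim: "(\<lambda>n. X n x) \<longlonglongrightarrow> ?\<chi> x * (LINT z|lborel. \<phi> z)" if x: "x \<notin> cbox a b - box a b" for x
    proof -
      have "(\<lambda>n. X n x) \<longlonglongrightarrow> (LINT z|lborel. ?\<chi> x * \<phi> z)"
        unfolding X_def
      proof (rule integral_dominated_convergence[where w=\<phi>])
        show "AE z in lborel. (\<lambda>n. ?\<chi> (x + (- 1 / real (Suc n)) *\<^sub>R z) * \<phi> z) \<longlonglongrightarrow> ?\<chi> x * \<phi> z"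
        proof (intro AE_I2 tendsto_intros)
          fix z
          have "(\<lambda>n. - 1 / real (Suc n)) \<longlonglongrightarrow> 0"
            using tendsto_minus[OF LIMSEQ_inverse_real_of_nat] by (simp add: inverse_eq_divide)
          then have lim: "(\<lambda>n. x + (- 1 / real (Suc n)) *\<^sub>R z) \<longlonglongrightarrow> x + 0 *\<^sub>R z" by (intro tendsto_intros)
          consider "x \<in> box a b" | "x \<in> - cbox a b" using x by blast
          then have "\<forall>\<^sub>F n in sequentially. ?\<chi> (x + (- 1 / real (Suc n)) *\<^sub>R z) = ?\<chi> x"
          proof cases
            case 1
            have "\<forall>\<^sub>F n in sequentially. x + (- 1 / real (Suc n)) *\<^sub>R z \<in> box a b"
              using lim 1 by (intro topological_tendstoD) (auto simp: open_box)
            then show ?thesis by eventually_elim (use 1 in auto)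
          next
            case 2
            have "\<forall>\<^sub>F n in sequentially. x + (- 1 / real (Suc n)) *\<^sub>R z \<in> - cbox a b"
              using lim 2 by (intro topological_tendstoD) (auto simp: closed_cbox)
            then show ?thesis by eventually_elim (use 2 box_subset_cbox[of a b] in \<open>auto simp: indicator_def\<close>)
          qed
          then show "(\<lambda>n. ?\<chi> (x + (- 1 / real (Suc n)) *\<^sub>R z)) \<longlonglongrightarrow> ?\<chi> x" by (rule tendsto_eventually)
        qed
        show "AE z in lborel. norm (?\<chi> (x + (- 1 / real (Suc n)) *\<^sub>R z) * \<phi> z) \<le> \<phi> z" for n
          using phi0 by (auto simp: indicator_def)
      qed (auto intro: littlewood_paley_integral[OF lp])
      then show ?thesis by simp
    qed
    have Xb: "\<bar>X n x\<bar> \<le> (LINT z|lborel. \<phi> z) * indicator (cball 0 (R + 2)) x" for n x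
    proof (cases "norm x \<le> R + 2")
      case True
      have "\<bar>X n x\<bar> \<le> (LINT z|lborel. norm (?\<chi> (x + (- 1 / real (Suc n)) *\<^sub>R z) * \<phi> z))"
        unfolding X_def using integral_norm_bound[of lborel "\<lambda>z. ?\<chi> (x + (- 1 / real (Suc n)) *\<^sub>R z) * \<phi> z"] by simp
      also have "\<dots> \<le> (LINT z|lborel. \<phi> z)"
        by (rule integral_mono_AE') (use phi0 littlewood_paley_integral[OF lp] in \<open>auto simp: indicator_def\<close>)
      finally show ?thesis using True by simp
    next
      case False
      have "?\<chi> (x + (- 1 / real (Suc n)) *\<^sub>R z) * \<phi> z = 0" for z
      proof (cases "norm z \<le> 2")
        case True
        have "norm ((- 1 / real (Suc n)) *\<^sub>R z) \<le> norm z" unfolding norm_scaleR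
          by (rule mult_left_le_one_le) auto
        then have "norm (x + (- 1 / real (Suc n)) *\<^sub>R z) > R" 
          using False True norm_triangle_ineq2[of x "- ((- 1 / real (Suc n)) *\<^sub>R z)"] by simp
        then show ?thesis using R by (force simp: indicator_def)
      qed (use phi_supp in auto)
      then have "X n x = 0" unfolding X_def by (simp only: Bochner_Integration.integral_zero)
      then show ?thesis using False by simp
    qed
    have [measurable]: "X n \<in> borel_measurable borel" for n
      unfolding X_def by measurable
    have "(\<lambda>n. LINT x|lborel. g x * of_real (X n x)) \<longlonglongrightarrow> (LINT x|lborel. g x * of_real (?\<chi> x * (LINT z|lborel. \<phi> z)))"
    proof (rule integral_dominated_convergence[where w="\<lambda>x. norm (g x * of_real ((LINT z|lborel. \<phi> z) * indicator (cball 0 (R + 2)) x))"])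
      show "integrable lborel (\<lambda>x. norm (g x * of_real ((LINT z|lborel. \<phi> z) * indicator (cball 0 (R + 2)) x)))"
        by (intro integrable_norm locally_integrable_bounded_support[OF g, of _ "LINT z|lborel. \<phi> z" "R + 2"])
           (use littlewood_paley_integral[OF lp] in \<open>auto simp: indicator_def\<close>)
      have "AE x in lborel. x \<notin> cbox a b - box a b"
        using null_sets_cbox_Diff_box[of a b] by (rule AE_not_in)
      then show "AE x in lborel. (\<lambda>n. g x * of_real (X n x)) \<longlonglongrightarrow> g x * of_real (?\<chi> x * (LINT z|lborel. \<phi> z))"
        by eventually_elim (intro tendsto_intros Xlim)
      show "AE x in lborel. norm (g x * of_real (X n x)) \<le> norm (g x * of_real ((LINT z|lborel. \<phi> z) * indicator (cball 0 (R + 2)) x))" for n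
        using Xb[of n] littlewood_paley_integral(2)[OF lp] unfolding norm_mult norm_of_real
        by (intro AE_I2 mult_left_mono) (auto simp: abs_mult)
    qed measurable
    then have "(LINT x|lborel. g x * of_real (?\<chi> x * (LINT z|lborel. \<phi> z))) = 0"
      unfolding Xzero using LIMSEQ_unique tendsto_const by blast
    then have "(LINT x|lborel. g x * of_real (?\<chi> x)) * of_real (LINT z|lborel. \<phi> z) = 0"
      by (simp add: mult.assoc[symmetric])
    then have "(LINT x|lborel. g x * of_real (?\<chi> x)) = 0" using littlewood_paley_integral(2)[OF lp] by simp
    then show ?thesis by (simp add: of_real_indicator)
  qed
  have iRe: "indicator (box a b) x * Re (g x) = Re (g x * indicator (box a b) x)" "indicator (box a b) x * Im (g x) = Im (g x * indicator (box a b) x)"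
    for a b x by (auto simp: indicator_def)
  have "AE x in lborel. Re (g x) = 0"
  proof (rule AE_zero_of_box_integrals)
    show "integrable lborel (\<lambda>x. indicator (box a b) x * Re (g x))" for a b
      unfolding iRe by (rule integrable_Re[OF box_int])
    show "(LINT x|lborel. indicator (box a b) x * Re (g x)) = 0" for a b
      unfolding iRe integral_Re[OF box_int] box_zero by simp
  qed measurable
  moreover have "AE x in lborel. Im (g x) = 0"
  proof (rule AE_zero_of_box_integrals)
    show "integrable lborel (\<lambda>x. indicator (box a b) x * Im (g x))" for a b
      unfolding iRe by (rule integrable_Im[OF box_int])
    show "(LINT x|lborel. indicator (box a b) x * Im (g x)) = 0" for a b
      unfolding iRe integral_Im[OF box_int] box_zero by simp
  qed measurable
  ultimately show ?thesis by eventually_elim (simp add: complex_eq_iff)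
qed

section \<open>Locally integrable functions\<close>

lemma locally_integrableI:
  fixes g :: "real^'d::finite \<Rightarrow> complex"
  assumes "\<And>R. integrable lborel (\<lambda>x. indicator (cball 0 R) x *\<^sub>R g x)"
  shows "locally_integrable g"
  unfolding locally_integrable_def
proof (intro allI impI)
  fix K :: "(real^'d) set" assume K: "compact K"
  then obtain R where "\<forall>x\<in>K. norm x \<le> R" using compact_imp_bounded bounded_iff by metis
  then have "set_integrable lborel (cball 0 R) g" "K \<subseteq> cball 0 R" using assms by (auto simp: set_integrable_def)
  then show "set_integrable lborel K g" using set_integrable_subset borel_compact[OF K] by (metis sets_lborel)
qed

lemma locally_integrable_integrable:
  fixes g :: "real^'d::finite \<Rightarrow> complex"
  assumes "integrable lborel g" shows "locally_integrable g"
  by (rule locally_integrableI) (intro integrable_mult_indicator assms, simp)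

lemma locally_integrable_mult:
  fixes g m :: "real^'d::finite \<Rightarrow> complex"
  assumes "locally_integrable g" and [measurable]: "m \<in> borel_measurable borel"
    and "\<And>R. \<exists>B. \<forall>x. norm x \<le> R \<longrightarrow> norm (m x) \<le> B"
  shows "locally_integrable (\<lambda>x. m x * g x)"
proof (rule locally_integrableI)
  fix R :: real
  obtain B where B: "\<And>x. norm x \<le> R \<Longrightarrow> norm (m x) \<le> B" using assms(3) by blast
  have "integrable lborel (\<lambda>x. g x * (m x * indicator (cball 0 R) x))"
    by (rule locally_integrable_bounded_support[OF assms(1), of _ "\<bar>B\<bar>" R]) (use B in \<open>force simp: indicator_def\<close>)+
  then show "integrable lborel (\<lambda>x. indicator (cball 0 R) x *\<^sub>R (m x * g x))"
    by (rule back_subst[of "integrable lborel"]) (auto simp: indicator_def)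
qed

lemma locally_integrable_bounded:
  fixes g :: "real^'d::finite \<Rightarrow> complex"
  assumes "g \<in> borel_measurable borel" "\<And>x. norm (g x) \<le> B"
  shows "locally_integrable g"
proof -
  have "locally_integrable (\<lambda>x::real^'d. 1::complex)"
    by (rule locally_integrableI, unfold scaleR_conv_of_real mult_1_right, intro integrable_of_real integrable_real_indicator emeasure_lborel_cball_finite) simp
  from locally_integrable_mult[OF this assms(1)] show ?thesis using assms(2) by auto
qed

lemma locally_integrable_add_diff:
  fixes g h :: "real^'d::finite \<Rightarrow> complex"
  assumes "locally_integrable g" "locally_integrable h"
  shows "locally_integrable (\<lambda>x. g x + h x)" "locally_integrable (\<lambda>x. g x - h x)"
  using assms unfolding locally_integrable_def by (auto intro: set_integral_add set_integral_diff)

lemma locally_integrable_sum: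
  fixes g :: "'i \<Rightarrow> real^'d::finite \<Rightarrow> complex"
  assumes "\<And>i. i \<in> I \<Longrightarrow> locally_integrable (g i)"
  shows "locally_integrable (\<lambda>x. \<Sum>i\<in>I. g i x)"
  using assms
  by (induction I rule: infinite_finite_induct) (auto intro: locally_integrable_add_diff locally_integrable_bounded[of _ 0])

section \<open>Distributions with locally integrable Fourier transform\<close>

lemma has_hat_unique:
  fixes \<phi> :: "real^'d::finite \<Rightarrow> real" and g :: "real^'d \<Rightarrow> complex"
  assumes lp: "littlewood_paley \<phi>" and g: "has_hat T g" and h: "has_hat T h"
  shows "AE \<xi> in lborel. g \<xi> = h \<xi>"
proof -
  have "AE \<xi> in lborel. g \<xi> - h \<xi> = 0"
  proof (rule AE_zero_of_test_integrals[OF lp])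
    show "locally_integrable (\<lambda>x. g x - h x)" using g h by (auto simp: has_hat_def intro: locally_integrable_add_diff)
    fix f :: "real^'d \<Rightarrow> complex" assume f: "test_function f"
    have "integrable lborel (\<lambda>x. g x * f x)" "integrable lborel (\<lambda>x. h x * f x)"
      using g h f by (auto simp: has_hat_def intro: locally_integrable_test)
    then have "(LINT x|lborel. (g x - h x) * f x) = (LINT x|lborel. g x * f x) - (LINT x|lborel. h x * f x)"
      by (simp add: left_diff_distrib)
    then show "(LINT x|lborel. (g x - h x) * f x) = 0" using g h f by (simp add: has_hat_def)
  qed
  then show ?thesis by simp
qed

lemma has_hat_hat: "has_hat T g \<Longrightarrow> has_hat T (hat T)"
  unfolding hat_def by (rule someI[of "has_hat T"])

lemma hat_AE:
  fixes \<phi> :: "real^'d::finite \<Rightarrow> real" and g :: "real^'d \<Rightarrow> complex"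
  assumes "littlewood_paley \<phi>" "has_hat T g" shows "AE \<xi> in lborel. hat T \<xi> = g \<xi>"
  using has_hat_unique[OF assms(1) has_hat_hat[OF assms(2)] assms(2)] .

lemma has_hat_cong_AE:
  assumes "has_hat T g" "AE \<xi> in lborel. g \<xi> = h \<xi>" and [measurable]: "h \<in> borel_measurable borel"
  shows "has_hat T h"
proof -
  have gm [measurable]: "g \<in> borel_measurable borel" using assms(1) locally_integrable_measurable by (auto simp: has_hat_def)
  have "locally_integrable h"
  proof (rule locally_integrableI)
    fix R :: real
    have "integrable lborel (\<lambda>x. indicator (cball 0 R) x *\<^sub>R g x)"
      using assms(1) unfolding has_hat_def locally_integrable_def set_integrable_def by auto
    moreover have "integrable lborel (\<lambda>x. indicator (cball 0 R) x *\<^sub>R g x) \<longleftrightarrow> integrable lborel (\<lambda>x. indicator (cball 0 R) x *\<^sub>R h x)"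
    proof (rule integrable_cong_AE)
      show "(\<lambda>x. indicator (cball 0 R) x *\<^sub>R g x) \<in> borel_measurable lborel" using gm by (intro borel_measurable_scaleR borel_measurable_indicator) auto
      show "(\<lambda>x. indicator (cball 0 R) x *\<^sub>R h x) \<in> borel_measurable lborel" using assms(3) by (intro borel_measurable_scaleR borel_measurable_indicator) auto
    qed (use assms(2) in auto)
    ultimately show "integrable lborel (\<lambda>x. indicator (cball 0 R) x *\<^sub>R h x)" by blast
  qed
  moreover have "(LINT x|lborel. g x * f x) = (LINT x|lborel. h x * f x)" if "test_function f" for f
    using test_function_borel[OF that] by (intro integral_cong_AE) (use assms(2) in auto)
  ultimately show ?thesis using assms(1) by (simp add: has_hat_def)
qed

lemma has_hat_add_diff:
  assumes "has_hat S g" "has_hat T h"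
  shows "has_hat (\<lambda>f. S f + T f) (\<lambda>\<xi>. g \<xi> + h \<xi>)" "has_hat (\<lambda>f. S f - T f) (\<lambda>\<xi>. g \<xi> - h \<xi>)"
  using assms locally_integrable_test unfolding has_hat_def
  by (auto intro!: locally_integrable_add_diff Bochner_Integration.integral_add[symmetric] Bochner_Integration.integral_diff[symmetric] simp: distrib_right left_diff_distrib)

lemma has_hat_inv_fourier_dist:
  "locally_integrable g \<Longrightarrow> has_hat (inv_fourier_dist g) g"
  by (simp add: has_hat_def inv_fourier_dist_def inv_fourier_fourier)

section \<open>Fourier transforms of products\<close>

lemma has_hat_locally_integrable: "has_hat T g \<Longrightarrow> locally_integrable g"
  by (simp only: has_hat_def)

lemma has_hat_measurable: "has_hat T g \<Longrightarrow> g \<in> borel_measurable borel"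
  by (intro locally_integrable_measurable has_hat_locally_integrable)

text \<open>Where the integral does not converge the value is \<open>0\<close>; for integrable factors this happens on a
  null set only.\<close>

definition conv :: "(real^'d::finite \<Rightarrow> complex) \<Rightarrow> (real^'d \<Rightarrow> complex) \<Rightarrow> real^'d \<Rightarrow> complex" where
  "conv a b \<xi> = (LINT \<eta>|lborel. a \<eta> * b (\<xi> - \<eta>))"

lemma integrable_conv_pair:
  fixes a b :: "real^'d::finite \<Rightarrow> complex"
  assumes a: "integrable lborel a" and b: "integrable lborel b"
  shows "integrable (lborel \<Otimes>\<^sub>M lborel) (\<lambda>(\<eta>, \<xi>). a \<eta> * b (\<xi> - \<eta>))"
proof (rule lborel_pair.Fubini_integrable)
  have [measurable]: "a \<in> borel_measurable borel" "b \<in> borel_measurable borel"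
    using borel_measurable_integrable[OF a] borel_measurable_integrable[OF b] by simp_all
  show "(\<lambda>(\<eta>, \<xi>). a \<eta> * b (\<xi> - \<eta>)) \<in> borel_measurable (lborel \<Otimes>\<^sub>M lborel)" by measurable
  have b': "integrable lborel (\<lambda>\<xi>. b (\<xi> - \<eta>))" for \<eta>
    using lborel_integrable_affine[OF b, of 1 "- \<eta>"] by (simp add: add.commute)
  then show "AE \<eta> in lborel. integrable lborel (\<lambda>\<xi>. case (\<eta>, \<xi>) of (\<eta>, \<xi>) \<Rightarrow> a \<eta> * b (\<xi> - \<eta>))" by simp
  have "(LINT \<xi>|lborel. norm (case (\<eta>, \<xi>) of (\<eta>, \<xi>) \<Rightarrow> a \<eta> * b (\<xi> - \<eta>))) = norm (a \<eta>) * (LINT \<xi>|lborel. norm (b \<xi>))" for \<eta>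
    using lborel_integral_translate[of "\<lambda>\<xi>. norm (b \<xi>)" "- \<eta>"] by (simp add: norm_mult)
  then show "integrable lborel (\<lambda>\<eta>. LINT \<xi>|lborel. norm (case (\<eta>, \<xi>) of (\<eta>, \<xi>) \<Rightarrow> a \<eta> * b (\<xi> - \<eta>)))"
    using a by simp
qed

lemma integrable_conv:
  fixes a b :: "real^'d::finite \<Rightarrow> complex"
  assumes "integrable lborel a" "integrable lborel b"
  shows "integrable lborel (conv a b)"
  unfolding conv_def[abs_def] by (rule lborel_pair.integrable_snd[OF integrable_conv_pair[OF assms]])

lemma inv_fourier_mult:
  fixes a b :: "real^'d::finite \<Rightarrow> complex"
  assumes a: "integrable lborel a" and b: "integrable lborel b"
  shows "inv_fourier a x * inv_fourier b x = inv_fourier (\<lambda>\<xi>. of_real (fourier_const TYPE('d)) * conv a b \<xi>) x"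
proof -
  let ?c = "complex_of_real (fourier_const TYPE('d))" and ?e = "\<lambda>\<xi>. wave x \<xi>"
  have [measurable]: "a \<in> borel_measurable borel" "b \<in> borel_measurable borel"
    using borel_measurable_integrable[OF a] borel_measurable_integrable[OF b] by simp_all
  have int: "integrable (lborel \<Otimes>\<^sub>M lborel) (\<lambda>(\<eta>, \<xi>). ?e \<xi> * (a \<eta> * b (\<xi> - \<eta>)))"
    by (rule Bochner_Integration.integrable_bound[OF integrable_conv_pair[OF a b]]) (auto simp: norm_mult intro!: AE_I2)
  have "(LINT \<eta>|lborel. ?e \<eta> * a \<eta>) * (LINT \<zeta>|lborel. ?e \<zeta> * b \<zeta>) = (LINT \<eta>|lborel. (?e \<eta> * a \<eta>) * (LINT \<zeta>|lborel. ?e \<zeta> * b \<zeta>))"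
    by simp
  also have "\<dots> = (LINT \<eta>|lborel. LINT \<xi>|lborel. ?e \<xi> * (a \<eta> * b (\<xi> - \<eta>)))"
  proof (intro Bochner_Integration.integral_cong refl)
    fix \<eta> :: "real^'d"
    have "(LINT \<zeta>|lborel. ?e \<zeta> * b \<zeta>) = (LINT \<xi>|lborel. ?e (\<xi> - \<eta>) * b (\<xi> - \<eta>))"
      using lborel_integral_translate[of "\<lambda>\<zeta>. ?e \<zeta> * b \<zeta>" "- \<eta>"] by simp
    then have "?e \<eta> * a \<eta> * (LINT \<zeta>|lborel. ?e \<zeta> * b \<zeta>) = (LINT \<xi>|lborel. ?e \<eta> * a \<eta> * (?e (\<xi> - \<eta>) * b (\<xi> - \<eta>)))"
      by simp
    also have "\<dots> = (LINT \<xi>|lborel. ?e \<xi> * (a \<eta> * b (\<xi> - \<eta>)))"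
      by (intro Bochner_Integration.integral_cong refl) (simp add: inner_diff_right algebra_simps exp_diff)
    finally show "?e \<eta> * a \<eta> * (LINT \<zeta>|lborel. ?e \<zeta> * b \<zeta>) = (LINT \<xi>|lborel. ?e \<xi> * (a \<eta> * b (\<xi> - \<eta>)))" .
  qed
  also have "\<dots> = (LINT \<xi>|lborel. LINT \<eta>|lborel. ?e \<xi> * (a \<eta> * b (\<xi> - \<eta>)))"
    using lborel_pair.Fubini_integral[OF int] by simp
  also have "\<dots> = (LINT \<xi>|lborel. ?e \<xi> * conv a b \<xi>)"
    by (simp add: conv_def)
  finally have eq: "(LINT \<eta>|lborel. ?e \<eta> * a \<eta>) * (LINT \<zeta>|lborel. ?e \<zeta> * b \<zeta>) = (LINT \<xi>|lborel. ?e \<xi> * conv a b \<xi>)" .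
  have "inv_fourier (\<lambda>\<xi>. ?c * conv a b \<xi>) x = ?c * (LINT \<xi>|lborel. ?c * (?e \<xi> * conv a b \<xi>))"
    unfolding inv_fourier_def by (simp only: mult_ac)
  also have "\<dots> = ?c * (?c * (LINT \<xi>|lborel. ?e \<xi> * conv a b \<xi>))"
    by (subst integral_mult_right_zero) simp
  finally show ?thesis unfolding eq[symmetric] by (simp add: inv_fourier_def mult_ac)
qed

text \<open>Both sides are the same double integral of \<open>e\<^sup>i\<^sup>x\<^sup>\<xi> F(x) g(\<xi>)\<close>.\<close>

lemma inv_fourier_multiplication_formula:
  fixes g F :: "real^'d::finite \<Rightarrow> complex"
  assumes g: "integrable lborel g" and F: "integrable lborel F"
  shows "(LINT x|lborel. inv_fourier g x * F x) = (LINT \<xi>|lborel. g \<xi> * inv_fourier F \<xi>)"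
proof -
  let ?c = "complex_of_real (fourier_const TYPE('d))"
  have int: "integrable (lborel \<Otimes>\<^sub>M lborel) (\<lambda>(x, \<xi>). wave x \<xi> * (F x * g \<xi>))"
    by (rule integrable_pair_mult[OF _ _ _ _ F g, of _ 1]) (auto intro: sigma_finite_lborel)
  have "(LINT x|lborel. inv_fourier g x * F x) = (LINT x|lborel. ?c * (LINT \<xi>|lborel. wave x \<xi> * (F x * g \<xi>)))"
  proof (intro Bochner_Integration.integral_cong refl)
    fix x :: "real^'d"
    have "(LINT \<xi>|lborel. wave x \<xi> * (F x * g \<xi>)) = (LINT \<xi>|lborel. F x * (wave x \<xi> * g \<xi>))"
      by (simp only: mult_ac)
    then show "inv_fourier g x * F x = ?c * (LINT \<xi>|lborel. wave x \<xi> * (F x * g \<xi>))"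
      by (simp add: inv_fourier_def mult_ac)
  qed
  also have "\<dots> = ?c * (LINT x|lborel. LINT \<xi>|lborel. wave x \<xi> * (F x * g \<xi>))"
    by (rule integral_mult_right_zero)
  also have "\<dots> = ?c * (LINT \<xi>|lborel. LINT x|lborel. wave x \<xi> * (F x * g \<xi>))"
    by (subst lborel_pair.Fubini_integral[OF int]) simp
  also have "\<dots> = (LINT \<xi>|lborel. ?c * (LINT x|lborel. wave x \<xi> * (F x * g \<xi>)))"
    by (rule integral_mult_right_zero[symmetric])
  also have "\<dots> = (LINT \<xi>|lborel. g \<xi> * inv_fourier F \<xi>)"
  proof (intro Bochner_Integration.integral_cong refl)
    fix \<xi> :: "real^'d"
    have "(LINT x|lborel. wave x \<xi> * (F x * g \<xi>)) = (LINT x|lborel. g \<xi> * (wave \<xi> x * F x))"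
      by (simp only: mult_ac inner_commute)
    also have "\<dots> = g \<xi> * (LINT x|lborel. wave \<xi> x * F x)"
      by (rule integral_mult_right_zero)
    finally show "?c * (LINT x|lborel. wave x \<xi> * (F x * g \<xi>)) = g \<xi> * inv_fourier F \<xi>"
      by (simp only: inv_fourier_def mult.left_commute)
  qed
  finally show ?thesis .
qed

lemma has_hat_dist_of_inv_fourier:
  fixes g :: "real^'d::finite \<Rightarrow> complex"
  assumes "integrable lborel g"
  shows "has_hat (dist_of_fun (inv_fourier g)) g"
  unfolding has_hat_def dist_of_fun_def
  using assms inv_fourier_multiplication_formula[OF assms fourier_test_integrable]
  by (simp add: locally_integrable_integrable inv_fourier_fourier)

lemma inv_fourier_cong_AE:
  fixes g h :: "real^'d::finite \<Rightarrow> complex"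
  assumes "AE \<xi> in lborel. g \<xi> = h \<xi>" and [measurable]: "g \<in> borel_measurable borel" "h \<in> borel_measurable borel"
  shows "inv_fourier g x = inv_fourier h x"
  unfolding inv_fourier_def
  by (intro arg_cong2[where f="(*)"] refl integral_cong_AE) (use assms(1) in auto)

text \<open>The transform of \<open>u\<^sub>l u\<^sub>m\<close> is a constant times \<open>U\<^sub>l * U\<^sub>m\<close>, and a derivative in
  direction \<open>m\<close> multiplies it by \<open>i \<xi>\<^sub>m\<close>.\<close>

lemma has_hat_div_tensor:
  fixes \<phi> :: "real^'d::finite \<Rightarrow> real" and u :: "('d dist)^'d" and U :: "'d \<Rightarrow> real^'d \<Rightarrow> complex"
  assumes lp: "littlewood_paley \<phi>" and U: "\<And>m. has_hat (u $ m) (U m)" "\<And>m. integrable lborel (U m)"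
  shows "has_hat (div_tensor (tensor_square u) $ l)
    (\<lambda>\<xi>. \<Sum>m\<in>UNIV. \<i> * of_real (\<xi> $ m) * (of_real (fourier_const TYPE('d)) * conv (U l) (U m) \<xi>))"
proof -
  let ?c = "complex_of_real (fourier_const TYPE('d))"
  have [measurable]: "U m \<in> borel_measurable borel" for m using borel_measurable_integrable[OF U(2)] by simp
  have hatU: "AE \<xi> in lborel. hat (u $ m) \<xi> = U m \<xi>" "hat (u $ m) \<in> borel_measurable borel" for m
    using hat_AE[OF lp U(1)] has_hat_hat[OF U(1)] locally_integrable_measurable by (auto simp: has_hat_def)
  have ci: "integrable lborel (\<lambda>\<xi>. ?c * conv (U l) (U m) \<xi>)" for m
    by (intro integrable_mult_right integrable_conv U)
  have W: "tensor_square u $ l $ m = dist_of_fun (inv_fourier (\<lambda>\<xi>. ?c * conv (U l) (U m) \<xi>))" for m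
    unfolding tensor_square_def 
    by (simp add: inv_fourier_cong_AE[OF hatU(1) hatU(2)] inv_fourier_mult[OF U(2) U(2)])
  have li: "locally_integrable (\<lambda>\<xi>. \<i> * of_real (\<xi> $ m) * (?c * conv (U l) (U m) \<xi>))" for m
  proof (rule locally_integrable_mult[OF locally_integrable_integrable[OF ci]])
    show "\<exists>B. \<forall>x. norm x \<le> R \<longrightarrow> cmod (\<i> * complex_of_real (x $ m)) \<le> B" for R
      by (intro exI[of _ R]) (auto simp: norm_mult intro: order_trans[OF component_le_norm_cart])
  qed measurable
  show ?thesis
    unfolding has_hat_def
  proof (intro conjI allI impI)
    show "locally_integrable (\<lambda>\<xi>. \<Sum>m\<in>UNIV. \<i> * of_real (\<xi> $ m) * (?c * conv (U l) (U m) \<xi>))"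
      by (rule locally_integrable_sum) (rule li)
    fix f :: "real^'d \<Rightarrow> complex" assume f: "test_function f"
    have W': "(tensor_square u $ l $ m) (partial_deriv m (fourier f)) = - (LINT \<xi>|lborel. \<i> * of_real (\<xi> $ m) * (?c * conv (U l) (U m) \<xi>) * f \<xi>)" for m
    proof -
      have "(tensor_square u $ l $ m) (partial_deriv m (fourier f)) = (LINT \<xi>|lborel. ?c * conv (U l) (U m) \<xi> * (- \<i> * of_real (\<xi> $ m) * f \<xi>))"
        unfolding partial_deriv_fourier[OF f] W
        using has_hat_dist_of_inv_fourier[OF ci] test_function_coord[OF f, of "- \<i>" m]
        unfolding has_hat_def by blast
      also have "\<dots> = (LINT \<xi>|lborel. - (\<i> * of_real (\<xi> $ m) * (?c * conv (U l) (U m) \<xi>) * f \<xi>))"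
        by (intro Bochner_Integration.integral_cong refl) (simp add: mult_ac)
      finally show ?thesis by simp
    qed
    have "(div_tensor (tensor_square u) $ l) (fourier f) = (\<Sum>m\<in>UNIV. LINT \<xi>|lborel. \<i> * of_real (\<xi> $ m) * (?c * conv (U l) (U m) \<xi>) * f \<xi>)"
      unfolding div_tensor_def by (simp add: W' sum_negf)
    also have "\<dots> = (LINT \<xi>|lborel. (\<Sum>m\<in>UNIV. \<i> * of_real (\<xi> $ m) * (?c * conv (U l) (U m) \<xi>) * f \<xi>))"
      by (rule Bochner_Integration.integral_sum[symmetric]) (rule locally_integrable_test[OF li f])
    finally show "(div_tensor (tensor_square u) $ l) (fourier f) = (LINT \<xi>|lborel. (\<Sum>m\<in>UNIV. \<i> * of_real (\<xi> $ m) * (?c * conv (U l) (U m) \<xi>)) * f \<xi>)"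
      by (simp add: sum_distrib_right)
  qed
qed

lemma leray_symbol_measurable [measurable]: "(\<lambda>\<xi>. leray_symbol \<xi> $ l $ m) \<in> borel_measurable borel"
proof -
  have "(\<lambda>\<xi>::real^'a. leray_symbol \<xi> $ l $ m) = (\<lambda>\<xi>. (if l = m then 1 else 0) - \<xi> $ l * \<xi> $ m / (norm \<xi>)\<^sup>2)"
    by (simp add: leray_symbol_def)
  also have "\<dots> \<in> borel_measurable borel"
  proof -
    have [measurable]: "(\<lambda>\<xi>::real^'a. \<xi> $ l) \<in> borel_measurable borel" for l
      by (intro borel_measurable_continuous_onI continuous_intros)
    show ?thesis by measurable
  qed
  finally show ?thesis .
qed

lemma leray_symbol_bound: "\<bar>leray_symbol \<xi> $ l $ m\<bar> \<le> 2"
proof -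
  have "\<bar>\<xi> $ l * \<xi> $ m\<bar> \<le> norm \<xi> * norm \<xi>"
    unfolding abs_mult by (intro mult_mono component_le_norm_cart) auto
  define q where "q = \<xi> $ l * \<xi> $ m / (norm \<xi>)\<^sup>2"
  have "\<bar>q\<bar> \<le> 1"
    using \<open>\<bar>\<xi> $ l * \<xi> $ m\<bar> \<le> norm \<xi> * norm \<xi>\<close> unfolding q_def abs_divide
    by (cases "\<xi> = 0") (auto simp: power2_eq_square divide_le_eq)
  moreover have "leray_symbol \<xi> $ l $ m = (if l = m then 1 else 0) - q" by (simp add: leray_symbol_def q_def)
  ultimately show ?thesis by (auto split: if_splits)
qed

lemma hat_nonlinearity:
  fixes \<phi> :: "real^'d::finite \<Rightarrow> real" and u :: "('d dist)^'d" and U :: "'d \<Rightarrow> real^'d \<Rightarrow> complex"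
  assumes lp: "littlewood_paley \<phi>" and U: "\<And>m. has_hat (u $ m) (U m)" "\<And>m. integrable lborel (U m)"
  defines "g \<equiv> \<lambda>i \<xi>. \<Sum>l\<in>UNIV. of_real (leray_symbol \<xi> $ i $ l) *
      (\<Sum>m\<in>UNIV. \<i> * of_real (\<xi> $ m) * (of_real (fourier_const TYPE('d)) * conv (U l) (U m) \<xi>))"
  shows "has_hat (leray_proj (div_tensor (tensor_square u)) $ i) (g i)"
proof -
  let ?h = "\<lambda>l \<xi>. \<Sum>m\<in>UNIV. \<i> * of_real (\<xi> $ m) * (of_real (fourier_const TYPE('d)) * conv (U l) (U m) \<xi>)"
  note h = has_hat_div_tensor[OF lp U]
  have hm: "?h l \<in> borel_measurable borel" for l by (rule has_hat_measurable[OF h])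
  have lm: "(\<lambda>\<xi>. complex_of_real (leray_symbol \<xi> $ i $ l)) \<in> borel_measurable borel" for l by measurable
  have lb: "\<exists>B. \<forall>\<xi>::real^'d. norm \<xi> \<le> R \<longrightarrow> cmod (complex_of_real (leray_symbol \<xi> $ i $ l)) \<le> B" for l R
    by (intro exI[of _ 2]) (simp add: leray_symbol_bound)
  have hl: "locally_integrable (hat (div_tensor (tensor_square u) $ l))" for l
    by (rule has_hat_locally_integrable[OF has_hat_hat[OF h]])
  have "locally_integrable (\<lambda>\<xi>. \<Sum>l\<in>UNIV. of_real (leray_symbol \<xi> $ i $ l) * hat (div_tensor (tensor_square u) $ l) \<xi>)"
    by (intro locally_integrable_sum locally_integrable_mult lm lb hl)
  then have 1: "has_hat (leray_proj (div_tensor (tensor_square u)) $ i)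
     (\<lambda>\<xi>. \<Sum>l\<in>UNIV. of_real (leray_symbol \<xi> $ i $ l) * hat (div_tensor (tensor_square u) $ l) \<xi>)"
    unfolding leray_proj_def vec_lambda_beta by (rule has_hat_inv_fourier_dist)
  have 2: "AE \<xi> in lborel. \<forall>l\<in>UNIV. hat (div_tensor (tensor_square u) $ l) \<xi> = ?h l \<xi>"
    by (rule AE_finite_allI[OF finite]) (rule hat_AE[OF lp h])
  show ?thesis
  proof (rule has_hat_cong_AE[OF 1])
    show "AE \<xi> in lborel. (\<Sum>l\<in>UNIV. of_real (leray_symbol \<xi> $ i $ l) * hat (div_tensor (tensor_square u) $ l) \<xi>) = g i \<xi>"
      using 2 by eventually_elim (simp add: g_def)
    show "g i \<in> borel_measurable borel"
      unfolding g_def by (intro borel_measurable_sum borel_measurable_times lm hm)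
  qed
qed

section \<open>Tempered distributions\<close>

lemma finite_lists_length_le_UNIV: "finite {is :: 'd::finite list. length is \<le> N}"
  using finite_lists_length_le[of "UNIV :: 'd set" N] by simp

lemma schwartz_bdd:
  assumes "schwartz f" shows "bdd_above (range (\<lambda>x. (1 + norm x) ^ N * norm (iter_partial is f x)))"
proof -
  have "bounded (range (\<lambda>x. (1 + norm x) ^ N *\<^sub>R iter_partial is f x))" using assms unfolding schwartz_def by blast
  then obtain B where "\<And>x. norm ((1 + norm x) ^ N *\<^sub>R iter_partial is f x) \<le> B" unfolding bounded_iff by blast
  then show ?thesis by (intro bdd_aboveI[of _ B]) auto
qed

lemma schwartz_seminorm_ge:
  assumes f: "schwartz f" shows "(1 + norm x) ^ N * norm (f x) \<le> schwartz_seminorm N f"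
proof -
  have "(1 + norm x) ^ N * norm (f x) = (1 + norm x) ^ N * norm (iter_partial [] f x)" by (simp add: iter_partial_def)
  also have "\<dots> \<le> (SUP x. (1 + norm x) ^ N * norm (iter_partial [] f x))"
    by (intro cSUP_upper schwartz_bdd[OF f]) simp
  also have "\<dots> \<le> schwartz_seminorm N f"
    unfolding schwartz_seminorm_def
    by (rule member_le_sum) (auto intro!: finite_lists_length_le_UNIV cSUP_upper2[OF schwartz_bdd[OF f]])
  finally show ?thesis .
qed

lemma schwartz_seminorm_mono:
  assumes f: "schwartz f" and "M \<le> N" shows "schwartz_seminorm M f \<le> schwartz_seminorm N f"
proof -
  have nn: "0 \<le> (SUP x. (1 + norm x) ^ N * norm (iter_partial is f x))" for "is"
    by (rule cSUP_upper2[OF schwartz_bdd[OF f]]) auto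
  have "schwartz_seminorm M f \<le> (\<Sum>is | length is \<le> M. SUP x. (1 + norm x) ^ N * norm (iter_partial is f x))"
    unfolding schwartz_seminorm_def
    by (intro sum_mono cSUP_mono schwartz_bdd[OF f]) (use assms(2) in \<open>auto intro!: mult_right_mono power_increasing exI\<close>)
  also have "\<dots> \<le> schwartz_seminorm N f"
    unfolding schwartz_seminorm_def
    by (rule sum_mono2) (use assms(2) nn in \<open>auto simp: finite_lists_length_le_UNIV\<close>)
  finally show ?thesis .
qed

lemma schwartz_seminorm_nonneg: "schwartz f \<Longrightarrow> 0 \<le> schwartz_seminorm N f"
  using schwartz_seminorm_ge[of f 0 N] by (smt (verit) mult_nonneg_nonneg norm_ge_zero zero_le_power)

lemma tempered_add_diff:
  assumes S: "tempered S" and T: "tempered T"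
  shows "tempered (\<lambda>f. S f - T f)" "tempered (\<lambda>f. S f + T f)"
proof -
  obtain N C where 1: "\<And>f. schwartz f \<Longrightarrow> norm (S f) \<le> C * schwartz_seminorm N f" using S unfolding tempered_def by blast
  obtain M D where 2: "\<And>f. schwartz f \<Longrightarrow> norm (T f) \<le> D * schwartz_seminorm M f" using T unfolding tempered_def by blast
  have b: "norm (S f) + norm (T f) \<le> (\<bar>C\<bar> + \<bar>D\<bar>) * schwartz_seminorm (max N M) f" if f: "schwartz f" for f
  proof -
    have "norm (S f) \<le> \<bar>C\<bar> * schwartz_seminorm (max N M) f"
      using 1[OF f] schwartz_seminorm_mono[OF f, of N "max N M"] schwartz_seminorm_nonneg[OF f, of N]
      by (smt (verit) max.cobounded1 mult_mono abs_ge_self abs_ge_zero)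
    moreover have "norm (T f) \<le> \<bar>D\<bar> * schwartz_seminorm (max N M) f"
      using 2[OF f] schwartz_seminorm_mono[OF f, of M "max N M"] schwartz_seminorm_nonneg[OF f, of M]
      by (smt (verit) max.cobounded2 mult_mono abs_ge_self abs_ge_zero)
    ultimately show ?thesis by (simp add: distrib_right)
  qed
  have lin: "S (\<lambda>x. a * f x + b * g x) = a * S f + b * S g" "T (\<lambda>x. a * f x + b * g x) = a * T f + b * T g"
    if "schwartz f" "schwartz g" for f g a b using S T that unfolding tempered_def by blast+
  show "tempered (\<lambda>f. S f - T f)"
    unfolding tempered_def
  proof (intro conjI allI impI exI)
    show "norm (S f - T f) \<le> (\<bar>C\<bar> + \<bar>D\<bar>) * schwartz_seminorm (max N M) f" if "schwartz f" for f
      using b[OF that] norm_triangle_ineq4 order_trans by blast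
  qed (simp add: lin algebra_simps)
  show "tempered (\<lambda>f. S f + T f)"
    unfolding tempered_def
  proof (intro conjI allI impI exI)
    show "norm (S f + T f) \<le> (\<bar>C\<bar> + \<bar>D\<bar>) * schwartz_seminorm (max N M) f" if "schwartz f" for f
      using b[OF that] norm_triangle_ineq order_trans by blast
  qed (simp add: lin algebra_simps)
qed

text \<open>A Schwartz function is bounded by its seminorm of order \<open>k\<close> times \<open>(1 + \<bar>x\<bar>)\<^sup>-\<^sup>k\<close>, which is
  integrable for large \<open>k\<close>.\<close>

lemma tempered_dist_of_bounded:
  fixes g :: "real^'d::finite \<Rightarrow> complex"
  assumes [measurable]: "g \<in> borel_measurable borel" and B: "\<And>x. norm (g x) \<le> B"
  shows "tempered (dist_of_fun g)"
proof -
  obtain k where k: "integrable lborel (\<lambda>x::real^'d. 1 / (1 + norm x) ^ k)" using integrable_decay by blast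
  have B0: "B \<ge> 0" using B[of 0] norm_ge_zero order_trans by blast
  have b: "norm (g x * f x) \<le> B * schwartz_seminorm k f * (1 / (1 + norm x) ^ k)" if f: "schwartz f" for f x
  proof -
    have "(1 + norm x) ^ k > 0" by (simp add: add_pos_nonneg)
    then have "norm (f x) \<le> schwartz_seminorm k f * (1 / (1 + norm x) ^ k)"
      using schwartz_seminorm_ge[OF f, of x k] by (simp add: field_simps)
    then have "norm (g x) * norm (f x) \<le> B * (schwartz_seminorm k f * (1 / (1 + norm x) ^ k))"
      using B[of x] B0 by (intro mult_mono) auto
    then show ?thesis by (simp add: norm_mult)
  qed
  have int: "integrable lborel (\<lambda>x. g x * f x)" if f: "schwartz f" for f
  proof (rule Bochner_Integration.integrable_bound)
    show "integrable lborel (\<lambda>x::real^'d. B * schwartz_seminorm k f * (1 / (1 + norm x) ^ k))"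
      by (intro integrable_mult_right k)
    have [measurable]: "f \<in> borel_measurable borel"
      using f smooth_fun_continuous unfolding schwartz_def by (intro borel_measurable_continuous_onI) blast
    show "(\<lambda>x. g x * f x) \<in> borel_measurable lborel" by measurable
    show "AE x in lborel. norm (g x * f x) \<le> norm (B * schwartz_seminorm k f * (1 / (1 + norm x) ^ k))"
      using b[OF f] by (intro AE_I2) (metis abs_ge_self order_trans real_norm_def)
  qed
  show ?thesis
    unfolding tempered_def dist_of_fun_def
  proof (intro conjI allI impI exI)
    fix f h :: "real^'d \<Rightarrow> complex" and a b :: complex assume "schwartz f" "schwartz h"
    then have i: "integrable lborel (\<lambda>x. a * (g x * f x))" "integrable lborel (\<lambda>x. b * (g x * h x))" using int by auto
    have "(LINT x|lborel. g x * (a * f x + b * h x)) = (LINT x|lborel. a * (g x * f x) + b * (g x * h x))"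
      by (simp add: algebra_simps)
    also have "\<dots> = (LINT x|lborel. a * (g x * f x)) + (LINT x|lborel. b * (g x * h x))"
      by (rule Bochner_Integration.integral_add[OF i])
    finally show "(LINT x|lborel. g x * (a * f x + b * h x)) = a * (LINT x|lborel. g x * f x) + b * (LINT x|lborel. g x * h x)" by simp
  next
    fix f :: "real^'d \<Rightarrow> complex" assume f: "schwartz f"
    have "norm (LINT x|lborel. g x * f x) \<le> (LINT x|lborel. norm (g x * f x))" by (rule integral_norm_bound)
    also have "\<dots> \<le> (LINT x|lborel. B * schwartz_seminorm k f * (1 / (1 + norm (x::real^'d)) ^ k))"
      by (intro integral_mono integrable_norm[OF int[OF f]] integrable_mult_right[OF k] b[OF f])
    also have "\<dots> = B * schwartz_seminorm k f * (LINT x|lborel. 1 / (1 + norm (x::real^'d)) ^ k)"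
      by (rule integral_mult_right_zero)
    finally show "norm (LINT x|lborel. g x * f x) \<le> B * (LINT x|lborel. 1 / (1 + norm (x::real^'d)) ^ k) * schwartz_seminorm k f"
      by (simp only: mult_ac)
  qed
qed

section \<open>Integral inequalities in extended nonnegative reals\<close>

lemma ennreal_two_mult_le: "2 * (a * b) \<le> a\<^sup>2 + (b::ennreal)\<^sup>2"
proof (cases a; cases b)
  fix x y assume xy: "a = ennreal x" "0 \<le> x" "b = ennreal y" "0 \<le> y"
  have "2 * (x * y) \<le> x\<^sup>2 + y\<^sup>2" using sum_squares_bound[of x y] by simp
  then have "ennreal (2 * (x * y)) \<le> ennreal (x\<^sup>2 + y\<^sup>2)" by (rule ennreal_leI)
  then show ?thesis using xy by (simp add: ennreal_mult ennreal_power ennreal_plus)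
qed (auto simp: power2_eq_square)

lemma ennreal_le_of_square_le:
  assumes "x\<^sup>2 \<le> ennreal (a\<^sup>2) * ennreal (b\<^sup>2)" "0 \<le> a" "0 \<le> b"
  shows "x \<le> ennreal (a * b)"
proof (cases x)
  case (real r)
  then have "ennreal (r\<^sup>2) \<le> ennreal ((a * b)\<^sup>2)"
    using assms by (simp add: ennreal_power ennreal_mult[symmetric] power_mult_distrib)
  then have "r\<^sup>2 \<le> (a * b)\<^sup>2" by (subst (asm) ennreal_le_iff) auto
  then have "r \<le> a * b" using assms by (intro power2_le_imp_le[of r]) auto
  then show ?thesis using real by (simp add: ennreal_leI)
next
  case top
  then show ?thesis using assms(1) by (simp add: ennreal_mult[symmetric] power2_eq_square top_unique)
qed

text \<open>A linear operator whose kernel slices have \<open>L\<^sup>2\<close> norm at most \<open>\<surd>S\<close> maps \<open>L\<^sup>1\<close> to \<open>L\<^sup>2\<close>; this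
  is Minkowski's integral inequality. Expanding the square and using \<open>2ab \<le> a\<^sup>2 + b\<^sup>2\<close> on the two
  kernels avoids square roots of extended reals.\<close>

lemma nn_integral_kernel_L1_L2:
  fixes k :: "'t \<Rightarrow> 'z \<Rightarrow> ennreal"
  assumes T: "sigma_finite_measure T" and Z: "sigma_finite_measure Z"
    and k[measurable]: "(\<lambda>(t, z). k t z) \<in> borel_measurable (T \<Otimes>\<^sub>M Z)"
    and F[measurable]: "F \<in> borel_measurable Z"
    and S: "\<And>z. z \<in> space Z \<Longrightarrow> (\<integral>\<^sup>+t. (k t z)\<^sup>2 \<partial>T) \<le> S"
  shows "(\<integral>\<^sup>+t. (\<integral>\<^sup>+z. k t z * F z \<partial>Z)\<^sup>2 \<partial>T) \<le> S * (\<integral>\<^sup>+z. F z \<partial>Z)\<^sup>2"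
proof -
  interpret T: sigma_finite_measure T by fact
  interpret Z: sigma_finite_measure Z by fact
  interpret TZ: pair_sigma_finite T Z ..
  have kk: "(\<integral>\<^sup>+t. k t z * k t z' \<partial>T) \<le> S" if z: "z \<in> space Z" "z' \<in> space Z" for z z'
  proof -
    have [measurable]: "(\<lambda>t. k t z) \<in> borel_measurable T" "(\<lambda>t. k t z') \<in> borel_measurable T"
      using z by measurable
    have "2 * (\<integral>\<^sup>+t. k t z * k t z' \<partial>T) = (\<integral>\<^sup>+t. 2 * (k t z * k t z') \<partial>T)"
      by (subst nn_integral_cmult) auto
    also have "\<dots> \<le> (\<integral>\<^sup>+t. (k t z)\<^sup>2 + (k t z')\<^sup>2 \<partial>T)"
      by (intro nn_integral_mono ennreal_two_mult_le)
    also have "\<dots> = (\<integral>\<^sup>+t. (k t z)\<^sup>2 \<partial>T) + (\<integral>\<^sup>+t. (k t z')\<^sup>2 \<partial>T)"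
      by (intro nn_integral_add) auto
    also have "\<dots> \<le> 2 * S" unfolding mult_2 by (intro add_mono S z)
    finally show ?thesis by (subst (asm) ennreal_mult_le_mult_iff) auto
  qed
  have "(\<integral>\<^sup>+t. (\<integral>\<^sup>+z. k t z * F z \<partial>Z)\<^sup>2 \<partial>T) = (\<integral>\<^sup>+t. \<integral>\<^sup>+z. k t z * F z * (\<integral>\<^sup>+z'. k t z' * F z' \<partial>Z) \<partial>Z \<partial>T)"
    unfolding power2_eq_square by (intro nn_integral_cong nn_integral_multc[symmetric]) measurable
  also have "\<dots> = (\<integral>\<^sup>+z. \<integral>\<^sup>+t. k t z * F z * (\<integral>\<^sup>+z'. k t z' * F z' \<partial>Z) \<partial>T \<partial>Z)"
    by (rule TZ.Fubini'[symmetric]) measurable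
  also have "\<dots> = (\<integral>\<^sup>+z. \<integral>\<^sup>+t. \<integral>\<^sup>+z'. k t z * F z * (k t z' * F z') \<partial>Z \<partial>T \<partial>Z)"
    by (intro nn_integral_cong nn_integral_cmult[symmetric]) measurable
  also have "\<dots> = (\<integral>\<^sup>+z. \<integral>\<^sup>+z'. \<integral>\<^sup>+t. k t z * F z * (k t z' * F z') \<partial>T \<partial>Z \<partial>Z)"
    by (intro nn_integral_cong TZ.Fubini'[symmetric]) measurable
  also have "\<dots> = (\<integral>\<^sup>+z. \<integral>\<^sup>+z'. \<integral>\<^sup>+t. F z * F z' * (k t z * k t z') \<partial>T \<partial>Z \<partial>Z)"
    by (simp only: mult_ac)
  also have "\<dots> = (\<integral>\<^sup>+z. \<integral>\<^sup>+z'. F z * F z' * (\<integral>\<^sup>+t. k t z * k t z' \<partial>T) \<partial>Z \<partial>Z)"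
    by (intro nn_integral_cong nn_integral_cmult) measurable
  also have "\<dots> \<le> (\<integral>\<^sup>+z. \<integral>\<^sup>+z'. F z * F z' * S \<partial>Z \<partial>Z)"
    by (intro nn_integral_mono mult_left_mono kk) auto
  also have "\<dots> = (\<integral>\<^sup>+z. F z * ((\<integral>\<^sup>+z'. F z' \<partial>Z) * S) \<partial>Z)"
    by (intro nn_integral_cong) (simp add: nn_integral_cmult nn_integral_multc mult.assoc)
  also have "\<dots> = S * (\<integral>\<^sup>+z. F z \<partial>Z)\<^sup>2"
    by (simp add: nn_integral_multc nn_integral_cmult power2_eq_square mult_ac)
  finally show ?thesis .
qed

lemma AE_lborel_reflect:
  fixes a :: "'a::euclidean_space"
  assumes "AE x in lborel. P x" shows "AE x in lborel. P (a - x)"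
proof -
  have eq: "distr lborel borel (\<lambda>x. a - x) = (lborel :: 'a measure)"
    using lborel_affine[of "-1" a] by (simp add: density_1)
  have "AE x in distr lborel borel (\<lambda>x. a - x). P x" by (subst eq) (rule assms)
  then show ?thesis by (rule AE_distrD[rotated]) measurable
qed

lemma nn_integral_lborel_reflect:
  fixes a :: "'a::euclidean_space"
  assumes "f \<in> borel_measurable borel" shows "(\<integral>\<^sup>+x. f (a - x) \<partial>lborel) = (\<integral>\<^sup>+x. f x \<partial>lborel)"
  using lborel_nn_integral_affine[OF assms, of "-1" a] by simp

section \<open>Heat kernel estimates in frequency\<close>

text \<open>The multiplier \<open>e\<^sup>-\<^sup>\<mu>\<^sup>(\<^sup>t\<^sup>-\<^sup>\<tau>\<^sup>)\<^sup>r\<^sup>2\<close> together with the causality condition \<open>\<tau> < t\<close>, so that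
  Duhamel integrals may run over the whole time axis and Tonelli applies to them directly.\<close>

definition heat_factor :: "real \<Rightarrow> real \<Rightarrow> real \<Rightarrow> real \<Rightarrow> ennreal" where
  "heat_factor \<mu> t \<tau> r = (if \<tau> < t then ennreal (exp (- (\<mu> * (t - \<tau>) * r\<^sup>2))) else 0)"

lemma heat_factor_measurable [measurable (raw)]:
  assumes [measurable]: "f \<in> borel_measurable M" "g \<in> borel_measurable M" "h \<in> borel_measurable M"
  shows "(\<lambda>x. heat_factor \<mu> (f x) (g x) (h x)) \<in> borel_measurable M"
  unfolding heat_factor_def by measurable

text \<open>Uniformly in the frequency \<open>r\<close>, one derivative of the heat flow is square integrable in time.
  By Cauchy--Schwarz in time it can be paired with the square integrable \<open>N\<close>.\<close>

lemma nn_integral_exp_L2: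
  assumes "\<nu> > 0"
  shows "(\<integral>\<^sup>+s. (ennreal \<bar>r\<bar> * (if 0 < s then ennreal (exp (- (\<nu> * s * r\<^sup>2))) else 0))\<^sup>2 \<partial>lborel) \<le> ennreal (1 / (2 * \<nu>))"
proof (cases "r = 0")
  case False
  have "(\<integral>\<^sup>+s. (ennreal \<bar>r\<bar> * (if 0 < s then ennreal (exp (- (\<nu> * s * r\<^sup>2))) else 0))\<^sup>2 \<partial>lborel)
      \<le> (\<integral>\<^sup>+s. ennreal (r\<^sup>2 * exp (- (2 * \<nu> * r\<^sup>2) * s)) * indicator {0..} s \<partial>lborel)"
  proof (rule nn_integral_mono)
    fix s :: real
    have "(exp (- (\<nu> * s * r\<^sup>2)))\<^sup>2 = exp (- (2 * \<nu> * r\<^sup>2) * s)"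
      by (simp add: exp_double[symmetric] mult_ac)
    then show "(ennreal \<bar>r\<bar> * (if 0 < s then ennreal (exp (- (\<nu> * s * r\<^sup>2))) else 0))\<^sup>2 \<le> ennreal (r\<^sup>2 * exp (- (2 * \<nu> * r\<^sup>2) * s)) * indicator {0..} s"
      by (simp add: power_mult_distrib ennreal_power ennreal_mult[symmetric])
  qed
  also have "\<dots> = ennreal (0 - (- exp (- (2 * \<nu> * r\<^sup>2) * 0) / (2 * \<nu>)))"
  proof (rule nn_integral_FTC_atLeast)
    show "((\<lambda>s. - exp (- (2 * \<nu> * r\<^sup>2) * s) / (2 * \<nu>)) has_real_derivative r\<^sup>2 * exp (- (2 * \<nu> * r\<^sup>2) * x)) (at x)" for x
      using assms by (auto intro!: derivative_eq_intros)
    have "filterlim (\<lambda>s. (- (2 * \<nu> * r\<^sup>2)) * s) at_bot at_top"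
      using assms False by (intro filterlim_tendsto_neg_mult_at_bot[OF tendsto_const]) (auto intro: filterlim_ident)
    then have "((\<lambda>s. exp ((- (2 * \<nu> * r\<^sup>2)) * s)) \<longlongrightarrow> 0) at_top"
      by (rule filterlim_compose[OF exp_at_bot])
    then have "((\<lambda>s. - exp (- (2 * \<nu> * r\<^sup>2) * s) / (2 * \<nu>)) \<longlongrightarrow> - 0 / (2 * \<nu>)) at_top"
      using assms by (intro tendsto_intros) auto
    then show "((\<lambda>s. - exp (- (2 * \<nu> * r\<^sup>2) * s) / (2 * \<nu>)) \<longlongrightarrow> 0) at_top" by simp
  qed auto
  finally show ?thesis by simp
qed simp

lemma heat_factor_L2_source:
  assumes "\<nu> > 0"
  shows "(\<integral>\<^sup>+\<tau>. (ennreal \<bar>r\<bar> * heat_factor \<nu> t \<tau> r)\<^sup>2 \<partial>lborel) \<le> ennreal (1 / (2 * \<nu>))"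
proof -
  have "(\<integral>\<^sup>+\<tau>. (ennreal \<bar>r\<bar> * heat_factor \<nu> t \<tau> r)\<^sup>2 \<partial>lborel) = (\<integral>\<^sup>+s. (ennreal \<bar>r\<bar> * heat_factor \<nu> t (t - s) r)\<^sup>2 \<partial>lborel)"
    by (subst nn_integral_lborel_reflect[symmetric, of _ t]) auto
  also have "\<dots> = (\<integral>\<^sup>+s. (ennreal \<bar>r\<bar> * (if 0 < s then ennreal (exp (- (\<nu> * s * r\<^sup>2))) else 0))\<^sup>2 \<partial>lborel)"
    by (intro nn_integral_cong) (simp add: heat_factor_def)
  finally show ?thesis using nn_integral_exp_L2[OF assms, of r] by simp
qed

lemma heat_factor_L2_target:
  assumes "\<nu> > 0"
  shows "(\<integral>\<^sup>+t. (ennreal \<bar>r\<bar> * heat_factor \<nu> t \<tau> r)\<^sup>2 \<partial>lborel) \<le> ennreal (1 / (2 * \<nu>))"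
proof -
  have "(\<integral>\<^sup>+t. (ennreal \<bar>r\<bar> * heat_factor \<nu> t \<tau> r)\<^sup>2 \<partial>lborel) = (\<integral>\<^sup>+s. (ennreal \<bar>r\<bar> * heat_factor \<nu> (\<tau> + s) \<tau> r)\<^sup>2 \<partial>lborel)"
    by (subst lborel_nn_integral_affine[of _ 1 \<tau>]) auto
  also have "\<dots> = (\<integral>\<^sup>+s. (ennreal \<bar>r\<bar> * (if 0 < s then ennreal (exp (- (\<nu> * s * r\<^sup>2))) else 0))\<^sup>2 \<partial>lborel)"
    by (intro nn_integral_cong) (simp add: heat_factor_def)
  finally show ?thesis using nn_integral_exp_L2[OF assms, of r] by simp
qed

text \<open>The profile that is compared with the solution: algebraic of arbitrary order \<open>k\<close> in the parabolic
  variable \<open>\<surd>t r\<close>. Unlike a Gaussian it changes by a constant factor only when \<open>r\<close> is halved, as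
  happens to one of the two frequencies in a convolution.\<close>

definition decay :: "nat \<Rightarrow> real \<Rightarrow> real \<Rightarrow> real" where
  "decay k t r = 1 / (1 + t * r\<^sup>2) ^ k"

lemma decay_nonneg: "0 \<le> t \<Longrightarrow> 0 \<le> decay k t r"
  by (simp add: decay_def)

lemma decay_pos: "0 \<le> t \<Longrightarrow> 0 < decay k t r"
  by (simp add: decay_def add_pos_nonneg)

lemma decay_le_1: "0 \<le> t \<Longrightarrow> decay k t r \<le> 1"
  by (simp add: decay_def add_pos_nonneg divide_le_eq)

lemma decay_half:
  assumes "0 \<le> t" "\<bar>r\<bar> \<le> 2 * \<bar>r'\<bar>" shows "decay k t r' \<le> 4 ^ k * decay k t r"
proof -
  have "r\<^sup>2 \<le> (2 * \<bar>r'\<bar>)\<^sup>2" using power_mono[OF assms(2), of 2] by simp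
  then have "t * r\<^sup>2 \<le> t * (4 * r'\<^sup>2)" using assms(1) by (intro mult_left_mono) (auto simp: power_mult_distrib)
  then have "1 + t * r\<^sup>2 \<le> 4 * (1 + t * r'\<^sup>2)" by simp
  moreover have p: "0 < 1 + t * r\<^sup>2" "0 < 1 + t * r'\<^sup>2" using assms(1) by (auto simp: add_pos_nonneg)
  ultimately have "(1 + t * r\<^sup>2) ^ k \<le> (4 * (1 + t * r'\<^sup>2)) ^ k" by (intro power_mono) auto
  then have "(1 + t * r\<^sup>2) ^ k \<le> 4 ^ k * (1 + t * r'\<^sup>2) ^ k" by (simp only: power_mult_distrib)
  then show ?thesis using p by (simp add: decay_def field_simps)
qed

text \<open>With \<open>m = k + 1\<close> one has \<open>1 + y \<le> C (1 + \<nu> y / m) \<le> C e\<^sup>\<nu>\<^sup>y\<^sup>/\<^sup>m\<close>; take \<open>k\<close>-th powers.\<close>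

lemma poly_exp_bound:
  fixes \<nu> :: real
  assumes "\<nu> > 0" shows "\<exists>C\<ge>1. \<forall>y\<ge>0. (1 + y) ^ k * exp (- (\<nu> * y)) \<le> C"
proof (intro exI conjI allI impI)
  define m where "m = real (Suc k)"
  define C where "C = max 1 (m / \<nu>)"
  have m: "m \<ge> 1" "m > 0" by (auto simp: m_def)
  show "1 \<le> C ^ k" by (simp add: C_def)
  fix y :: real assume y: "y \<ge> 0"
  have "1 + y \<le> C * (1 + \<nu> / m * y)"
  proof -
    have "C * (\<nu> / m) \<ge> m / \<nu> * (\<nu> / m)" unfolding C_def using assms m by (intro mult_right_mono) auto
    then have "C * (\<nu> / m) \<ge> 1" using assms m by simp
    then have "C * (\<nu> / m) * y \<ge> 1 * y" using y by (rule mult_right_mono)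
    moreover have "C \<ge> 1" by (simp add: C_def)
    ultimately show ?thesis by (simp add: distrib_left mult.assoc)
  qed
  also have "\<dots> \<le> C * exp (\<nu> / m * y)"
    by (intro mult_left_mono exp_ge_add_one_self) (simp add: C_def)
  finally have "(1 + y) ^ k \<le> (C * exp (\<nu> / m * y)) ^ k" using y by (intro power_mono) auto
  also have "\<dots> = C ^ k * exp (real k * (\<nu> / m * y))" by (simp only: power_mult_distrib exp_of_nat_mult[symmetric])
  also have "\<dots> \<le> C ^ k * exp (\<nu> * y)"
  proof -
    have "real k * (\<nu> / m * y) = (real k / m) * (\<nu> * y)" by simp
    also have "\<dots> \<le> 1 * (\<nu> * y)" using y assms by (intro mult_right_mono) (auto simp: m_def)
    finally show ?thesis by (auto intro!: mult_left_mono simp: C_def)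
  qed
  finally show "(1 + y) ^ k * exp (- (\<nu> * y)) \<le> C ^ k"
    by (simp add: exp_minus field_simps)
qed

text \<open>Half of the heat factor pays for moving the decay rate from time \<open>\<tau>\<close> to time \<open>t\<close>, since
  \<open>1 + t r\<^sup>2 \<le> (1 + \<tau> r\<^sup>2) (1 + (t - \<tau>) r\<^sup>2)\<close>.\<close>

lemma decay_transport:
  assumes "\<mu> > 0"
  obtains C where "C \<ge> 1" "\<And>t \<tau> r. 0 \<le> \<tau> \<Longrightarrow> \<tau> \<le> t \<Longrightarrow>
      exp (- (\<mu> * (t - \<tau>) * r\<^sup>2)) * decay k \<tau> r \<le> C * (exp (- (\<mu> / 2 * (t - \<tau>) * r\<^sup>2)) * decay k t r)"
proof -
  obtain C where C: "C \<ge> 1" "\<And>y. y \<ge> 0 \<Longrightarrow> (1 + y) ^ k * exp (- (\<mu> / 2 * y)) \<le> C"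
    using poly_exp_bound[of "\<mu> / 2" k] assms by auto
  show thesis
  proof (rule that[OF C(1)])
    fix t \<tau> r :: real assume t: "0 \<le> \<tau>" "\<tau> \<le> t"
    let ?y = "(t - \<tau>) * r\<^sup>2"
    have y: "?y \<ge> 0" using t by simp
    have "1 + t * r\<^sup>2 \<le> (1 + \<tau> * r\<^sup>2) * (1 + ?y)"
    proof -
      have "(1 + \<tau> * r\<^sup>2) * (1 + ?y) = 1 + t * r\<^sup>2 + (\<tau> * r\<^sup>2) * ?y" by (simp add: algebra_simps)
      moreover have "(\<tau> * r\<^sup>2) * ?y \<ge> 0" using t by simp
      ultimately show ?thesis by linarith
    qed
    then have "(1 + t * r\<^sup>2) ^ k \<le> ((1 + \<tau> * r\<^sup>2) * (1 + ?y)) ^ k" using t by (intro power_mono) auto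
    then have "(1 + t * r\<^sup>2) ^ k \<le> (1 + \<tau> * r\<^sup>2) ^ k * (1 + ?y) ^ k" by (simp add: power_mult_distrib)
    moreover have "(1 + t * r\<^sup>2) ^ k > 0" "(1 + \<tau> * r\<^sup>2) ^ k > 0" using t by (auto simp: add_pos_nonneg)
    ultimately have d: "decay k \<tau> r \<le> (1 + ?y) ^ k * decay k t r"
      by (simp add: decay_def field_simps)
    have "exp (- (\<mu> * (t - \<tau>) * r\<^sup>2)) = exp (- (\<mu> / 2 * ?y)) * exp (- (\<mu> / 2 * (t - \<tau>) * r\<^sup>2))"
      by (simp add: exp_add[symmetric] field_simps)
    then have "exp (- (\<mu> * (t - \<tau>) * r\<^sup>2)) * decay k \<tau> r 
        \<le> exp (- (\<mu> / 2 * ?y)) * exp (- (\<mu> / 2 * (t - \<tau>) * r\<^sup>2)) * ((1 + ?y) ^ k * decay k t r)"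
      using d by (simp add: mult_left_mono)
    also have "\<dots> = ((1 + ?y) ^ k * exp (- (\<mu> / 2 * ?y))) * (exp (- (\<mu> / 2 * (t - \<tau>) * r\<^sup>2)) * decay k t r)"
      by (simp only: mult_ac)
    also have "\<dots> \<le> C * (exp (- (\<mu> / 2 * (t - \<tau>) * r\<^sup>2)) * decay k t r)"
      using C(2)[OF y] t by (intro mult_right_mono) (auto simp: decay_nonneg)
    finally show "exp (- (\<mu> * (t - \<tau>) * r\<^sup>2)) * decay k \<tau> r \<le> C * (exp (- (\<mu> / 2 * (t - \<tau>) * r\<^sup>2)) * decay k t r)" .
  qed
qed

section \<open>The barrier argument\<close>

lemma decay_measurable [measurable (raw)]:
  assumes [measurable]: "f \<in> borel_measurable M" "g \<in> borel_measurable M"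
  shows "(\<lambda>x. decay k (f x) (g x)) \<in> borel_measurable M"
  unfolding decay_def by measurable

text \<open>In \<open>v(\<eta>) v(\<xi> - \<eta>)\<close> one of the two frequencies has modulus at least \<open>\<bar>\<xi>\<bar>/2\<close>, and the decay
  bound is applied to that factor only. The other factor is integrated. The function \<open>w\<close> is the
  part of \<open>v\<close> that may exceed the bound, and it enters linearly.\<close>

lemma self_convolution_decay:
  fixes v w :: "'a::euclidean_space \<Rightarrow> ennreal"
  assumes [measurable]: "v \<in> borel_measurable borel" "w \<in> borel_measurable borel"
    and \<tau>: "0 \<le> \<tau>" and D: "0 \<le> D"
    and bound: "AE \<eta> in lborel. v \<eta> \<le> ennreal (D * decay k \<tau> (norm \<eta>)) + w \<eta>"
  shows "(\<integral>\<^sup>+\<eta>. v \<eta> * v (\<xi> - \<eta>) \<partial>lborel)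
    \<le> ennreal (2 * 4 ^ k * D * decay k \<tau> (norm \<xi>)) * (\<integral>\<^sup>+\<eta>. v \<eta> \<partial>lborel) + 2 * (\<integral>\<^sup>+\<eta>. w \<eta> * v (\<xi> - \<eta>) \<partial>lborel)"
proof -
  define X where "X = ennreal (4 ^ k * D * decay k \<tau> (norm \<xi>))"
  have X2: "ennreal (2 * 4 ^ k * D * decay k \<tau> (norm \<xi>)) = X + X"
    unfolding X_def using \<tau> D by (simp add: ennreal_plus[symmetric] decay_nonneg del: ennreal_plus)
  have far: "ennreal (D * decay k \<tau> (norm \<eta>)) \<le> X" if "norm \<xi> \<le> 2 * norm \<eta>" for \<eta> :: 'a
    unfolding X_def
  proof (rule ennreal_leI)
    have "D * decay k \<tau> (norm \<eta>) \<le> D * (4 ^ k * decay k \<tau> (norm \<xi>))"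
      using that \<tau> D by (intro mult_left_mono decay_half) auto
    then show "D * decay k \<tau> (norm \<eta>) \<le> 4 ^ k * D * decay k \<tau> (norm \<xi>)" by (simp only: mult_ac)
  qed
  have pw: "AE \<eta> in lborel. v \<eta> * v (\<xi> - \<eta>) \<le> (X * v \<eta> + X * v (\<xi> - \<eta>)) + (w \<eta> * v (\<xi> - \<eta>) + v \<eta> * w (\<xi> - \<eta>))"
    using bound AE_lborel_reflect[OF bound, of \<xi>]
  proof eventually_elim
    case (elim \<eta>)
    have "norm \<xi> \<le> norm \<eta> + norm (\<xi> - \<eta>)" using norm_triangle_ineq[of \<eta> "\<xi> - \<eta>"] by simp
    then consider "norm \<xi> \<le> 2 * norm \<eta>" | "norm \<xi> \<le> 2 * norm (\<xi> - \<eta>)" by linarith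
    then show ?case
    proof cases
      case 1
      have "v \<eta> \<le> X + w \<eta>" using elim(1) far[OF 1] by (meson add_right_mono order_trans)
      then have "v \<eta> * v (\<xi> - \<eta>) \<le> (X + w \<eta>) * v (\<xi> - \<eta>)" by (rule mult_right_mono) simp
      also have "\<dots> = X * v (\<xi> - \<eta>) + w \<eta> * v (\<xi> - \<eta>)" by (simp add: distrib_right)
      also have "\<dots> \<le> (X * v \<eta> + X * v (\<xi> - \<eta>)) + (w \<eta> * v (\<xi> - \<eta>) + v \<eta> * w (\<xi> - \<eta>))"
        by (intro add_mono) (auto intro: add_increasing add_increasing2)
      finally show ?thesis .
    next
      case 2
      have "v (\<xi> - \<eta>) \<le> X + w (\<xi> - \<eta>)" using elim(2) far[OF 2] by (meson add_right_mono order_trans)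
      then have "v \<eta> * v (\<xi> - \<eta>) \<le> v \<eta> * (X + w (\<xi> - \<eta>))" by (rule mult_left_mono) simp
      also have "\<dots> = X * v \<eta> + v \<eta> * w (\<xi> - \<eta>)" by (simp add: distrib_left mult.commute)
      also have "\<dots> \<le> (X * v \<eta> + X * v (\<xi> - \<eta>)) + (w \<eta> * v (\<xi> - \<eta>) + v \<eta> * w (\<xi> - \<eta>))"
        by (intro add_mono) (auto intro: add_increasing add_increasing2)
      finally show ?thesis .
    qed
  qed
  have r1: "(\<integral>\<^sup>+\<eta>. v (\<xi> - \<eta>) \<partial>lborel) = (\<integral>\<^sup>+\<eta>. v \<eta> \<partial>lborel)"
    by (rule nn_integral_lborel_reflect) simp
  have r2: "(\<integral>\<^sup>+\<eta>. v \<eta> * w (\<xi> - \<eta>) \<partial>lborel) = (\<integral>\<^sup>+\<eta>. w \<eta> * v (\<xi> - \<eta>) \<partial>lborel)"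
    by (subst nn_integral_lborel_reflect[symmetric, of _ \<xi>]) (auto simp: mult.commute)
  have "(\<integral>\<^sup>+\<eta>. v \<eta> * v (\<xi> - \<eta>) \<partial>lborel) \<le> (\<integral>\<^sup>+\<eta>. (X * v \<eta> + X * v (\<xi> - \<eta>)) + (w \<eta> * v (\<xi> - \<eta>) + v \<eta> * w (\<xi> - \<eta>)) \<partial>lborel)"
    by (rule nn_integral_mono_AE[OF pw])
  also have "\<dots> = (X * (\<integral>\<^sup>+\<eta>. v \<eta> \<partial>lborel) + X * (\<integral>\<^sup>+\<eta>. v (\<xi> - \<eta>) \<partial>lborel)) + ((\<integral>\<^sup>+\<eta>. w \<eta> * v (\<xi> - \<eta>) \<partial>lborel) + (\<integral>\<^sup>+\<eta>. v \<eta> * w (\<xi> - \<eta>) \<partial>lborel))"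
    by (simp add: nn_integral_add nn_integral_cmult)
  finally show ?thesis unfolding r1 r2 X2 by (simp add: distrib_right mult_2)
qed

lemma ennreal_zero_of_half:
  assumes "y \<le> ennreal a * y" "a \<le> 1 / 2" "y < \<infinity>" shows "y = (0::ennreal)"
proof (cases y)
  case (real r)
  show ?thesis
  proof (cases "a \<ge> 0")
    case True
    then have "r \<le> a * r" using assms(1) real by (simp add: ennreal_mult[symmetric])
    also have "\<dots> \<le> 1 / 2 * r" using assms(2) real by (intro mult_right_mono) auto
    finally show ?thesis using real by simp
  next
    case False
    then show ?thesis using assms(1) by (simp add: ennreal_neg)
  qed
qed (use assms in simp)

definition self_conv :: "(real \<times> 'a::euclidean_space \<Rightarrow> ennreal) \<Rightarrow> real \<Rightarrow> 'a \<Rightarrow> ennreal" where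
  "self_conv V \<tau> \<xi> = (\<integral>\<^sup>+\<eta>. V (\<tau>, \<eta>) * V (\<tau>, \<xi> - \<eta>) \<partial>lborel)"

lemma self_conv_measurable [measurable (raw)]:
  fixes f :: "'m \<Rightarrow> real" and g :: "'m \<Rightarrow> 'a::euclidean_space"
  assumes [measurable]: "V \<in> borel_measurable borel" "f \<in> borel_measurable M" "g \<in> borel_measurable M"
  shows "(\<lambda>x. self_conv V (f x) (g x)) \<in> borel_measurable M"
  unfolding self_conv_def by measurable

text \<open>A nonnegative field dominated by a heat flow with bounded data plus \<open>c \<bar>\<xi>\<bar>\<close> times the Duhamel
  integral of its own convolution square, as the modulus of the Fourier transform of a mild
  solution is. By \<open>energy\<close> it lies in \<open>L\<^sup>2\<close> in time with values in \<open>L\<^sup>1\<close> in frequency. Setting the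
  field to \<open>0\<close> at nonpositive times frees all time integrals of a lower limit.\<close>

locale convolution_duhamel =
  fixes V :: "real \<times> 'a::euclidean_space \<Rightarrow> ennreal" and \<mu> c K0 E :: real
  assumes V_meas [measurable]: "V \<in> borel_measurable borel"
    and pos: "0 < \<mu>" "0 \<le> c" "0 \<le> K0" "0 \<le> E"
    and V_past: "\<And>t \<xi>. t \<le> 0 \<Longrightarrow> V (t, \<xi>) = 0"
    and energy: "(\<integral>\<^sup>+\<tau>. (\<integral>\<^sup>+\<eta>. V (\<tau>, \<eta>) \<partial>lborel)\<^sup>2 \<partial>lborel) \<le> ennreal (E\<^sup>2)"
    and duhamel: "AE t in lborel. 0 < t \<longrightarrow> (AE \<xi> in lborel.
       V (t, \<xi>) \<le> ennreal (K0 * exp (- (\<mu> * t * (norm \<xi>)\<^sup>2))) + ennreal (c * norm \<xi>) *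
         (\<integral>\<^sup>+\<tau>. heat_factor \<mu> t \<tau> (norm \<xi>) * self_conv V \<tau> \<xi> \<partial>lborel))"
begin

definition N :: "real \<Rightarrow> ennreal" where "N \<tau> = (\<integral>\<^sup>+\<eta>. V (\<tau>, \<eta>) \<partial>lborel)"

lemma N_measurable [measurable]: "N \<in> borel_measurable borel"
  unfolding N_def[abs_def] by measurable

lemma N_past: "\<tau> \<le> 0 \<Longrightarrow> N \<tau> = 0"
  by (simp add: N_def V_past)

text \<open>Cauchy--Schwarz in time against \<open>heat_factor_L2_source\<close>. The diffusivity is halved because
  \<open>decay_transport\<close> has used the other half.\<close>

lemma source_bound:
  assumes [measurable]: "S \<in> sets borel" and d: "(\<integral>\<^sup>+\<tau>. indicator S \<tau> * (N \<tau>)\<^sup>2 \<partial>lborel) \<le> ennreal (d\<^sup>2)" "0 \<le> d" and r: "0 \<le> r"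
  shows "ennreal r * (\<integral>\<^sup>+\<tau>. heat_factor (\<mu> / 2) t \<tau> r * (indicator S \<tau> * N \<tau>) \<partial>lborel) \<le> ennreal (d / sqrt \<mu>)"
proof -
  have "ennreal r * (\<integral>\<^sup>+\<tau>. heat_factor (\<mu> / 2) t \<tau> r * (indicator S \<tau> * N \<tau>) \<partial>lborel)
    = (\<integral>\<^sup>+\<tau>. (ennreal \<bar>r\<bar> * heat_factor (\<mu> / 2) t \<tau> r) * (indicator S \<tau> * N \<tau>) \<partial>lborel)"
    using r by (simp add: nn_integral_cmult[symmetric] mult.assoc)
  moreover have "(\<integral>\<^sup>+\<tau>. (ennreal \<bar>r\<bar> * heat_factor (\<mu> / 2) t \<tau> r) * (indicator S \<tau> * N \<tau>) \<partial>lborel)\<^sup>2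
    \<le> (\<integral>\<^sup>+\<tau>. (ennreal \<bar>r\<bar> * heat_factor (\<mu> / 2) t \<tau> r)\<^sup>2 \<partial>lborel) * (\<integral>\<^sup>+\<tau>. (indicator S \<tau> * N \<tau>)\<^sup>2 \<partial>lborel)"
    by (rule Cauchy_Schwarz_nn_integral) measurable
  moreover have "\<dots> \<le> ennreal ((1 / sqrt \<mu>)\<^sup>2) * ennreal (d\<^sup>2)"
  proof (rule mult_mono)
    show "(\<integral>\<^sup>+\<tau>. (ennreal \<bar>r\<bar> * heat_factor (\<mu> / 2) t \<tau> r)\<^sup>2 \<partial>lborel) \<le> ennreal ((1 / sqrt \<mu>)\<^sup>2)"
      using heat_factor_L2_source[of "\<mu> / 2" r t] pos by (simp add: power_divide)
    have "(\<integral>\<^sup>+\<tau>. (indicator S \<tau> * N \<tau>)\<^sup>2 \<partial>lborel) = (\<integral>\<^sup>+\<tau>. indicator S \<tau> * (N \<tau>)\<^sup>2 \<partial>lborel)"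
      by (intro nn_integral_cong) (simp add: indicator_def)
    then show "(\<integral>\<^sup>+\<tau>. (indicator S \<tau> * N \<tau>)\<^sup>2 \<partial>lborel) \<le> ennreal (d\<^sup>2)" using d by simp
  qed auto
  ultimately have "ennreal r * (\<integral>\<^sup>+\<tau>. heat_factor (\<mu> / 2) t \<tau> r * (indicator S \<tau> * N \<tau>) \<partial>lborel) \<le> ennreal (1 / sqrt \<mu> * d)"
    using d pos by (intro ennreal_le_of_square_le) auto
  then show ?thesis by simp
qed

text \<open>The part \<open>W\<close> of \<open>V\<close> above the barrier \<open>C1\<close> times the decay rate satisfies a linear inequality: \<open>W\<close>
  is at most \<open>2c\<bar>\<xi>\<bar>\<close> times the Duhamel integral of \<open>W * V\<close>. Its right side is a strict contraction
  of \<open>L\<^sup>2\<close> in time with values in \<open>L\<^sup>1\<close> in frequency on a time interval that carries little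
  energy, so \<open>W\<close> vanishes there. The first smallness condition makes the barrier reproduce
  itself, the second one makes the map contract; \<open>CT\<close> accounts for the past up to time \<open>T\<close>.\<close>

lemma barrier_step:
  fixes C1 CT ck T T' d :: real
  assumes ck: "1 \<le> ck" "\<And>t \<tau> r. 0 \<le> \<tau> \<Longrightarrow> \<tau> \<le> t \<Longrightarrow>
      exp (- (\<mu> * (t - \<tau>) * r\<^sup>2)) * decay k \<tau> r \<le> ck * (exp (- (\<mu> / 2 * (t - \<tau>) * r\<^sup>2)) * decay k t r)"
    and T: "0 \<le> T" and CT: "0 \<le> CT"
    and before: "AE t in lborel. 0 < t \<and> t \<le> T \<longrightarrow> (AE \<xi> in lborel. V (t, \<xi>) \<le> ennreal (CT * decay k t (norm \<xi>)))"
    and d: "0 \<le> d" "(\<integral>\<^sup>+\<tau>. indicator {T<..T'} \<tau> * (N \<tau>)\<^sup>2 \<partial>lborel) \<le> ennreal (d\<^sup>2)"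
    and small: "4 * 4 ^ k * ck * c * (d / sqrt \<mu>) \<le> 1" "4 * c\<^sup>2 * d\<^sup>2 / \<mu> \<le> 1"
  defines "C1 \<equiv> 2 * (K0 * ck + 2 * 4 ^ k * ck * c * CT * (E / sqrt \<mu>))"
  shows "AE t in lborel. T < t \<and> t \<le> T' \<longrightarrow> (AE \<xi> in lborel. V (t, \<xi>) \<le> ennreal (C1 * decay k t (norm \<xi>)))"
proof -
  define S where "S = {T<..T'}"
  \<comment> \<open>The excess over the barrier; extended subtraction truncates at \<open>0\<close>.\<close>
  define W where "W = (\<lambda>(t, \<xi>). indicator S t * (V (t, \<xi>) - ennreal (C1 * decay k t (norm \<xi>))))"
  define R where "R \<tau> \<xi> = (\<integral>\<^sup>+\<eta>. W (\<tau>, \<eta>) * V (\<tau>, \<xi> - \<eta>) \<partial>lborel)" for \<tau> \<xi>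
  define w where "w t = (\<integral>\<^sup>+\<xi>. W (t, \<xi>) \<partial>lborel)" for t
  have [measurable]: "S \<in> sets borel" by (simp add: S_def)
  have W_meas [measurable]: "W \<in> borel_measurable borel"
  proof -
    have "W \<in> borel_measurable (borel \<Otimes>\<^sub>M borel)" unfolding W_def by measurable
    then show ?thesis by (simp add: borel_prod)
  qed
  have R_meas [measurable]: "(\<lambda>(\<xi>, \<tau>). R \<tau> \<xi>) \<in> borel_measurable (lborel \<Otimes>\<^sub>M lborel)"
    unfolding R_def by measurable
  have R_meas': "(\<lambda>\<tau>. R \<tau> \<xi>) \<in> borel_measurable borel" for \<xi>
    unfolding R_def by measurable
  have w_meas [measurable]: "w \<in> borel_measurable borel" unfolding w_def[abs_def] by measurable
  have C1: "0 \<le> C1" using pos ck CT by (simp add: C1_def)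
  have W_le: "W (t, \<xi>) \<le> V (t, \<xi>)" for t \<xi> by (auto simp: W_def indicator_def diff_le_self_ennreal)
  have W_off: "W (t, \<xi>) = 0" if "t \<notin> S" for t \<xi> using that by (simp add: W_def)
  have V_le: "V (t, \<xi>) \<le> ennreal (C1 * decay k t (norm \<xi>)) + W (t, \<xi>)" if "t \<in> S" for t \<xi>
    using that by (auto simp: W_def add_diff_self_ennreal not_le less_imp_le)
  define D where "D \<tau> = (if \<tau> \<le> T then CT else C1)" for \<tau>
  have Q: "AE \<tau> in lborel. \<tau> \<le> T' \<longrightarrow> (\<forall>\<xi>. self_conv V \<tau> \<xi>
      \<le> ennreal (2 * 4 ^ k * D \<tau> * decay k \<tau> (norm \<xi>)) * N \<tau> + 2 * R \<tau> \<xi>)"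
    using before
  proof eventually_elim
    case (elim \<tau>)
    show ?case
    proof (intro impI allI)
      fix \<xi> assume \<tau>: "\<tau> \<le> T'"
      show "self_conv V \<tau> \<xi> \<le> ennreal (2 * 4 ^ k * D \<tau> * decay k \<tau> (norm \<xi>)) * N \<tau> + 2 * R \<tau> \<xi>"
      proof (cases "0 < \<tau>")
        case True
        have "AE \<eta> in lborel. V (\<tau>, \<eta>) \<le> ennreal (D \<tau> * decay k \<tau> (norm \<eta>)) + W (\<tau>, \<eta>)"
        proof (cases "\<tau> \<le> T")
          case True
          with elim \<open>0 < \<tau>\<close> have "AE \<eta> in lborel. V (\<tau>, \<eta>) \<le> ennreal (CT * decay k \<tau> (norm \<eta>))" by blast
          then show ?thesis by eventually_elim (use True in \<open>auto simp: D_def intro: add_increasing2\<close>)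
        next
          case False
          then show ?thesis using V_le[of \<tau>] \<tau> by (simp add: D_def S_def)
        qed
        then show ?thesis unfolding R_def N_def self_conv_def using True C1 CT
          by (intro self_convolution_decay) (auto simp: D_def)
      qed (simp add: V_past self_conv_def)
    qed
  qed
  \<comment> \<open>The barrier absorbs the datum, the past and its own feedback; only the excess is left.\<close>
  have V_Z: "AE t in lborel. t \<in> S \<longrightarrow> (AE \<xi> in lborel. V (t, \<xi>) \<le> ennreal (C1 * decay k t (norm \<xi>)) +
      ennreal (2 * c * norm \<xi>) * (\<integral>\<^sup>+\<tau>. heat_factor \<mu> t \<tau> (norm \<xi>) * R \<tau> \<xi> \<partial>lborel))"
    using duhamel
  proof eventually_elim
    case (elim t)
    show ?case
    proof
      assume t: "t \<in> S"
      then have t': "0 < t" "T < t" "t \<le> T'" using T by (auto simp: S_def)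
      with elim have "AE \<xi> in lborel. V (t, \<xi>) \<le> ennreal (K0 * exp (- (\<mu> * t * (norm \<xi>)\<^sup>2))) + ennreal (c * norm \<xi>) *
         (\<integral>\<^sup>+\<tau>. heat_factor \<mu> t \<tau> (norm \<xi>) * self_conv V \<tau> \<xi> \<partial>lborel)" by blast
      then show "AE \<xi> in lborel. V (t, \<xi>) \<le> ennreal (C1 * decay k t (norm \<xi>)) +
         ennreal (2 * c * norm \<xi>) * (\<integral>\<^sup>+\<tau>. heat_factor \<mu> t \<tau> (norm \<xi>) * R \<tau> \<xi> \<partial>lborel)"
      proof eventually_elim
        case (elim \<xi>)
        define r where "r = norm \<xi>"
        define a where "a = decay k t r"
        have r: "0 \<le> r" by (simp add: r_def)
        have a: "0 \<le> a" using t' by (simp add: a_def decay_nonneg)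
        define h where "h \<tau> = heat_factor \<mu> t \<tau> r" for \<tau>
        define h2 where "h2 \<tau> = heat_factor (\<mu> / 2) t \<tau> r" for \<tau>
        have [measurable]: "h \<in> borel_measurable borel" "h2 \<in> borel_measurable borel"
          unfolding h_def[abs_def] h2_def[abs_def] by measurable
        have [measurable]: "(\<lambda>\<tau>. R \<tau> \<xi>) \<in> borel_measurable borel" by (rule R_meas')
        let ?e = "2 * 4 ^ k * ck * a"
        have e: "0 \<le> ?e" using ck a by simp
        \<comment> \<open>transport the decay rate from \<open>\<tau>\<close> to \<open>t\<close> at the price of half the heat factor\<close>
        have pt: "h \<tau> * (ennreal (2 * 4 ^ k * D \<tau> * decay k \<tau> r) * N \<tau>)
            \<le> ennreal ?e * (ennreal CT * (h2 \<tau> * (indicator UNIV \<tau> * N \<tau>)) + ennreal C1 * (h2 \<tau> * (indicator S \<tau> * N \<tau>)))" for \<tau>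
        proof (cases "0 < \<tau> \<and> \<tau> < t")
          case True
          have D: "0 \<le> D \<tau>" using CT C1 by (simp add: D_def)
          have "exp (- (\<mu> * (t - \<tau>) * r\<^sup>2)) * (2 * 4 ^ k * D \<tau> * decay k \<tau> r) = (2 * 4 ^ k * D \<tau>) * (exp (- (\<mu> * (t - \<tau>) * r\<^sup>2)) * decay k \<tau> r)"
            by (simp only: mult_ac)
          also have "\<dots> \<le> (2 * 4 ^ k * D \<tau>) * (ck * (exp (- (\<mu> / 2 * (t - \<tau>) * r\<^sup>2)) * a))"
            unfolding a_def using True D by (intro mult_left_mono ck) auto
          also have "\<dots> = ?e * (D \<tau> * exp (- (\<mu> / 2 * (t - \<tau>) * r\<^sup>2)))" by (simp only: mult_ac)
          finally have "h \<tau> * ennreal (2 * 4 ^ k * D \<tau> * decay k \<tau> r) \<le> ennreal ?e * (ennreal (D \<tau>) * h2 \<tau>)"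
            unfolding h_def h2_def heat_factor_def using True e D
            by (simp add: ennreal_mult[symmetric] decay_nonneg ennreal_leI)
          then have "h \<tau> * ennreal (2 * 4 ^ k * D \<tau> * decay k \<tau> r) * N \<tau> \<le> ennreal ?e * (ennreal (D \<tau>) * h2 \<tau>) * N \<tau>"
            by (rule mult_right_mono) simp
          also have "\<dots> = ennreal ?e * (ennreal (D \<tau>) * h2 \<tau> * N \<tau>)" by (simp only: mult_ac)
          also have "\<dots> \<le> ennreal ?e * (ennreal CT * (h2 \<tau> * (indicator UNIV \<tau> * N \<tau>)) + ennreal C1 * (h2 \<tau> * (indicator S \<tau> * N \<tau>)))"
          proof (rule mult_left_mono)
            show "ennreal (D \<tau>) * h2 \<tau> * N \<tau> \<le> ennreal CT * (h2 \<tau> * (indicator UNIV \<tau> * N \<tau>)) + ennreal C1 * (h2 \<tau> * (indicator S \<tau> * N \<tau>))"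
              using True t' by (cases "\<tau> \<le> T") (auto simp: D_def S_def mult.assoc intro: add_increasing add_increasing2)
          qed simp
          finally show ?thesis by (simp only: mult.assoc)
        next
          case False
          then have "h \<tau> = 0 \<or> N \<tau> = 0" by (auto simp: h_def heat_factor_def N_past)
          then show ?thesis by auto
        qed
        have "(\<integral>\<^sup>+\<tau>. h \<tau> * self_conv V \<tau> \<xi> \<partial>lborel)
          \<le> (\<integral>\<^sup>+\<tau>. ennreal ?e * (ennreal CT * (h2 \<tau> * (indicator UNIV \<tau> * N \<tau>)) + ennreal C1 * (h2 \<tau> * (indicator S \<tau> * N \<tau>))) + 2 * (h \<tau> * R \<tau> \<xi>) \<partial>lborel)"
        proof (rule nn_integral_mono_AE, use Q in eventually_elim)
          case (elim \<tau>)
          show ?case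
          proof (cases "\<tau> < t")
            case True
            then have "h \<tau> * self_conv V \<tau> \<xi> \<le> h \<tau> * (ennreal (2 * 4 ^ k * D \<tau> * decay k \<tau> r) * N \<tau> + 2 * R \<tau> \<xi>)"
              using elim t' unfolding r_def by (intro mult_left_mono) auto
            also have "\<dots> = h \<tau> * (ennreal (2 * 4 ^ k * D \<tau> * decay k \<tau> r) * N \<tau>) + 2 * (h \<tau> * R \<tau> \<xi>)"
              by (simp add: distrib_left mult.left_commute)
            finally show ?thesis using pt[of \<tau>] by (meson add_right_mono order_trans)
          next
            case False
            then show ?thesis by (simp add: h_def heat_factor_def)
          qed
        qed
        also have "\<dots> = ennreal ?e * (ennreal CT * (\<integral>\<^sup>+\<tau>. h2 \<tau> * (indicator UNIV \<tau> * N \<tau>) \<partial>lborel) + ennreal C1 * (\<integral>\<^sup>+\<tau>. h2 \<tau> * (indicator S \<tau> * N \<tau>) \<partial>lborel))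
            + 2 * (\<integral>\<^sup>+\<tau>. h \<tau> * R \<tau> \<xi> \<partial>lborel)"
          by (simp add: nn_integral_add nn_integral_cmult)
        finally have "ennreal (c * r) * (\<integral>\<^sup>+\<tau>. h \<tau> * self_conv V \<tau> \<xi> \<partial>lborel)
          \<le> ennreal (c * r) * (ennreal ?e * (ennreal CT * (\<integral>\<^sup>+\<tau>. h2 \<tau> * (indicator UNIV \<tau> * N \<tau>) \<partial>lborel) + ennreal C1 * (\<integral>\<^sup>+\<tau>. h2 \<tau> * (indicator S \<tau> * N \<tau>) \<partial>lborel))
            + 2 * (\<integral>\<^sup>+\<tau>. h \<tau> * R \<tau> \<xi> \<partial>lborel))"
          by (rule mult_left_mono) simp
        also have "\<dots> = ennreal (c * ?e) * (ennreal CT * (ennreal r * (\<integral>\<^sup>+\<tau>. h2 \<tau> * (indicator UNIV \<tau> * N \<tau>) \<partial>lborel)) + ennreal C1 * (ennreal r * (\<integral>\<^sup>+\<tau>. h2 \<tau> * (indicator S \<tau> * N \<tau>) \<partial>lborel)))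
            + ennreal (2 * c * r) * (\<integral>\<^sup>+\<tau>. h \<tau> * R \<tau> \<xi> \<partial>lborel)"
        proof -
          have "ennreal (c * r) = ennreal c * ennreal r" "ennreal (c * ?e) = ennreal c * ennreal ?e" "ennreal (2 * c * r) = 2 * ennreal c * ennreal r"
            using pos r e by (simp_all add: ennreal_mult)
          then show ?thesis by (simp only: distrib_left mult_ac)
        qed
        also have "\<dots> \<le> ennreal (c * ?e) * (ennreal CT * ennreal (E / sqrt \<mu>) + ennreal C1 * ennreal (d / sqrt \<mu>))
            + ennreal (2 * c * r) * (\<integral>\<^sup>+\<tau>. h \<tau> * R \<tau> \<xi> \<partial>lborel)"
          unfolding h2_def
          by (intro add_mono mult_left_mono source_bound order_refl) (use energy d pos r in \<open>auto simp: N_def[symmetric] S_def\<close>)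
        also have "ennreal (c * ?e) * (ennreal CT * ennreal (E / sqrt \<mu>) + ennreal C1 * ennreal (d / sqrt \<mu>))
           = ennreal (c * ?e * (CT * (E / sqrt \<mu>) + C1 * (d / sqrt \<mu>)))"
          using pos e d CT C1 by (simp add: ennreal_mult[symmetric] ennreal_plus[symmetric] del: ennreal_plus)
        finally have nl: "ennreal (c * r) * (\<integral>\<^sup>+\<tau>. h \<tau> * self_conv V \<tau> \<xi> \<partial>lborel)
          \<le> ennreal (c * ?e * (CT * (E / sqrt \<mu>) + C1 * (d / sqrt \<mu>))) + ennreal (2 * c * r) * (\<integral>\<^sup>+\<tau>. h \<tau> * R \<tau> \<xi> \<partial>lborel)" .
        have lin: "K0 * exp (- (\<mu> * t * r\<^sup>2)) \<le> K0 * (ck * a)"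
        proof (rule mult_left_mono)
          have "exp (- (\<mu> * (t - 0) * r\<^sup>2)) * decay k 0 r \<le> ck * (exp (- (\<mu> / 2 * (t - 0) * r\<^sup>2)) * decay k t r)"
            using t' by (intro ck) auto
          also have "\<dots> \<le> ck * (1 * decay k t r)"
            using ck t' pos by (intro mult_left_mono mult_right_mono) (auto simp: decay_nonneg)
          finally show "exp (- (\<mu> * t * r\<^sup>2)) \<le> ck * a" by (simp add: decay_def a_def)
        qed (use pos in simp)
        have "K0 * (ck * a) + c * ?e * (CT * (E / sqrt \<mu>) + C1 * (d / sqrt \<mu>))
          = a * ((K0 * ck + 2 * 4 ^ k * ck * c * CT * (E / sqrt \<mu>)) + C1 * (2 * 4 ^ k * ck * c * (d / sqrt \<mu>)))"
          by (simp add: algebra_simps)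
        also have "\<dots> \<le> a * (C1 / 2 + C1 * (1 / 2))"
          using a C1 small(1) by (intro mult_left_mono add_mono) (auto simp: C1_def)
        finally have sum: "K0 * (ck * a) + c * ?e * (CT * (E / sqrt \<mu>) + C1 * (d / sqrt \<mu>)) \<le> C1 * a" by (simp add: mult.commute)
        have "V (t, \<xi>) \<le> ennreal (K0 * (ck * a)) + (ennreal (c * ?e * (CT * (E / sqrt \<mu>) + C1 * (d / sqrt \<mu>))) + ennreal (2 * c * r) * (\<integral>\<^sup>+\<tau>. h \<tau> * R \<tau> \<xi> \<partial>lborel))"
          using elim nl lin unfolding h_def r_def by (meson add_mono ennreal_leI order_trans)
        also have "\<dots> = ennreal (K0 * (ck * a) + c * ?e * (CT * (E / sqrt \<mu>) + C1 * (d / sqrt \<mu>))) + ennreal (2 * c * r) * (\<integral>\<^sup>+\<tau>. h \<tau> * R \<tau> \<xi> \<partial>lborel)"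
          using pos ck a e CT C1 d by (subst ennreal_plus) (auto simp: add.assoc)
        also have "\<dots> \<le> ennreal (C1 * a) + ennreal (2 * c * r) * (\<integral>\<^sup>+\<tau>. h \<tau> * R \<tau> \<xi> \<partial>lborel)"
          by (intro add_right_mono ennreal_leI sum)
        finally show ?case unfolding h_def a_def r_def .
      qed
    qed
  qed
  define kern where "kern t = (\<lambda>(\<xi>::'a, \<tau>). ennreal (2 * c) * (ennreal \<bar>norm \<xi>\<bar> * heat_factor \<mu> t \<tau> (norm \<xi>)))" for t
  have w_le: "AE t in lborel. w t \<le> (\<integral>\<^sup>+z. kern t z * (case z of (\<xi>, \<tau>) \<Rightarrow> R \<tau> \<xi>) \<partial>(lborel \<Otimes>\<^sub>M lborel))"
    using V_Z
  proof eventually_elim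
    case (elim t)
    show ?case
    proof (cases "t \<in> S")
      case True
      with elim have "AE \<xi> in lborel. V (t, \<xi>) \<le> ennreal (C1 * decay k t (norm \<xi>)) +
        ennreal (2 * c * norm \<xi>) * (\<integral>\<^sup>+\<tau>. heat_factor \<mu> t \<tau> (norm \<xi>) * R \<tau> \<xi> \<partial>lborel)" by blast
      then have "w t \<le> (\<integral>\<^sup>+\<xi>. (\<integral>\<^sup>+\<tau>. kern t (\<xi>, \<tau>) * (case (\<xi>, \<tau>) of (\<xi>, \<tau>) \<Rightarrow> R \<tau> \<xi>) \<partial>lborel) \<partial>lborel)"
        unfolding w_def
      proof (intro nn_integral_mono_AE, eventually_elim)
        case (elim \<xi>)
        have [measurable]: "(\<lambda>\<tau>. R \<tau> \<xi>) \<in> borel_measurable borel" by (rule R_meas')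
        have "W (t, \<xi>) \<le> ennreal (2 * c * norm \<xi>) * (\<integral>\<^sup>+\<tau>. heat_factor \<mu> t \<tau> (norm \<xi>) * R \<tau> \<xi> \<partial>lborel)"
          using elim True by (simp add: W_def ennreal_minus_le_iff)
        also have "\<dots> = (\<integral>\<^sup>+\<tau>. kern t (\<xi>, \<tau>) * R \<tau> \<xi> \<partial>lborel)"
          using pos by (simp add: kern_def nn_integral_cmult[symmetric] ennreal_mult mult.assoc)
        finally show ?case by simp
      qed
      also have "\<dots> = (\<integral>\<^sup>+z. kern t z * (case z of (\<xi>, \<tau>) \<Rightarrow> R \<tau> \<xi>) \<partial>(lborel \<Otimes>\<^sub>M lborel))"
        unfolding kern_def by (rule lborel.nn_integral_fst) measurable
      finally show ?thesis .
    qed (simp add: w_def W_off)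
  qed
  \<comment> \<open>By Tonelli, \<open>W * V\<close> has total mass the time integral of \<open>w N\<close>, and \<open>w\<close> lives on \<open>S\<close>.\<close>
  have R_total: "(\<integral>\<^sup>+z. (case z of (\<xi>, \<tau>) \<Rightarrow> R \<tau> \<xi>) \<partial>(lborel \<Otimes>\<^sub>M lborel)) = (\<integral>\<^sup>+\<tau>. w \<tau> * (indicator S \<tau> * N \<tau>) \<partial>lborel)"
  proof -
    have "(\<integral>\<^sup>+z. (case z of (\<xi>, \<tau>) \<Rightarrow> R \<tau> \<xi>) \<partial>(lborel \<Otimes>\<^sub>M lborel)) = (\<integral>\<^sup>+\<tau>. \<integral>\<^sup>+\<xi>. R \<tau> \<xi> \<partial>lborel \<partial>lborel)"
      by (subst lborel_pair.nn_integral_snd[symmetric]) auto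
    also have "\<dots> = (\<integral>\<^sup>+\<tau>. w \<tau> * (indicator S \<tau> * N \<tau>) \<partial>lborel)"
    proof (intro nn_integral_cong)
      fix \<tau>
      have "(\<integral>\<^sup>+\<xi>. R \<tau> \<xi> \<partial>lborel) = (\<integral>\<^sup>+\<eta>. \<integral>\<^sup>+\<xi>. W (\<tau>, \<eta>) * V (\<tau>, \<xi> - \<eta>) \<partial>lborel \<partial>lborel)"
        unfolding R_def by (rule lborel_pair.Fubini') measurable
      also have "\<dots> = (\<integral>\<^sup>+\<eta>. W (\<tau>, \<eta>) * N \<tau> \<partial>lborel)"
      proof (intro nn_integral_cong)
        fix \<eta>
        have "(\<integral>\<^sup>+\<xi>. V (\<tau>, \<xi> - \<eta>) \<partial>lborel) = N \<tau>"
          unfolding N_def by (subst lborel_nn_integral_affine[of _ 1 "- \<eta>"]) auto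
        then show "(\<integral>\<^sup>+\<xi>. W (\<tau>, \<eta>) * V (\<tau>, \<xi> - \<eta>) \<partial>lborel) = W (\<tau>, \<eta>) * N \<tau>"
          by (simp add: nn_integral_cmult)
      qed
      also have "\<dots> = w \<tau> * N \<tau>" unfolding w_def by (simp add: nn_integral_multc)
      also have "\<dots> = w \<tau> * (indicator S \<tau> * N \<tau>)" by (cases "\<tau> \<in> S") (simp_all add: w_def W_off)
      finally show "(\<integral>\<^sup>+\<xi>. R \<tau> \<xi> \<partial>lborel) = w \<tau> * (indicator S \<tau> * N \<tau>)" .
    qed
    finally show ?thesis .
  qed
  define y where "y = (\<integral>\<^sup>+t. (w t)\<^sup>2 \<partial>lborel)"
  have "y \<le> (\<integral>\<^sup>+t. (\<integral>\<^sup>+z. kern t z * (case z of (\<xi>, \<tau>) \<Rightarrow> R \<tau> \<xi>) \<partial>(lborel \<Otimes>\<^sub>M lborel))\<^sup>2 \<partial>lborel)"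
    unfolding y_def by (rule nn_integral_mono_AE, use w_le in eventually_elim) (intro power_mono, auto)
  also have "\<dots> \<le> ennreal (4 * c\<^sup>2 * (1 / (2 * \<mu>))) * (\<integral>\<^sup>+z. (case z of (\<xi>, \<tau>) \<Rightarrow> R \<tau> \<xi>) \<partial>(lborel \<Otimes>\<^sub>M lborel))\<^sup>2"
  proof (rule nn_integral_kernel_L1_L2)
    show "sigma_finite_measure (lborel \<Otimes>\<^sub>M lborel :: ('a \<times> real) measure)"
      by (simp add: lborel_prod sigma_finite_lborel)
    show "(\<lambda>(t, z). kern t z) \<in> borel_measurable (lborel \<Otimes>\<^sub>M (lborel \<Otimes>\<^sub>M lborel))"
      unfolding kern_def by measurable
    fix z :: "'a \<times> real"
    obtain \<xi> \<tau> where z: "z = (\<xi>, \<tau>)" by (cases z)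
    have "(\<integral>\<^sup>+t. (kern t z)\<^sup>2 \<partial>lborel) = ennreal (4 * c\<^sup>2) * (\<integral>\<^sup>+t. (ennreal \<bar>norm \<xi>\<bar> * heat_factor \<mu> t \<tau> (norm \<xi>))\<^sup>2 \<partial>lborel)"
      unfolding z kern_def using pos
      by (simp add: power_mult_distrib nn_integral_cmult[symmetric] ennreal_power)
    also have "\<dots> \<le> ennreal (4 * c\<^sup>2) * ennreal (1 / (2 * \<mu>))"
      by (intro mult_left_mono heat_factor_L2_target pos) simp
    also have "\<dots> = ennreal (4 * c\<^sup>2 * (1 / (2 * \<mu>)))" using pos by (intro ennreal_mult[symmetric]) auto
    finally show "(\<integral>\<^sup>+t. (kern t z)\<^sup>2 \<partial>lborel) \<le> ennreal (4 * c\<^sup>2 * (1 / (2 * \<mu>)))" .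
  qed (auto intro: sigma_finite_lborel)
  also have "(\<integral>\<^sup>+z. (case z of (\<xi>, \<tau>) \<Rightarrow> R \<tau> \<xi>) \<partial>(lborel \<Otimes>\<^sub>M lborel))\<^sup>2 \<le> y * ennreal (d\<^sup>2)"
  proof -
    have "(\<integral>\<^sup>+\<tau>. w \<tau> * (indicator S \<tau> * N \<tau>) \<partial>lborel)\<^sup>2 \<le> y * (\<integral>\<^sup>+\<tau>. (indicator S \<tau> * N \<tau>)\<^sup>2 \<partial>lborel)"
      unfolding y_def by (rule Cauchy_Schwarz_nn_integral) measurable
    also have "(\<integral>\<^sup>+\<tau>. (indicator S \<tau> * N \<tau>)\<^sup>2 \<partial>lborel) = (\<integral>\<^sup>+\<tau>. indicator S \<tau> * (N \<tau>)\<^sup>2 \<partial>lborel)"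
      by (intro nn_integral_cong) (simp add: indicator_def)
    also have "y * \<dots> \<le> y * ennreal (d\<^sup>2)" using d unfolding S_def by (intro mult_left_mono) auto
    finally show ?thesis unfolding R_total .
  qed
  also have "ennreal (4 * c\<^sup>2 * (1 / (2 * \<mu>))) * (y * ennreal (d\<^sup>2)) = ennreal (4 * c\<^sup>2 * (1 / (2 * \<mu>)) * d\<^sup>2) * y"
  proof -
    have "ennreal (4 * c\<^sup>2 * (1 / (2 * \<mu>)) * d\<^sup>2) = ennreal (4 * c\<^sup>2 * (1 / (2 * \<mu>))) * ennreal (d\<^sup>2)"
      using pos by (intro ennreal_mult) auto
    then show ?thesis by (simp only: mult_ac)
  qed
  \<comment> \<open>Together with the finiteness of \<open>y\<close> this forces \<open>y = 0\<close>.\<close>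
  finally have y1: "y \<le> ennreal (4 * c\<^sup>2 * (1 / (2 * \<mu>)) * d\<^sup>2) * y" by (simp add: mult_left_mono)
  have "y \<le> (\<integral>\<^sup>+t. (N t)\<^sup>2 \<partial>lborel)"
    unfolding y_def N_def w_def by (intro nn_integral_mono power_mono W_le) auto
  also have "\<dots> < \<infinity>" using energy unfolding N_def by (rule le_less_trans) simp
  finally have "y = 0" using y1 small(2) pos by (intro ennreal_zero_of_half[OF y1]) (auto simp: field_simps)
  then have "AE t in lborel. (w t)\<^sup>2 = 0"
    unfolding y_def by (subst (asm) nn_integral_0_iff_AE) auto
  then show ?thesis
  proof eventually_elim
    case (elim t)
    show ?case
    proof
      assume "T < t \<and> t \<le> T'"
      then have t: "t \<in> S" by (simp add: S_def)
      have "w t = 0" using elim by simp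
      then have "AE \<xi> in lborel. W (t, \<xi>) = 0"
        unfolding w_def by (subst (asm) nn_integral_0_iff_AE) auto
      then show "AE \<xi> in lborel. V (t, \<xi>) \<le> ennreal (C1 * decay k t (norm \<xi>))"
      proof eventually_elim
        case (elim \<xi>)
        then show ?case using V_le[OF t, of \<xi>] by simp
      qed
    qed
  qed
qed

text \<open>The energy accumulated up to time \<open>t\<close> is a continuous function of \<open>t\<close>, being the distribution
  function of a finite measure without atoms. Its levels \<open>j d\<^sup>2\<close> therefore cut the time axis into
  finitely many intervals of energy at most \<open>d\<^sup>2\<close>, and \<open>barrier_step\<close> passes from one to the next.
  The constants depend on the level only, which covers the unbounded last interval as well.\<close>

lemma decay_bound:
  "\<exists>C\<ge>0. AE t in lborel. 0 < t \<longrightarrow> (AE \<xi> in lborel. V (t, \<xi>) \<le> ennreal (C * decay k t (norm \<xi>)))"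
proof -
  obtain ck where ck: "ck \<ge> 1" "\<And>t \<tau> r. 0 \<le> \<tau> \<Longrightarrow> \<tau> \<le> t \<Longrightarrow>
      exp (- (\<mu> * (t - \<tau>) * r\<^sup>2)) * decay k \<tau> r \<le> ck * (exp (- (\<mu> / 2 * (t - \<tau>) * r\<^sup>2)) * decay k t r)"
    using decay_transport[OF pos(1), of k] by blast
  define B1 where "B1 = 4 * 4 ^ k * ck * c / sqrt \<mu>"
  define B2 where "B2 = 4 * c\<^sup>2 / \<mu>"
  \<comment> \<open>small enough for both conditions of \<open>barrier_step\<close>, as \<open>B1 d \<le> 1\<close> and \<open>B2 d\<^sup>2 \<le> B2 d \<le> 1\<close>\<close>
  define d where "d = 1 / (1 + B1 + B2)"
  have B: "0 \<le> B1" "0 \<le> B2" using pos ck by (auto simp: B1_def B2_def)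
  then have d: "0 < d" "d \<le> 1" "B1 * d \<le> 1" "B2 * d \<le> 1" by (auto simp: d_def divide_le_eq)
  have "B2 * d\<^sup>2 \<le> B2 * d" using B d by (intro mult_left_mono) (auto simp: power2_eq_square mult_le_one intro: mult_left_le_one_le)
  then have small: "4 * 4 ^ k * ck * c * (d / sqrt \<mu>) \<le> 1" "4 * c\<^sup>2 * d\<^sup>2 / \<mu> \<le> 1"
    using d by (auto simp: B1_def B2_def)
  define \<nu> where "\<nu> = density lborel (\<lambda>\<tau>. (N \<tau>)\<^sup>2)"
  have total: "emeasure \<nu> UNIV < \<infinity>"
    using energy unfolding \<nu>_def N_def by (subst emeasure_density) (auto simp: le_less_trans)
  have "space \<nu> = UNIV" by (simp add: \<nu>_def)
  then have "finite_measure \<nu>" using total by (intro finite_measureI) simp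
  moreover have "sets \<nu> = sets borel" by (simp add: \<nu>_def)
  ultimately interpret finite_borel_measure \<nu>
    by (intro finite_borel_measure.intro finite_borel_measure_axioms.intro)
  have cont: "isCont (cdf \<nu>) x" for x
  proof -
    have "emeasure \<nu> {x} = 0" unfolding \<nu>_def
      by (subst emeasure_density) (auto simp: nn_integral_0_iff_AE indicator_def intro: eventually_mono[OF AE_lborel_singleton[of x]])
    then show ?thesis unfolding isCont_cdf by (simp add: measure_def)
  qed
  have cdf0: "cdf \<nu> 0 = 0"
  proof -
    have "emeasure \<nu> {..0} = 0" unfolding \<nu>_def
      by (subst emeasure_density) (auto simp: nn_integral_0_iff_AE indicator_def N_past)
    then show ?thesis by (simp add: cdf_def measure_def)
  qed
  define G where "G CT = max CT (2 * (K0 * ck + 2 * 4 ^ k * ck * c * CT * (E / sqrt \<mu>)))" for CT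
  have step: "AE t in lborel. 0 < t \<and> t \<le> T' \<longrightarrow> (AE \<xi> in lborel. V (t, \<xi>) \<le> ennreal (G CT * decay k t (norm \<xi>)))"
    if T: "0 \<le> T" "T \<le> T'" "cdf \<nu> T' - cdf \<nu> T \<le> d\<^sup>2" and CT: "0 \<le> CT"
      and before: "AE t in lborel. 0 < t \<and> t \<le> T \<longrightarrow> (AE \<xi> in lborel. V (t, \<xi>) \<le> ennreal (CT * decay k t (norm \<xi>)))"
    for T T' CT
  proof -
    have "measure \<nu> {T<..T'} \<le> d\<^sup>2"
      using T cdf_diff_eq[of T T'] by (cases "T = T'") auto
    then have "emeasure \<nu> {T<..T'} \<le> ennreal (d\<^sup>2)" by (simp add: emeasure_eq_measure ennreal_leI)
    also have "emeasure \<nu> {T<..T'} = (\<integral>\<^sup>+\<tau>. indicator {T<..T'} \<tau> * (N \<tau>)\<^sup>2 \<partial>lborel)"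
      unfolding \<nu>_def by (subst emeasure_density) (auto simp: mult.commute)
    finally have small': "(\<integral>\<^sup>+\<tau>. indicator {T<..T'} \<tau> * (N \<tau>)\<^sup>2 \<partial>lborel) \<le> ennreal (d\<^sup>2)" .
    have "AE t in lborel. T < t \<and> t \<le> T' \<longrightarrow> (AE \<xi> in lborel. V (t, \<xi>)
        \<le> ennreal (2 * (K0 * ck + 2 * 4 ^ k * ck * c * CT * (E / sqrt \<mu>)) * decay k t (norm \<xi>)))"
      by (rule barrier_step[OF ck(1) _ T(1) CT before less_imp_le[OF d(1)] small' small]) (rule ck(2))
    with before show ?thesis
    proof eventually_elim
      case (elim t)
      show ?case
      proof
        assume t: "0 < t \<and> t \<le> T'"
        have le: "ennreal (CT * decay k t (norm \<xi>)) \<le> ennreal (G CT * decay k t (norm \<xi>))"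
          "ennreal (2 * (K0 * ck + 2 * 4 ^ k * ck * c * CT * (E / sqrt \<mu>)) * decay k t (norm \<xi>)) \<le> ennreal (G CT * decay k t (norm \<xi>))" for \<xi> :: 'a
          using t by (auto simp: G_def decay_nonneg intro!: ennreal_leI mult_right_mono)
        show "AE \<xi> in lborel. V (t, \<xi>) \<le> ennreal (G CT * decay k t (norm \<xi>))"
        proof (cases "t \<le> T")
          case True
          then have "AE \<xi> in lborel. V (t, \<xi>) \<le> ennreal (CT * decay k t (norm \<xi>))" using elim t by blast
          then show ?thesis by eventually_elim (rule order_trans[OF _ le(1)])
        next
          case False
          then have "AE \<xi> in lborel. V (t, \<xi>) \<le> ennreal (2 * (K0 * ck + 2 * 4 ^ k * ck * c * CT * (E / sqrt \<mu>)) * decay k t (norm \<xi>))"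
            using elim t by auto
          then show ?thesis by eventually_elim (rule order_trans[OF _ le(2)])
        qed
      qed
    qed
  qed
  have levels: "\<exists>C\<ge>0. \<forall>T\<ge>0. cdf \<nu> T \<le> real j * d\<^sup>2 \<longrightarrow>
      (AE t in lborel. 0 < t \<and> t \<le> T \<longrightarrow> (AE \<xi> in lborel. V (t, \<xi>) \<le> ennreal (C * decay k t (norm \<xi>))))" for j
  proof (induction j)
    case 0
    have "AE t in lborel. 0 < t \<and> t \<le> T \<longrightarrow> (AE \<xi> in lborel. V (t, \<xi>) \<le> ennreal (G 0 * decay k t (norm \<xi>)))"
      if "0 \<le> T" "cdf \<nu> T \<le> 0" for T
      using that cdf0 by (intro step[of 0]) (auto intro: order_trans)
    moreover have "0 \<le> G 0" by (simp add: G_def)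
    ultimately show ?case by (intro exI[of _ "G 0"]) auto
  next
    case (Suc j)
    then obtain C where C: "0 \<le> C" "\<And>T. 0 \<le> T \<Longrightarrow> cdf \<nu> T \<le> real j * d\<^sup>2 \<Longrightarrow>
      (AE t in lborel. 0 < t \<and> t \<le> T \<longrightarrow> (AE \<xi> in lborel. V (t, \<xi>) \<le> ennreal (C * decay k t (norm \<xi>))))" by blast
    have "AE t in lborel. 0 < t \<and> t \<le> T \<longrightarrow> (AE \<xi> in lborel. V (t, \<xi>) \<le> ennreal (G C * decay k t (norm \<xi>)))"
      if T: "0 \<le> T" "cdf \<nu> T \<le> real (Suc j) * d\<^sup>2" for T
    proof -
      have "\<exists>T0. 0 \<le> T0 \<and> T0 \<le> T \<and> cdf \<nu> T0 = min (cdf \<nu> T) (real j * d\<^sup>2)"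
        using T(1) cdf_nondecreasing[OF T(1)] by (intro IVT) (auto simp: cdf0 cont)
      then obtain T0 where T0: "0 \<le> T0" "T0 \<le> T" "cdf \<nu> T0 = min (cdf \<nu> T) (real j * d\<^sup>2)" by blast
      show ?thesis
      proof (rule step[OF T0(1,2) _ C(1)])
        show "cdf \<nu> T - cdf \<nu> T0 \<le> d\<^sup>2" using T(2) T0(3) by (simp add: min_def distrib_right)
        show "AE t in lborel. 0 < t \<and> t \<le> T0 \<longrightarrow> (AE \<xi> in lborel. V (t, \<xi>) \<le> ennreal (C * decay k t (norm \<xi>)))"
          using T0 by (intro C(2)) auto
      qed
    qed
    moreover have "0 \<le> G C" using C(1) by (simp add: G_def)
    ultimately show ?case by (intro exI[of _ "G C"]) auto
  qed
  obtain j where j: "measure \<nu> (space \<nu>) \<le> real j * d\<^sup>2"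
    using reals_Archimedean3[of "d\<^sup>2"] d(1) by (auto intro: less_imp_le)
  obtain C where C: "0 \<le> C" "\<And>T. 0 \<le> T \<Longrightarrow> cdf \<nu> T \<le> real j * d\<^sup>2 \<Longrightarrow>
      (AE t in lborel. 0 < t \<and> t \<le> T \<longrightarrow> (AE \<xi> in lborel. V (t, \<xi>) \<le> ennreal (C * decay k t (norm \<xi>))))"
    using levels[of j] by blast
  have "AE t in lborel. \<forall>n::nat. 0 < t \<and> t \<le> real n \<longrightarrow> (AE \<xi> in lborel. V (t, \<xi>) \<le> ennreal (C * decay k t (norm \<xi>)))"
    unfolding AE_all_countable
  proof
    fix n :: nat
    have "cdf \<nu> (real n) \<le> real j * d\<^sup>2" using cdf_bounded[of "real n"] j by linarith
    then show "AE t in lborel. 0 < t \<and> t \<le> real n \<longrightarrow> (AE \<xi> in lborel. V (t, \<xi>) \<le> ennreal (C * decay k t (norm \<xi>)))"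
      by (intro C(2)) auto
  qed
  then have "AE t in lborel. 0 < t \<longrightarrow> (AE \<xi> in lborel. V (t, \<xi>) \<le> ennreal (C * decay k t (norm \<xi>)))"
  proof eventually_elim
    case (elim t)
    obtain n :: nat where "t \<le> real n" using real_arch_simple by blast
    then show ?case using elim by blast
  qed
  then show ?thesis using C(1) by blast
qed

end

section \<open>Fourier--Lebesgue norms of vector fields\<close>

lemma borel_measurable_vec_lambda [measurable (raw)]:
  fixes f :: "'i::finite \<Rightarrow> 'a \<Rightarrow> 'b::euclidean_space"
  assumes "\<And>i. f i \<in> borel_measurable M"
  shows "(\<lambda>x. \<chi> i. f i x) \<in> borel_measurable M"
proof (subst borel_measurable_euclidean_space, intro ballI)
  fix b :: "'b^'i" assume "b \<in> Basis"
  then obtain i c where b: "b = axis i c" by (auto simp: Basis_vec_def)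
  have "(\<lambda>x. f i x \<bullet> c) \<in> borel_measurable M" using assms by measurable
  then show "(\<lambda>x. (\<chi> i. f i x) \<bullet> b) \<in> borel_measurable M" by (simp add: b inner_axis)
qed

lemma borel_measurable_vec_component [measurable (raw)]:
  fixes f :: "'a \<Rightarrow> 'b::euclidean_space^'i::finite"
  assumes [measurable]: "f \<in> borel_measurable M" shows "(\<lambda>x. f x $ i) \<in> borel_measurable M"
proof -
  have "(\<lambda>x::'b^'i. x $ i) \<in> borel_measurable borel"
    by (intro borel_measurable_continuous_onI continuous_intros)
  from measurable_compose[OF assms this] show ?thesis .
qed

lemma hconj_infinity [simp]: "hconj \<infinity> = 1" "hconj top = 1"
  by (simp_all add: hconj_def)

lemma ennpow_1 [simp]: "ennpow x 1 = x"
  by (cases x) (auto simp: ennpow_def)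

lemma ennpow_2: "ennpow x 2 = x\<^sup>2"
proof (cases x)
  case (real r)
  then have "r powr 2 = r\<^sup>2" by (cases "r = 0") (auto simp: powr_numeral)
  then show ?thesis using real by (simp add: ennpow_def ennreal_power)
qed (simp add: ennpow_def power2_eq_square)

lemma ennpow_less_top_iff [simp]: "ennpow x a < top \<longleftrightarrow> x < top"
  by (cases x) (auto simp: ennpow_def)

lemma hatL_norm_infinity:
  assumes "hat_class f"
  shows "hatL_norm \<infinity> f = (\<integral>\<^sup>+\<xi>. ennreal (norm (vhat f \<xi>)) \<partial>lborel)"
  using assms by (simp add: hatL_norm_def Lq_norm_def)

text \<open>Outside the ambient class the norm is infinite, so a finite norm carries membership along.\<close>

lemma hatL_norm_finite_class: "hatL_norm p f < \<infinity> \<Longrightarrow> hat_class f"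
  by (auto simp: hatL_norm_def split: if_splits)

lemma hat_class_has_hat:
  assumes "hat_class f" shows "has_hat (f $ i) (hat (f $ i))"
  using assms has_hat_hat unfolding hat_class_def by blast

lemma vhat_measurable [measurable]:
  assumes "hat_class f" shows "vhat f \<in> borel_measurable borel"
  unfolding vhat_def[abs_def]
  by (intro borel_measurable_vec_lambda has_hat_measurable[OF hat_class_has_hat] assms)

lemma hat_class_vdiff:
  assumes "hat_class u" "hat_class v" shows "hat_class (vdiff u v)"
  unfolding hat_class_def
proof
  fix i
  have "tempered (\<lambda>f. (u $ i) f - (v $ i) f)"
    using assms unfolding hat_class_def by (intro tempered_add_diff(1)) auto
  moreover have "has_hat (\<lambda>f. (u $ i) f - (v $ i) f) (\<lambda>\<xi>. hat (u $ i) \<xi> - hat (v $ i) \<xi>)"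
    by (intro has_hat_add_diff(2) hat_class_has_hat assms)
  ultimately show "tempered (vdiff u v $ i) \<and> (\<exists>g. has_hat (vdiff u v $ i) g)"
    unfolding vdiff_def vec_lambda_beta by blast
qed

lemma vhat_vdiff:
  fixes \<phi> :: "real^'d::finite \<Rightarrow> real" and u v :: "('d dist)^'d"
  assumes lp: "littlewood_paley \<phi>" and "hat_class u" "hat_class v"
  shows "AE \<xi> in lborel. vhat (vdiff u v) \<xi> = vhat u \<xi> - vhat v \<xi>"
proof -
  have "AE \<xi> in lborel. \<forall>i\<in>UNIV. hat (vdiff u v $ i) \<xi> = hat (u $ i) \<xi> - hat (v $ i) \<xi>"
  proof (rule AE_finite_allI)
    fix i
    have "has_hat (vdiff u v $ i) (\<lambda>\<xi>. hat (u $ i) \<xi> - hat (v $ i) \<xi>)"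
      using has_hat_add_diff(2)[OF hat_class_has_hat[OF assms(2)] hat_class_has_hat[OF assms(3)]] by (simp add: vdiff_def)
    then show "AE \<xi> in lborel. hat (vdiff u v $ i) \<xi> = hat (u $ i) \<xi> - hat (v $ i) \<xi>" by (rule hat_AE[OF lp])
  qed simp
  then show ?thesis by eventually_elim (simp add: vhat_def vec_eq_iff)
qed

text \<open>Approximation in norm controls \<open>u - v\<close> only; membership of \<open>u\<close> is recovered by adding \<open>v\<close>.\<close>

lemma hat_class_of_vdiff:
  fixes u v :: "('d::finite dist)^'d"
  assumes "hat_class (vdiff u v)" "hat_class v" shows "hat_class u"
  unfolding hat_class_def
proof
  fix i
  have eq: "u $ i = (\<lambda>f. (vdiff u v $ i) f + (v $ i) f)" by (simp add: vdiff_def)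
  have "tempered (\<lambda>f. (vdiff u v $ i) f + (v $ i) f)"
    using assms unfolding hat_class_def by (intro tempered_add_diff(2)) auto
  moreover have "has_hat (\<lambda>f. (vdiff u v $ i) f + (v $ i) f) (\<lambda>\<xi>. hat (vdiff u v $ i) \<xi> + hat (v $ i) \<xi>)"
    by (intro has_hat_add_diff(1) hat_class_has_hat assms)
  ultimately show "tempered (u $ i) \<and> (\<exists>g. has_hat (u $ i) g)" unfolding eq by blast
qed

section \<open>Joint measurability in time and frequency\<close>

text \<open>The sum of the distances has finite integral, hence is finite almost everywhere, and its terms
  tend to \<open>0\<close> there.\<close>

lemma AE_convergent_of_summable_L1:
  fixes X :: "'a \<Rightarrow> 'b::euclidean_space"
  assumes [measurable]: "X \<in> borel_measurable M" "\<And>k. G k \<in> borel_measurable M"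
    and b: "\<And>k. (\<integral>\<^sup>+x. ennreal (norm (X x - G k x)) \<partial>M) \<le> ennreal ((1 / 2) ^ k)"
  shows "AE x in M. (\<lambda>k. G k x) \<longlonglongrightarrow> X x"
proof -
  have "(\<integral>\<^sup>+x. (\<Sum>k. ennreal (norm (X x - G k x))) \<partial>M) = (\<Sum>k. \<integral>\<^sup>+x. ennreal (norm (X x - G k x)) \<partial>M)"
    by (rule nn_integral_suminf) measurable
  also have "\<dots> \<le> (\<Sum>k. ennreal ((1 / 2) ^ k))" by (intro suminf_le b) auto
  also have "\<dots> = ennreal (\<Sum>k. (1 / 2) ^ k)" by (rule suminf_ennreal2) auto
  also have "\<dots> < \<infinity>" by simp
  finally have "(\<integral>\<^sup>+x. (\<Sum>k. ennreal (norm (X x - G k x))) \<partial>M) \<noteq> \<infinity>" by simp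
  then have "AE x in M. (\<Sum>k. ennreal (norm (X x - G k x))) \<noteq> \<infinity>"
    by (intro nn_integral_PInf_AE) auto
  then show ?thesis
  proof eventually_elim
    case (elim x)
    then have "summable (\<lambda>k. norm (X x - G k x))" by (intro summable_suminf_not_top) auto
    then have "(\<lambda>k. norm (X x - G k x)) \<longlonglongrightarrow> 0" by (rule summable_LIMSEQ_zero)
    then have "(\<lambda>k. norm (G k x - X x)) \<longlonglongrightarrow> 0" by (simp add: norm_minus_commute)
    then have "(\<lambda>k. G k x - X x) \<longlonglongrightarrow> 0" by (rule tendsto_norm_zero_cancel)
    then show ?case by (rule LIM_zero_cancel)
  qed
qed

text \<open>The index is defined through mutual distances \<open>e\<close> alone, which depend measurably on time, and not
  through the distance \<open>E\<close> to the limit, whose measurability is not yet known. The distances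
  obey the triangle inequality, so a small tail of \<open>e\<close> makes \<open>E\<close> small in the limit \<open>m \<rightarrow> \<infinity>\<close>.\<close>

lemma fast_Cauchy_index:
  fixes e :: "nat \<Rightarrow> nat \<Rightarrow> ennreal" and E :: "nat \<Rightarrow> ennreal"
  assumes E: "E \<longlonglongrightarrow> 0" and e: "\<And>n m. e n m \<le> E n + E m" "\<And>n m. E n \<le> e n m + E m" and \<delta>: "0 < \<delta>"
  shows "E (LEAST n. \<forall>m\<ge>n. e n m \<le> ennreal \<delta>) \<le> ennreal \<delta>"
proof -
  let ?i = "LEAST n. \<forall>m\<ge>n. e n m \<le> ennreal \<delta>"
  have "\<forall>\<^sub>F n in sequentially. E n < ennreal (\<delta> / 2)"
    using \<delta> by (intro order_tendstoD(2)[OF E]) (simp add: ennreal_zero_less_divide)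
  then obtain n0 where n0: "\<And>n. n \<ge> n0 \<Longrightarrow> E n < ennreal (\<delta> / 2)" unfolding eventually_sequentially by blast
  have "e n0 m \<le> ennreal \<delta>" if "m \<ge> n0" for m
  proof -
    have "e n0 m \<le> ennreal (\<delta> / 2) + ennreal (\<delta> / 2)"
      using e(1)[of n0 m] n0[of n0] n0[OF that] by (meson add_mono less_imp_le order_refl order_trans)
    also have "\<dots> = ennreal \<delta>" using \<delta> by (simp add: ennreal_plus[symmetric] del: ennreal_plus)
    finally show ?thesis .
  qed
  then have "\<forall>m\<ge>n0. e n0 m \<le> ennreal \<delta>" by simp
  then have i: "\<forall>m\<ge>?i. e ?i m \<le> ennreal \<delta>" by (rule LeastI)
  have "\<forall>\<^sub>F m in sequentially. E ?i \<le> ennreal \<delta> + E m"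
  proof (rule eventually_sequentiallyI)
    fix m assume "?i \<le> m"
    then have "e ?i m \<le> ennreal \<delta>" using i by simp
    then show "E ?i \<le> ennreal \<delta> + E m" by (rule order_trans[OF e(2) add_right_mono])
  qed
  moreover have "(\<lambda>m. ennreal \<delta> + E m) \<longlonglongrightarrow> ennreal \<delta> + 0" by (intro tendsto_add E tendsto_const)
  ultimately show ?thesis by (intro tendsto_lowerbound) auto
qed

text \<open>The transform \<open>vhat (u t)\<close> is chosen separately for each \<open>t\<close>, so Fubini needs a better version of
  it. The approximating simple functions are made Borel by passing to the Borel parts of their
  level sets. A subsequence index that depends measurably on time selects a rapidly converging
  subsequence at each time, and its pointwise limit is jointly measurable.\<close>

lemma jointly_measurable_representative:
  fixes \<phi> :: "real^'d::finite \<Rightarrow> real" and u :: "real \<Rightarrow> ('d dist)^'d"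
  assumes lp: "littlewood_paley \<phi>" and sm: "strongly_measurable \<infinity> u"
  obtains U :: "real \<times> (real^'d) \<Rightarrow> complex^'d" where "U \<in> borel_measurable borel" "\<And>t \<xi>. t \<le> 0 \<Longrightarrow> U (t, \<xi>) = 0"
    "AE t in lborel. 0 < t \<longrightarrow> hat_class (u t) \<and> hatL_norm \<infinity> (u t) < \<infinity> \<and> (AE \<xi> in lborel. vhat (u t) \<xi> = U (t, \<xi>))"
proof -
  obtain s :: "nat \<Rightarrow> real \<Rightarrow> ('d dist)^'d" where fin: "\<And>n. finite (range (s n))"
    and meas: "\<And>n v. s n -` {v} \<in> sets lebesgue" and s_fin: "\<And>n t. hatL_norm \<infinity> (s n t) < \<infinity>"
    and conv: "AE t in lebesgue. t > 0 \<longrightarrow> (\<lambda>n. hatL_norm \<infinity> (vdiff (u t) (s n t))) \<longlonglongrightarrow> 0"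
    using sm unfolding strongly_measurable_def by blast
  have s_class: "hat_class (s n t)" for n t using hatL_norm_finite_class[OF s_fin] .
  define A where "A n v = main_part lborel (s n -` {v})" for n v
  have A_meas [measurable]: "A n v \<in> sets borel" for n v
    using main_part_sets[OF meas[of n v]] by (simp add: A_def)
  define F where "F n = (\<lambda>(t, \<xi>). \<Sum>v\<in>range (s n). indicat_real (A n v) t *\<^sub>R vhat v \<xi>)" for n
  have F_meas [measurable]: "F n \<in> borel_measurable borel" for n
  proof -
    have "F n \<in> borel_measurable (borel \<Otimes>\<^sub>M borel)"
      unfolding F_def case_prod_beta
    proof (intro borel_measurable_sum borel_measurable_scaleR)
      fix v assume "v \<in> range (s n)"
      then have [measurable]: "vhat v \<in> borel_measurable borel" using s_class vhat_measurable by blast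
      show "(\<lambda>x. indicat_real (A n v) (fst x)) \<in> borel_measurable (borel \<Otimes>\<^sub>M borel)" by measurable
      show "(\<lambda>x. vhat v (snd x)) \<in> borel_measurable (borel \<Otimes>\<^sub>M borel)" by measurable
    qed
    then show ?thesis by (simp add: borel_prod)
  qed
  have F_eq: "AE t in lborel. \<forall>n \<xi>. F n (t, \<xi>) = vhat (s n t) \<xi>"
  proof -
    have "AE t in lborel. \<forall>v\<in>range (s n). t \<notin> null_part lborel (s n -` {v})" for n
      by (rule AE_finite_allI[OF fin]) (rule AE_notin_null_part[OF meas])
    then have "AE t in lborel. \<forall>n. \<forall>v\<in>range (s n). t \<notin> null_part lborel (s n -` {v})"
      unfolding AE_all_countable by blast
    then show ?thesis
    proof eventually_elim
      case (elim t)
      show ?case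
      proof (intro allI)
        fix n \<xi>
        have "t \<in> A n v \<longleftrightarrow> s n t = v" if "v \<in> range (s n)" for v
          using main_part_null_part_Un[OF meas[of n v]] elim that unfolding A_def by blast
        then have "F n (t, \<xi>) = (\<Sum>v\<in>range (s n). if s n t = v then vhat v \<xi> else 0)"
          unfolding F_def by (auto intro!: sum.cong simp: indicator_def)
        also have "\<dots> = vhat (s n t) \<xi>" using fin by (simp add: sum.delta')
        finally show "F n (t, \<xi>) = vhat (s n t) \<xi>" .
      qed
    qed
  qed
  define e where "e n m t = (\<integral>\<^sup>+\<xi>. ennreal (norm (F n (t, \<xi>) - F m (t, \<xi>))) \<partial>lborel)" for n m t
  have [measurable]: "e n m \<in> borel_measurable borel" for n m unfolding e_def[abs_def] by measurable
  define idx where "idx k t = (LEAST n. \<forall>m\<ge>n. e n m t \<le> ennreal ((1 / 2) ^ k))" for k t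
  have idx_meas [measurable]: "idx k \<in> measurable borel (count_space UNIV)" for k
    unfolding idx_def[abs_def] by measurable
  define G where "G k = (\<lambda>(t, \<xi>). F (idx k t) (t, \<xi>))" for k
  have G_meas [measurable]: "G k \<in> borel_measurable borel" for k
  proof -
    have "(fst :: real \<times> (real^'d) \<Rightarrow> real) \<in> borel_measurable borel"
      by (intro borel_measurable_continuous_onI continuous_intros)
    then have "(\<lambda>z::real \<times> (real^'d). idx k (fst z)) \<in> measurable borel (count_space UNIV)"
      by (rule measurable_compose[OF _ idx_meas])
    then have "(\<lambda>z. F (idx k (fst z)) z) \<in> borel_measurable borel"
      by (rule measurable_compose_countable[OF F_meas])
    then show ?thesis by (simp only: G_def split_beta' prod.collapse)
  qed
  define U where "U = (\<lambda>z. if 0 < fst z then lim (\<lambda>k. G k z) else 0)"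
  have U_meas: "U \<in> borel_measurable borel"
  proof -
    have fst_meas: "(fst :: real \<times> (real^'d) \<Rightarrow> real) \<in> borel_measurable borel"
      by (intro borel_measurable_continuous_onI continuous_intros)
    show ?thesis unfolding U_def
    proof (rule measurable_If)
      show "(\<lambda>z. lim (\<lambda>k. G k z)) \<in> borel_measurable borel" by (rule borel_measurable_lim_metric[OF G_meas])
      show "{z \<in> space borel. 0 < fst (z :: real \<times> (real^'d))} \<in> sets borel"
        using fst_meas by measurable
    qed simp
  qed
  have "AE t in lborel. t > 0 \<longrightarrow> (\<lambda>n. hatL_norm \<infinity> (vdiff (u t) (s n t))) \<longlonglongrightarrow> 0"
    using conv by (simp add: AE_completion_iff)
  with F_eq have "AE t in lborel. 0 < t \<longrightarrow> hat_class (u t) \<and> hatL_norm \<infinity> (u t) < \<infinity> \<and> (AE \<xi> in lborel. vhat (u t) \<xi> = U (t, \<xi>))"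
  proof eventually_elim
    case (elim t)
    show ?case
    proof
      assume t: "0 < t"
      have lim: "(\<lambda>n. hatL_norm \<infinity> (vdiff (u t) (s n t))) \<longlonglongrightarrow> 0" using elim t by blast
      then have "\<forall>\<^sub>F n in sequentially. hatL_norm \<infinity> (vdiff (u t) (s n t)) < 1"
        by (rule order_tendstoD(2)) simp
      then obtain n1 where n1: "hatL_norm \<infinity> (vdiff (u t) (s n1 t)) < 1" unfolding eventually_sequentially by blast
      then have n1': "hatL_norm \<infinity> (vdiff (u t) (s n1 t)) < \<infinity>" by (rule less_trans) simp
      have cl: "hat_class (u t)" using hat_class_of_vdiff[OF hatL_norm_finite_class[OF n1'] s_class] .
      have [measurable]: "vhat (u t) \<in> borel_measurable borel" using vhat_measurable[OF cl] .
      define E where "E n = (\<integral>\<^sup>+\<xi>. ennreal (norm (vhat (u t) \<xi> - F n (t, \<xi>))) \<partial>lborel)" for n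
      have E_eq: "hatL_norm \<infinity> (vdiff (u t) (s n t)) = E n" for n
        unfolding hatL_norm_infinity[OF hat_class_vdiff[OF cl s_class]] E_def
        by (intro nn_integral_cong_AE, use vhat_vdiff[OF lp cl s_class[of n t]] in eventually_elim) (use elim in simp)
      have E: "E \<longlonglongrightarrow> 0" using lim unfolding E_eq .
      have tri: "(\<integral>\<^sup>+\<xi>. ennreal (norm (f \<xi> - h \<xi>)) \<partial>lborel) \<le> (\<integral>\<^sup>+\<xi>. ennreal (norm (f \<xi> - g \<xi>)) \<partial>lborel) + (\<integral>\<^sup>+\<xi>. ennreal (norm (g \<xi> - h \<xi>)) \<partial>lborel)"
        if [measurable]: "f \<in> borel_measurable borel" "g \<in> borel_measurable borel" "h \<in> borel_measurable borel"
        for f g h :: "real^'d \<Rightarrow> complex^'d"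
      proof -
        have "(\<integral>\<^sup>+\<xi>. ennreal (norm (f \<xi> - h \<xi>)) \<partial>lborel) \<le> (\<integral>\<^sup>+\<xi>. ennreal (norm (f \<xi> - g \<xi>)) + ennreal (norm (g \<xi> - h \<xi>)) \<partial>lborel)"
        proof (rule nn_integral_mono)
          fix \<xi>
          have "norm (f \<xi> - h \<xi>) \<le> norm (f \<xi> - g \<xi>) + norm (g \<xi> - h \<xi>)" by (rule norm_diff_triangle_ineq[THEN order_trans[rotated]]) simp
          then show "ennreal (norm (f \<xi> - h \<xi>)) \<le> ennreal (norm (f \<xi> - g \<xi>)) + ennreal (norm (g \<xi> - h \<xi>))"
            by (simp add: ennreal_plus[symmetric] ennreal_leI del: ennreal_plus)
        qed
        then show ?thesis by (simp add: nn_integral_add)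
      qed
      have Ft [measurable]: "(\<lambda>\<xi>. F n (t, \<xi>)) \<in> borel_measurable borel" for n by measurable
      have e1: "e n m t \<le> E n + E m" for n m
        using tri[of "\<lambda>\<xi>. F n (t, \<xi>)" "vhat (u t)" "\<lambda>\<xi>. F m (t, \<xi>)"] unfolding e_def E_def by (simp add: norm_minus_commute)
      have e2: "E n \<le> e n m t + E m" for n m
        using tri[of "vhat (u t)" "\<lambda>\<xi>. F m (t, \<xi>)" "\<lambda>\<xi>. F n (t, \<xi>)"] unfolding e_def E_def by (simp add: norm_minus_commute add.commute)
      have "AE \<xi> in lborel. (\<lambda>k. F (idx k t) (t, \<xi>)) \<longlonglongrightarrow> vhat (u t) \<xi>"
      proof (rule AE_convergent_of_summable_L1)
        show "(\<integral>\<^sup>+\<xi>. ennreal (norm (vhat (u t) \<xi> - F (idx k t) (t, \<xi>))) \<partial>lborel) \<le> ennreal ((1 / 2) ^ k)" for k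
          using fast_Cauchy_index[OF E, of "\<lambda>n m. e n m t" "(1 / 2) ^ k", OF e1 e2] unfolding idx_def E_def by simp
      qed auto
      then have "AE \<xi> in lborel. vhat (u t) \<xi> = U (t, \<xi>)"
        by eventually_elim (use t in \<open>simp add: U_def G_def limI\<close>)
      moreover have "hatL_norm \<infinity> (u t) < \<infinity>"
      proof -
        have "hatL_norm \<infinity> (u t) \<le> (\<integral>\<^sup>+\<xi>. ennreal (norm (vhat (u t) \<xi> - F n1 (t, \<xi>))) + ennreal (norm (F n1 (t, \<xi>))) \<partial>lborel)"
          unfolding hatL_norm_infinity[OF cl]
        proof (rule nn_integral_mono)
          fix \<xi>
          have "norm (vhat (u t) \<xi>) \<le> norm (vhat (u t) \<xi> - F n1 (t, \<xi>)) + norm (F n1 (t, \<xi>))"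
            using norm_triangle_sub[of "vhat (u t) \<xi>" "F n1 (t, \<xi>)"] by (simp add: add.commute)
          then show "ennreal (norm (vhat (u t) \<xi>)) \<le> ennreal (norm (vhat (u t) \<xi> - F n1 (t, \<xi>))) + ennreal (norm (F n1 (t, \<xi>)))"
            by (simp add: ennreal_plus[symmetric] ennreal_leI del: ennreal_plus)
        qed
        also have "\<dots> = E n1 + hatL_norm \<infinity> (s n1 t)"
        proof -
          have Fs: "vhat (s n1 t) \<xi> = F n1 (t, \<xi>)" for \<xi> using elim by simp
          have "(\<lambda>\<xi>. ennreal (norm (vhat (u t) \<xi> - F n1 (t, \<xi>)))) \<in> borel_measurable lborel"
            "(\<lambda>\<xi>. ennreal (norm (F n1 (t, \<xi>)))) \<in> borel_measurable lborel" by measurable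
          then show ?thesis unfolding hatL_norm_infinity[OF s_class] E_def Fs by (rule nn_integral_add)
        qed
        also have "\<dots> < \<infinity>" using n1' s_fin[of n1 t] unfolding E_eq by simp
        finally show ?thesis .
      qed
      ultimately show "hat_class (u t) \<and> hatL_norm \<infinity> (u t) < \<infinity> \<and> (AE \<xi> in lborel. vhat (u t) \<xi> = U (t, \<xi>))"
        using cl by blast
    qed
  qed
  then show thesis using that[OF U_meas] by (simp add: U_def)
qed

lemma time_L2_energy:
  fixes U :: "real \<times> (real^'d::finite) \<Rightarrow> complex^'d" and u :: "real \<Rightarrow> ('d dist)^'d"
  assumes "time_L2 \<infinity> u" and past: "\<And>t \<xi>. t \<le> 0 \<Longrightarrow> U (t, \<xi>) = 0"
    and AE: "AE t in lborel. 0 < t \<longrightarrow> hat_class (u t) \<and> hatL_norm \<infinity> (u t) < \<infinity> \<and> (AE \<xi> in lborel. vhat (u t) \<xi> = U (t, \<xi>))"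
  shows "(\<integral>\<^sup>+t. (\<integral>\<^sup>+\<xi>. ennreal (norm (U (t, \<xi>))) \<partial>lborel)\<^sup>2 \<partial>lborel) < \<infinity>"
proof -
  have "(\<integral>\<^sup>+t. (hatL_norm \<infinity> (u t))\<^sup>2 \<partial>restrict_space lebesgue {0<..}) < \<infinity>"
    using assms(1) unfolding time_L2_def Lq_norm_def by (simp add: ennpow_2)
  then have "(\<integral>\<^sup>+t. (hatL_norm \<infinity> (u t))\<^sup>2 * indicator {0<..} t \<partial>lborel) < \<infinity>"
    by (subst (asm) nn_integral_restrict_space) (auto simp: nn_integral_completion)
  also have "(\<integral>\<^sup>+t. (hatL_norm \<infinity> (u t))\<^sup>2 * indicator {0<..} t \<partial>lborel) = (\<integral>\<^sup>+t. (\<integral>\<^sup>+\<xi>. ennreal (norm (U (t, \<xi>))) \<partial>lborel)\<^sup>2 \<partial>lborel)"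
  proof (rule nn_integral_cong_AE, use AE in eventually_elim)
    case (elim t)
    show ?case
    proof (cases "0 < t")
      case True
      with elim have "hat_class (u t)" and ae: "AE \<xi> in lborel. vhat (u t) \<xi> = U (t, \<xi>)" by auto
      have "(\<integral>\<^sup>+\<xi>. ennreal (norm (vhat (u t) \<xi>)) \<partial>lborel) = (\<integral>\<^sup>+\<xi>. ennreal (norm (U (t, \<xi>))) \<partial>lborel)"
        by (rule nn_integral_cong_AE, use ae in eventually_elim) simp
      then show ?thesis using True hatL_norm_infinity[OF \<open>hat_class (u t)\<close>] by simp
    qed (simp add: past)
  qed
  finally show ?thesis .
qed

section \<open>The mild formulation at fixed frequency\<close>

text \<open>By Tonelli and translation invariance.\<close>

lemma nn_integral_self_conv:
  fixes V :: "real \<times> 'a::euclidean_space \<Rightarrow> ennreal"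
  assumes [measurable]: "V \<in> borel_measurable borel"
  shows "(\<integral>\<^sup>+\<xi>. self_conv V \<tau> \<xi> \<partial>lborel) = (\<integral>\<^sup>+\<eta>. V (\<tau>, \<eta>) \<partial>lborel)\<^sup>2"
proof -
  have "(\<integral>\<^sup>+\<xi>. self_conv V \<tau> \<xi> \<partial>lborel) = (\<integral>\<^sup>+\<eta>. \<integral>\<^sup>+\<xi>. V (\<tau>, \<eta>) * V (\<tau>, \<xi> - \<eta>) \<partial>lborel \<partial>lborel)"
    unfolding self_conv_def by (rule lborel_pair.Fubini') measurable
  also have "\<dots> = (\<integral>\<^sup>+\<eta>. V (\<tau>, \<eta>) * (\<integral>\<^sup>+\<xi>. V (\<tau>, \<xi>) \<partial>lborel) \<partial>lborel)"
  proof (intro nn_integral_cong)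
    fix \<eta>
    have "(\<integral>\<^sup>+\<xi>. V (\<tau>, \<xi> - \<eta>) \<partial>lborel) = (\<integral>\<^sup>+\<xi>. V (\<tau>, \<xi>) \<partial>lborel)"
      by (subst lborel_nn_integral_affine[of "\<lambda>\<xi>. V (\<tau>, \<xi> - \<eta>)" 1 \<eta>]) auto
    then show "(\<integral>\<^sup>+\<xi>. V (\<tau>, \<eta>) * V (\<tau>, \<xi> - \<eta>) \<partial>lborel) = V (\<tau>, \<eta>) * (\<integral>\<^sup>+\<xi>. V (\<tau>, \<xi>) \<partial>lborel)"
      by (simp add: nn_integral_cmult)
  qed
  also have "\<dots> = (\<integral>\<^sup>+\<eta>. V (\<tau>, \<eta>) \<partial>lborel)\<^sup>2"
    by (simp add: nn_integral_multc power2_eq_square)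
  finally show ?thesis .
qed

text \<open>The Fourier transform of component \<open>i\<close> of \<open>\<P>\<^sub>\<sigma> div (u \<otimes> u)(\<tau>)\<close> when \<open>U (\<tau>, \<cdot>)\<close> is that of
  \<open>u \<tau>\<close>.\<close>

definition nonlin :: "(real \<times> (real^'d::finite) \<Rightarrow> complex^'d) \<Rightarrow> 'd \<Rightarrow> real \<Rightarrow> real^'d \<Rightarrow> complex" where
  "nonlin U i \<tau> \<xi> = (\<Sum>l\<in>UNIV. of_real (leray_symbol \<xi> $ i $ l) *
      (\<Sum>m\<in>UNIV. \<i> * of_real (\<xi> $ m) * (of_real (fourier_const TYPE('d)) *
         conv (\<lambda>\<eta>. U (\<tau>, \<eta>) $ l) (\<lambda>\<eta>. U (\<tau>, \<eta>) $ m) \<xi>)))"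

lemma nonlin_measurable:
  fixes U :: "real \<times> (real^'d::finite) \<Rightarrow> complex^'d"
  assumes [measurable]: "U \<in> borel_measurable borel"
  shows "(\<lambda>z. nonlin U i (fst z) (snd z)) \<in> borel_measurable (borel \<Otimes>\<^sub>M borel)"
proof -
  have c: "(\<lambda>z. conv (\<lambda>\<eta>. U (fst z, \<eta>) $ l) (\<lambda>\<eta>. U (fst z, \<eta>) $ m) (snd z)) \<in> borel_measurable (borel \<Otimes>\<^sub>M borel)" for l m
    unfolding conv_def by measurable
  have p: "(\<lambda>z::real \<times> (real^'d). complex_of_real (leray_symbol (snd z) $ i $ l)) \<in> borel_measurable (borel \<Otimes>\<^sub>M borel)" for l
  proof -
    have "(\<lambda>z::real \<times> (real^'d). leray_symbol (snd z) $ i $ l) \<in> borel_measurable (borel \<Otimes>\<^sub>M borel)"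
      by (rule measurable_compose[OF measurable_snd leray_symbol_measurable])
    then show ?thesis by measurable
  qed
  have x: "(\<lambda>z::real \<times> (real^'d). complex_of_real (snd z $ m)) \<in> borel_measurable (borel \<Otimes>\<^sub>M borel)" for m
    by measurable
  show ?thesis unfolding nonlin_def
    by (intro borel_measurable_sum borel_measurable_times c p x borel_measurable_const)
qed

lemma norm_component_le: "norm ((x::complex^'d::finite) $ i) \<le> norm x"
  unfolding norm_vec_def by (rule member_le_L2_set) auto

lemma norm_nonlin:
  fixes U :: "real \<times> (real^'d::finite) \<Rightarrow> complex^'d"
  assumes [measurable]: "U \<in> borel_measurable borel"
  shows "ennreal (norm (nonlin U i \<tau> \<xi>)) \<le> ennreal (2 * (real CARD('d))\<^sup>2 * fourier_const TYPE('d) * norm \<xi>) * self_conv (\<lambda>z. ennreal (norm (U z))) \<tau> \<xi>"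
proof (cases "self_conv (\<lambda>z. ennreal (norm (U z))) \<tau> \<xi>")
  case (real q)
  let ?c = "fourier_const TYPE('d)"
  have cb: "norm (conv (\<lambda>\<eta>. U (\<tau>, \<eta>) $ l) (\<lambda>\<eta>. U (\<tau>, \<eta>) $ m) \<xi>) \<le> q" for l m
  proof -
    have "(\<integral>\<^sup>+\<eta>. ennreal (norm (U (\<tau>, \<eta>) $ l * U (\<tau>, \<xi> - \<eta>) $ m)) \<partial>lborel) \<le> self_conv (\<lambda>z. ennreal (norm (U z))) \<tau> \<xi>"
      unfolding self_conv_def
      by (intro nn_integral_mono) (auto simp: norm_mult ennreal_mult[symmetric] intro!: ennreal_leI mult_mono norm_component_le)
    then have le: "(\<integral>\<^sup>+\<eta>. ennreal (norm (U (\<tau>, \<eta>) $ l * U (\<tau>, \<xi> - \<eta>) $ m)) \<partial>lborel) \<le> ennreal q" using real by simp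
    have int: "integrable lborel (\<lambda>\<eta>. U (\<tau>, \<eta>) $ l * U (\<tau>, \<xi> - \<eta>) $ m)"
      by (rule integrableI_bounded) (use le in \<open>auto intro: le_less_trans\<close>)
    have "ennreal (norm (conv (\<lambda>\<eta>. U (\<tau>, \<eta>) $ l) (\<lambda>\<eta>. U (\<tau>, \<eta>) $ m) \<xi>)) \<le> ennreal q"
      unfolding conv_def using integral_norm_bound_ennreal[OF int] le by (rule order_trans)
    then show ?thesis using real by simp
  qed
  have "norm (nonlin U i \<tau> \<xi>) \<le> (\<Sum>l\<in>(UNIV::'d set). 2 * (\<Sum>m\<in>(UNIV::'d set). norm \<xi> * (?c * q)))"
    unfolding nonlin_def
  proof (intro sum_norm_le)
    fix l :: 'd
    have "norm (\<Sum>m\<in>UNIV. \<i> * complex_of_real (\<xi> $ m) * (complex_of_real ?c * conv (\<lambda>\<eta>. U (\<tau>, \<eta>) $ l) (\<lambda>\<eta>. U (\<tau>, \<eta>) $ m) \<xi>)) \<le> (\<Sum>m\<in>(UNIV::'d set). norm \<xi> * (?c * q))"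
    proof (intro sum_norm_le)
      fix m :: 'd
      have "norm (\<i> * complex_of_real (\<xi> $ m) * (complex_of_real ?c * conv (\<lambda>\<eta>. U (\<tau>, \<eta>) $ l) (\<lambda>\<eta>. U (\<tau>, \<eta>) $ m) \<xi>))
        = \<bar>\<xi> $ m\<bar> * (?c * norm (conv (\<lambda>\<eta>. U (\<tau>, \<eta>) $ l) (\<lambda>\<eta>. U (\<tau>, \<eta>) $ m) \<xi>))"
        by (simp add: norm_mult)
      also have "\<dots> \<le> norm \<xi> * (?c * q)"
        by (intro mult_mono cb component_le_norm_cart mult_left_mono) auto
      finally show "norm (\<i> * complex_of_real (\<xi> $ m) * (complex_of_real ?c * conv (\<lambda>\<eta>. U (\<tau>, \<eta>) $ l) (\<lambda>\<eta>. U (\<tau>, \<eta>) $ m) \<xi>)) \<le> norm \<xi> * (?c * q)" .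
    qed
    then show "norm (complex_of_real (leray_symbol \<xi> $ i $ l) * (\<Sum>m\<in>UNIV. \<i> * complex_of_real (\<xi> $ m) * (complex_of_real ?c * conv (\<lambda>\<eta>. U (\<tau>, \<eta>) $ l) (\<lambda>\<eta>. U (\<tau>, \<eta>) $ m) \<xi>)))
       \<le> 2 * (\<Sum>m\<in>(UNIV::'d set). norm \<xi> * (?c * q))"
      unfolding norm_mult norm_of_real using leray_symbol_bound[of \<xi> i l] by (intro mult_mono) auto
  qed
  also have "\<dots> = 2 * (real CARD('d))\<^sup>2 * ?c * norm \<xi> * q" by (simp add: power2_eq_square)
  finally have "ennreal (norm (nonlin U i \<tau> \<xi>)) \<le> ennreal (2 * (real CARD('d))\<^sup>2 * ?c * norm \<xi> * q)" by (rule ennreal_leI)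
  then show ?thesis using real by (simp add: ennreal_mult)
next
  case top
  show ?thesis
  proof (cases "\<xi> = 0")
    case True then show ?thesis by (simp add: nonlin_def)
  next
    case False
    then have "2 * (real CARD('d))\<^sup>2 * fourier_const TYPE('d) * norm \<xi> > 0" by simp
    then show ?thesis using top False by (simp add: ennreal_mult_top)
  qed
qed

lemma norm_le_sum_components: "norm (x::complex^'d::finite) \<le> (\<Sum>i\<in>UNIV. norm (x $ i))"
  unfolding norm_vec_def by (rule L2_set_le_sum) auto

lemma inv_fourier_dist_fourier:
  "test_function f \<Longrightarrow> inv_fourier_dist g (fourier f) = (LINT \<xi>|lborel. g \<xi> * f \<xi>)"
  by (simp add: inv_fourier_dist_def inv_fourier_fourier)

text \<open>Testing the mild formulation against \<open>fourier f\<close> turns every operator into a multiplication on the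
  Fourier side. The time integral, which exists after pairing only, is interchanged with the
  frequency integral: on the bounded support of \<open>f\<close> the double integral is dominated by the
  energy. Comparing with the definition of the transform gives the formula at almost every
  frequency, at every positive time. The field \<open>V\<close> is the modulus of the jointly measurable
  representative, so it agrees with \<open>\<bar>vhat (u t)\<bar>\<close> at almost every time.\<close>

lemma mild_solution_fourier:
  fixes \<phi> :: "real^'d::finite \<Rightarrow> real" and u0 :: "('d dist)^'d" and u :: "real \<Rightarrow> ('d dist)^'d"
  assumes lp: "littlewood_paley \<phi>" and \<mu>: "0 < \<mu>" and u0: "hat_class u0" and mild: "global_mild_solution \<mu> u0 u"
  obtains V :: "real \<times> (real^'d) \<Rightarrow> ennreal" and B :: "real \<Rightarrow> real^'d \<Rightarrow> complex^'d" and K :: real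
  where "V \<in> borel_measurable borel" "\<And>t \<xi>. t \<le> 0 \<Longrightarrow> V (t, \<xi>) = 0"
    "(\<integral>\<^sup>+t. (\<integral>\<^sup>+\<xi>. V (t, \<xi>) \<partial>lborel)\<^sup>2 \<partial>lborel) < \<infinity>" "0 \<le> K"
    "\<And>t. 0 < t \<Longrightarrow> hat_class (u t)"
    "\<And>t. 0 < t \<Longrightarrow> AE \<xi> in lborel. vhat (u t) \<xi> = exp (- (\<mu> * t * (norm \<xi>)\<^sup>2)) *\<^sub>R vhat u0 \<xi> - B t \<xi>"
    "\<And>t \<xi>. 0 < t \<Longrightarrow> ennreal (norm (B t \<xi>)) \<le> ennreal (K * norm \<xi>) * (\<integral>\<^sup>+\<tau>. heat_factor \<mu> t \<tau> (norm \<xi>) * self_conv V \<tau> \<xi> \<partial>lborel)"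
    "AE t in lborel. 0 < t \<longrightarrow> (AE \<xi> in lborel. V (t, \<xi>) = ennreal (norm (vhat (u t) \<xi>)))"
proof -
  have L2: "time_L2 \<infinity> u" using mild unfolding global_mild_solution_def by blast
  then have sm: "strongly_measurable \<infinity> u" unfolding time_L2_def by blast
  obtain U :: "real \<times> (real^'d) \<Rightarrow> complex^'d" where U [measurable]: "U \<in> borel_measurable borel" and past: "\<And>t \<xi>. t \<le> 0 \<Longrightarrow> U (t, \<xi>) = 0"
    and rep: "AE t in lborel. 0 < t \<longrightarrow> hat_class (u t) \<and> hatL_norm \<infinity> (u t) < \<infinity> \<and> (AE \<xi> in lborel. vhat (u t) \<xi> = U (t, \<xi>))"
    using jointly_measurable_representative[OF lp sm] by blast
  have energy: "(\<integral>\<^sup>+t. (\<integral>\<^sup>+\<xi>. ennreal (norm (U (t, \<xi>))) \<partial>lborel)\<^sup>2 \<partial>lborel) < \<infinity>"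
    by (rule time_L2_energy[OF L2 past rep])
  define V where "V = (\<lambda>z. ennreal (norm (U z)))"
  have V_meas [measurable]: "V \<in> borel_measurable borel" unfolding V_def by measurable
  define K where "K = 2 * (real CARD('d))\<^sup>2 * fourier_const TYPE('d)"
  have K: "0 \<le> K" by (simp add: K_def)
  have nl: "ennreal (norm (nonlin U i \<tau> \<xi>)) \<le> ennreal (K * norm \<xi>) * self_conv V \<tau> \<xi>" for i \<tau> \<xi>
    using norm_nonlin[OF U, of i \<tau> \<xi>] unfolding V_def K_def .
  have nonlin_m [measurable]: "(\<lambda>z. nonlin U i (fst z) (snd z)) \<in> borel_measurable (borel \<Otimes>\<^sub>M borel)" for i
    by (rule nonlin_measurable[OF U])
  define H where "H t \<tau> \<xi> = (if 0 < \<tau> \<and> \<tau> < t then complex_of_real (exp (- (\<mu> * (t - \<tau>) * (norm (\<xi>::real^'d))\<^sup>2))) else 0)" for t \<tau> \<xi>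
  have H_meas [measurable]: "(\<lambda>z. H t (fst z) (snd z)) \<in> borel_measurable (borel \<Otimes>\<^sub>M borel)" for t
    unfolding H_def by measurable
  have H_le: "ennreal (norm (H t \<tau> \<xi>)) \<le> heat_factor \<mu> t \<tau> (norm \<xi>)" for t \<tau> \<xi>
    by (simp add: H_def heat_factor_def)
  have hf_le: "heat_factor \<mu> t \<tau> r \<le> 1" for t \<tau> r
    using \<mu> by (simp add: heat_factor_def)
  have HN_le: "ennreal (norm (H t \<tau> \<xi> * nonlin U i \<tau> \<xi>)) \<le> ennreal (K * norm \<xi>) * (heat_factor \<mu> t \<tau> (norm \<xi>) * self_conv V \<tau> \<xi>)" for t \<tau> \<xi> i
  proof -
    have "ennreal (norm (H t \<tau> \<xi> * nonlin U i \<tau> \<xi>)) = ennreal (norm (H t \<tau> \<xi>)) * ennreal (norm (nonlin U i \<tau> \<xi>))"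
      by (simp add: norm_mult ennreal_mult)
    also have "\<dots> \<le> heat_factor \<mu> t \<tau> (norm \<xi>) * (ennreal (K * norm \<xi>) * self_conv V \<tau> \<xi>)"
      by (intro mult_mono H_le nl) auto
    finally show ?thesis by (simp only: mult.left_commute)
  qed
  define b where "b t i \<xi> = (LINT \<tau>|lborel. H t \<tau> \<xi> * nonlin U i \<tau> \<xi>)" for t i \<xi>
  define B where "B t \<xi> = (\<chi> i. b t i \<xi>)" for t \<xi>
  have b_bound: "ennreal (norm (b t i \<xi>)) \<le> ennreal (K * norm \<xi>) * (\<integral>\<^sup>+\<tau>. heat_factor \<mu> t \<tau> (norm \<xi>) * self_conv V \<tau> \<xi> \<partial>lborel)" for t i \<xi>
  proof (cases "integrable lborel (\<lambda>\<tau>. H t \<tau> \<xi> * nonlin U i \<tau> \<xi>)")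
    case True
    have "ennreal (norm (b t i \<xi>)) \<le> (\<integral>\<^sup>+\<tau>. ennreal (norm (H t \<tau> \<xi> * nonlin U i \<tau> \<xi>)) \<partial>lborel)"
      unfolding b_def by (rule integral_norm_bound_ennreal[OF True])
    also have "\<dots> \<le> (\<integral>\<^sup>+\<tau>. ennreal (K * norm \<xi>) * (heat_factor \<mu> t \<tau> (norm \<xi>) * self_conv V \<tau> \<xi>) \<partial>lborel)"
      by (intro nn_integral_mono HN_le)
    finally show ?thesis by (simp add: nn_integral_cmult)
  qed (simp add: b_def not_integrable_integral_eq)
  have B_bound: "ennreal (norm (B t \<xi>)) \<le> ennreal (real CARD('d) * K * norm \<xi>) * (\<integral>\<^sup>+\<tau>. heat_factor \<mu> t \<tau> (norm \<xi>) * self_conv V \<tau> \<xi> \<partial>lborel)" for t \<xi>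
  proof -
    let ?I = "\<integral>\<^sup>+\<tau>. heat_factor \<mu> t \<tau> (norm \<xi>) * self_conv V \<tau> \<xi> \<partial>lborel"
    have "ennreal (norm (B t \<xi>)) \<le> ennreal (\<Sum>i\<in>UNIV. norm (B t \<xi> $ i))" by (intro ennreal_leI norm_le_sum_components)
    also have "\<dots> = (\<Sum>i\<in>(UNIV::'d set). ennreal (norm (b t i \<xi>)))" by (simp add: B_def sum_ennreal)
    also have "\<dots> \<le> (\<Sum>i\<in>(UNIV::'d set). ennreal (K * norm \<xi>) * ?I)" by (intro sum_mono b_bound)
    also have "\<dots> = ennreal (real CARD('d)) * (ennreal (K * norm \<xi>) * ?I)" by (simp add: ennreal_of_nat_eq_real_of_nat)
    also have "\<dots> = ennreal (real CARD('d) * K * norm \<xi>) * ?I" using K by (simp add: ennreal_mult mult.assoc)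
    finally show ?thesis .
  qed
  \<comment> \<open>On a bounded frequency set the double integral is controlled by the energy.\<close>
  have int: "integrable (lborel \<Otimes>\<^sub>M lborel) (\<lambda>(\<tau>, \<xi>). H t \<tau> \<xi> * nonlin U i \<tau> \<xi> * f \<xi>)"
    if [measurable]: "f \<in> borel_measurable borel" and f: "\<And>\<xi>. norm (f \<xi>) \<le> M" "\<And>\<xi>. norm \<xi> > R \<Longrightarrow> f \<xi> = 0" for t i f M R
  proof (rule integrableI_bounded)
    have M: "0 \<le> M" using f(1)[of 0] norm_ge_zero order_trans by blast
    have "(\<lambda>z. H t (fst z) (snd z) * nonlin U i (fst z) (snd z) * f (snd z)) \<in> borel_measurable (borel \<Otimes>\<^sub>M borel)"
      by measurable
    then show m: "(\<lambda>(\<tau>, \<xi>). H t \<tau> \<xi> * nonlin U i \<tau> \<xi> * f \<xi>) \<in> borel_measurable (lborel \<Otimes>\<^sub>M lborel)"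
      by (simp add: split_beta')
    have "(\<integral>\<^sup>+z. ennreal (norm (case z of (\<tau>, \<xi>) \<Rightarrow> H t \<tau> \<xi> * nonlin U i \<tau> \<xi> * f \<xi>)) \<partial>(lborel \<Otimes>\<^sub>M lborel))
      = (\<integral>\<^sup>+\<tau>. \<integral>\<^sup>+\<xi>. ennreal (norm (H t \<tau> \<xi> * nonlin U i \<tau> \<xi> * f \<xi>)) \<partial>lborel \<partial>lborel)"
      using m by (subst lborel.nn_integral_fst[symmetric]) auto
    also have "\<dots> \<le> (\<integral>\<^sup>+\<tau>. \<integral>\<^sup>+\<xi>. ennreal (K * \<bar>R\<bar> * M) * self_conv V \<tau> \<xi> \<partial>lborel \<partial>lborel)"
    proof (intro nn_integral_mono)
      fix \<tau> \<xi>
      show "ennreal (norm (H t \<tau> \<xi> * nonlin U i \<tau> \<xi> * f \<xi>)) \<le> ennreal (K * \<bar>R\<bar> * M) * self_conv V \<tau> \<xi>"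
      proof (cases "norm \<xi> \<le> R")
        case True
        have "ennreal (norm (H t \<tau> \<xi> * nonlin U i \<tau> \<xi> * f \<xi>)) = ennreal (norm (H t \<tau> \<xi> * nonlin U i \<tau> \<xi>)) * ennreal (norm (f \<xi>))"
          by (simp add: norm_mult ennreal_mult)
        also have "\<dots> \<le> (ennreal (K * norm \<xi>) * (heat_factor \<mu> t \<tau> (norm \<xi>) * self_conv V \<tau> \<xi>)) * ennreal M"
          by (intro mult_mono HN_le ennreal_leI f) auto
        also have "\<dots> \<le> (ennreal (K * \<bar>R\<bar>) * (1 * self_conv V \<tau> \<xi>)) * ennreal M"
          using True K by (intro mult_right_mono mult_mono ennreal_leI mult_left_mono hf_le) auto
        also have "\<dots> = ennreal (K * \<bar>R\<bar> * M) * self_conv V \<tau> \<xi>"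
          using K M by (simp add: ennreal_mult mult_ac)
        finally show ?thesis .
      qed (use f in simp)
    qed
    also have "\<dots> = ennreal (K * \<bar>R\<bar> * M) * (\<integral>\<^sup>+\<tau>. (\<integral>\<^sup>+\<xi>. V (\<tau>, \<xi>) \<partial>lborel)\<^sup>2 \<partial>lborel)"
      by (simp add: nn_integral_cmult nn_integral_self_conv)
    also have "\<dots> < \<infinity>" using energy unfolding V_def by (simp add: ennreal_mult_less_top)
    finally show "(\<integral>\<^sup>+z. ennreal (norm (case z of (\<tau>, \<xi>) \<Rightarrow> H t \<tau> \<xi> * nonlin U i \<tau> \<xi> * f \<xi>)) \<partial>(lborel \<Otimes>\<^sub>M lborel)) < \<infinity>" .
  qed
  have b_li: "locally_integrable (b t i)" for t i
  proof (rule locally_integrableI)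
    fix R :: real
    let ?f = "indicator (cball 0 R) :: real^'d \<Rightarrow> complex"
    have "integrable (lborel \<Otimes>\<^sub>M lborel) (\<lambda>(\<tau>, \<xi>). H t \<tau> \<xi> * nonlin U i \<tau> \<xi> * ?f \<xi>)"
      by (rule int[of _ 1 R]) (auto simp: indicator_def)
    then have "integrable lborel (\<lambda>\<xi>. LINT \<tau>|lborel. H t \<tau> \<xi> * nonlin U i \<tau> \<xi> * ?f \<xi>)"
      by (rule lborel_pair.integrable_snd)
    then show "integrable lborel (\<lambda>\<xi>. indicator (cball 0 R) \<xi> *\<^sub>R b t i \<xi>)"
      by (rule back_subst[of "integrable lborel"]) (auto simp: b_def indicator_def fun_eq_iff)
  qed
  have hat_nl: "AE \<tau> in lborel. 0 < \<tau> \<longrightarrow> (\<forall>i. has_hat (leray_proj (div_tensor (tensor_square (u \<tau>))) $ i) (nonlin U i \<tau>))"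
    using rep
  proof eventually_elim
    case (elim \<tau>)
    show ?case
    proof (intro impI allI)
      fix i assume "0 < \<tau>"
      with elim have cl: "hat_class (u \<tau>)" and fin: "hatL_norm \<infinity> (u \<tau>) < \<infinity>" and ae: "AE \<xi> in lborel. vhat (u \<tau>) \<xi> = U (\<tau>, \<xi>)" by auto
      have Um: "has_hat (u \<tau> $ m) (\<lambda>\<xi>. U (\<tau>, \<xi>) $ m)" for m
      proof (rule has_hat_cong_AE[OF hat_class_has_hat[OF cl]])
        show "AE \<xi> in lborel. hat (u \<tau> $ m) \<xi> = U (\<tau>, \<xi>) $ m"
          using ae by eventually_elim (auto simp: vhat_def vec_eq_iff)
      qed measurable
      have "(\<integral>\<^sup>+\<xi>. ennreal (norm (U (\<tau>, \<xi>))) \<partial>lborel) = hatL_norm \<infinity> (u \<tau>)"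
        unfolding hatL_norm_infinity[OF cl] by (rule nn_integral_cong_AE, use ae in eventually_elim) simp
      then have fin': "(\<integral>\<^sup>+\<xi>. ennreal (norm (U (\<tau>, \<xi>))) \<partial>lborel) < \<infinity>" using fin by simp
      have Ui: "integrable lborel (\<lambda>\<xi>. U (\<tau>, \<xi>) $ m)" for m
      proof (rule integrableI_bounded)
        have "(\<integral>\<^sup>+\<xi>. ennreal (norm (U (\<tau>, \<xi>) $ m)) \<partial>lborel) \<le> (\<integral>\<^sup>+\<xi>. ennreal (norm (U (\<tau>, \<xi>))) \<partial>lborel)"
          by (intro nn_integral_mono ennreal_leI norm_component_le)
        then show "(\<integral>\<^sup>+\<xi>. ennreal (norm (U (\<tau>, \<xi>) $ m)) \<partial>lborel) < \<infinity>" using fin' by (rule le_less_trans)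
      qed measurable
      show "has_hat (leray_proj (div_tensor (tensor_square (u \<tau>))) $ i) (nonlin U i \<tau>)"
        using hat_nonlinearity[OF lp Um Ui, of i] unfolding nonlin_def[abs_def] .
    qed
  qed
  have hat_u: "has_hat (u t $ i) (\<lambda>\<xi>. complex_of_real (exp (- (\<mu> * t * (norm \<xi>)\<^sup>2))) * hat (u0 $ i) \<xi> - b t i \<xi>)" if t: "0 < t" for t i
    unfolding has_hat_def
  proof (intro conjI allI impI)
    have m: "(\<lambda>\<xi>::real^'d. complex_of_real (exp (- (\<mu> * t * (norm \<xi>)\<^sup>2)))) \<in> borel_measurable borel" by measurable
    have bd: "\<exists>B. \<forall>\<xi>::real^'d. norm \<xi> \<le> R \<longrightarrow> norm (complex_of_real (exp (- (\<mu> * t * (norm \<xi>)\<^sup>2)))) \<le> B" for R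
      using \<mu> t by (intro exI[of _ 1]) simp
    have li: "locally_integrable (\<lambda>\<xi>. complex_of_real (exp (- (\<mu> * t * (norm \<xi>)\<^sup>2))) * hat (u0 $ i) \<xi>)"
      by (intro locally_integrable_mult has_hat_locally_integrable[OF hat_class_has_hat[OF u0]] m bd)
    show "locally_integrable (\<lambda>\<xi>. complex_of_real (exp (- (\<mu> * t * (norm \<xi>)\<^sup>2))) * hat (u0 $ i) \<xi> - b t i \<xi>)"
      by (intro locally_integrable_add_diff li b_li)
    fix f :: "real^'d \<Rightarrow> complex" assume f: "test_function f"
    let ?G = "\<lambda>\<tau>. (heat \<mu> (t - \<tau>) (leray_proj (div_tensor (tensor_square (u \<tau>)))) $ i) (fourier f)"
    have mild_t: "set_integrable lebesgue {0<..<t} ?G"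
      "(u t $ i) (fourier f) = (heat \<mu> t u0 $ i) (fourier f) - (LINT \<tau>:{0<..<t}|lebesgue. ?G \<tau>)"
      using mild t schwartz_fourier[OF f] unfolding global_mild_solution_def by blast+
    obtain M where M: "\<And>\<xi>. norm (f \<xi>) \<le> M" using test_function_bounded[OF f] by blast
    obtain R where R: "\<And>\<xi>. norm \<xi> \<ge> R \<Longrightarrow> f \<xi> = 0" using test_function_support[OF f] by blast
    have [measurable]: "f \<in> borel_measurable borel" using test_function_borel[OF f] .
    have fub: "integrable (lborel \<Otimes>\<^sub>M lborel) (\<lambda>(\<tau>, \<xi>). H t \<tau> \<xi> * nonlin U i \<tau> \<xi> * f \<xi>)"
      by (rule int[of f M R]) (use M R in auto)
    define \<Phi> where "\<Phi> \<tau> = (LINT \<xi>|lborel. H t \<tau> \<xi> * nonlin U i \<tau> \<xi> * f \<xi>)" for \<tau>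
    have \<Phi>_int: "integrable lborel \<Phi>" unfolding \<Phi>_def[abs_def] by (rule lborel_pair.integrable_fst[OF fub])
    have \<Phi>_meas: "\<Phi> \<in> borel_measurable lborel" using borel_measurable_integrable[OF \<Phi>_int] .
    have eq: "AE \<tau> in lborel. indicator {0<..<t} \<tau> *\<^sub>R ?G \<tau> = \<Phi> \<tau>"
      using hat_nl
    proof eventually_elim
      case (elim \<tau>)
      show ?case
      proof (cases "0 < \<tau> \<and> \<tau> < t")
        case True
        let ?X = "leray_proj (div_tensor (tensor_square (u \<tau>))) $ i"
        have X: "has_hat ?X (nonlin U i \<tau>)" using elim True by blast
        have meas: "hat ?X \<in> borel_measurable borel" "nonlin U i \<tau> \<in> borel_measurable borel"
          using has_hat_measurable[OF has_hat_hat[OF X]] has_hat_measurable[OF X] .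
        note [measurable] = meas
        have "?G \<tau> = (LINT \<xi>|lborel. complex_of_real (exp (- (\<mu> * (t - \<tau>) * (norm \<xi>)\<^sup>2))) * hat ?X \<xi> * f \<xi>)"
          unfolding heat_def fourier_mult_def vec_lambda_beta by (rule inv_fourier_dist_fourier[OF f])
        also have "\<dots> = (LINT \<xi>|lborel. complex_of_real (exp (- (\<mu> * (t - \<tau>) * (norm \<xi>)\<^sup>2))) * nonlin U i \<tau> \<xi> * f \<xi>)"
          by (intro integral_cong_AE) (use hat_AE[OF lp X] in \<open>auto elim: eventually_mono\<close>)
        also have "\<dots> = \<Phi> \<tau>" using True by (simp add: \<Phi>_def H_def)
        finally show ?thesis using True by simp
      next
        case False
        then have "H t \<tau> \<xi> = 0" for \<xi> by (auto simp: H_def)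
        then show ?thesis using False by (simp add: \<Phi>_def)
      qed
    qed
    have "(LINT \<tau>:{0<..<t}|lebesgue. ?G \<tau>) = (LINT \<tau>|lebesgue. \<Phi> \<tau>)"
      unfolding set_lebesgue_integral_def
    proof (rule integral_cong_AE)
      show "(\<lambda>\<tau>. indicator {0<..<t} \<tau> *\<^sub>R ?G \<tau>) \<in> borel_measurable lebesgue"
        using mild_t(1) unfolding set_integrable_def by (rule borel_measurable_integrable)
      show "\<Phi> \<in> borel_measurable lebesgue" by (rule measurable_completion[OF \<Phi>_meas])
      show "AE \<tau> in lebesgue. indicator {0<..<t} \<tau> *\<^sub>R ?G \<tau> = \<Phi> \<tau>" by (rule AE_completion[OF eq])
    qed
    also have "\<dots> = (LINT \<tau>|lborel. \<Phi> \<tau>)" by (rule integral_completion[OF \<Phi>_meas])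
    also have "\<dots> = (LINT \<xi>|lborel. LINT \<tau>|lborel. H t \<tau> \<xi> * nonlin U i \<tau> \<xi> * f \<xi>)"
      unfolding \<Phi>_def using lborel_pair.Fubini_integral[OF fub] by simp
    also have "\<dots> = (LINT \<xi>|lborel. b t i \<xi> * f \<xi>)" by (simp add: b_def)
    finally have nlin: "(LINT \<tau>:{0<..<t}|lebesgue. ?G \<tau>) = (LINT \<xi>|lborel. b t i \<xi> * f \<xi>)" .
    have lin: "(heat \<mu> t u0 $ i) (fourier f) = (LINT \<xi>|lborel. complex_of_real (exp (- (\<mu> * t * (norm \<xi>)\<^sup>2))) * hat (u0 $ i) \<xi> * f \<xi>)"
      unfolding heat_def fourier_mult_def vec_lambda_beta by (rule inv_fourier_dist_fourier[OF f])
    show "(u t $ i) (fourier f) = (LINT \<xi>|lborel. (complex_of_real (exp (- (\<mu> * t * (norm \<xi>)\<^sup>2))) * hat (u0 $ i) \<xi> - b t i \<xi>) * f \<xi>)"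
      unfolding mild_t(2) nlin lin left_diff_distrib
      by (rule Bochner_Integration.integral_diff[symmetric]) (intro locally_integrable_test[OF _ f] li b_li)+
  qed
  show thesis
  proof (rule that[of V "real CARD('d) * K" B])
    show "V \<in> borel_measurable borel" by (rule V_meas)
    show "V (t, \<xi>) = 0" if "t \<le> 0" for t \<xi> using past[OF that] by (simp add: V_def)
    show "(\<integral>\<^sup>+t. (\<integral>\<^sup>+\<xi>. V (t, \<xi>) \<partial>lborel)\<^sup>2 \<partial>lborel) < \<infinity>" using energy unfolding V_def .
    show "0 \<le> real CARD('d) * K" using K by simp
    show cl: "hat_class (u t)" if t: "0 < t" for t
      using mild t hat_u[OF t] unfolding hat_class_def global_mild_solution_def by blast
    show "AE \<xi> in lborel. vhat (u t) \<xi> = exp (- (\<mu> * t * (norm \<xi>)\<^sup>2)) *\<^sub>R vhat u0 \<xi> - B t \<xi>" if t: "0 < t" for t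
    proof -
      have "AE \<xi> in lborel. \<forall>i\<in>UNIV. hat (u t $ i) \<xi> = complex_of_real (exp (- (\<mu> * t * (norm \<xi>)\<^sup>2))) * hat (u0 $ i) \<xi> - b t i \<xi>"
        by (rule AE_finite_allI[OF finite]) (rule hat_AE[OF lp hat_u[OF t]])
      then show ?thesis by eventually_elim (simp add: vhat_def B_def vec_eq_iff scaleR_conv_of_real[where 'a=complex])
    qed
    show "ennreal (norm (B t \<xi>)) \<le> ennreal (real CARD('d) * K * norm \<xi>) * (\<integral>\<^sup>+\<tau>. heat_factor \<mu> t \<tau> (norm \<xi>) * self_conv V \<tau> \<xi> \<partial>lborel)" if "0 < t" for t \<xi>
      by (rule B_bound)
    show "AE t in lborel. 0 < t \<longrightarrow> (AE \<xi> in lborel. V (t, \<xi>) = ennreal (norm (vhat (u t) \<xi>)))"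
      using rep by eventually_elim (auto simp: V_def elim: eventually_mono)
  qed
qed

section \<open>Asymptotics of the nonlinear part\<close>

context convolution_duhamel
begin

lemma nn_integral_N_le:
  assumes [measurable]: "S \<in> sets borel" and S: "emeasure lborel S \<le> ennreal (a\<^sup>2)" "0 \<le> a"
    and b: "(\<integral>\<^sup>+\<tau>. indicator S \<tau> * (N \<tau>)\<^sup>2 \<partial>lborel) \<le> ennreal (b\<^sup>2)" "0 \<le> b"
  shows "(\<integral>\<^sup>+\<tau>. indicator S \<tau> * N \<tau> \<partial>lborel) \<le> ennreal (a * b)"
proof (rule ennreal_le_of_square_le)
  have "(\<integral>\<^sup>+\<tau>. indicator S \<tau> * N \<tau> \<partial>lborel) = (\<integral>\<^sup>+\<tau>. indicator S \<tau> * (indicator S \<tau> * N \<tau>) \<partial>lborel)"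
    by (intro nn_integral_cong) (simp add: indicator_def)
  also have "(\<dots>)\<^sup>2 \<le> (\<integral>\<^sup>+\<tau>. (indicator S \<tau>)\<^sup>2 \<partial>lborel) * (\<integral>\<^sup>+\<tau>. (indicator S \<tau> * N \<tau>)\<^sup>2 \<partial>lborel)"
    by (rule Cauchy_Schwarz_nn_integral) measurable
  also have "(\<integral>\<^sup>+\<tau>. (indicator S \<tau>)\<^sup>2 \<partial>lborel) = (\<integral>\<^sup>+\<tau>. indicator S \<tau> \<partial>lborel)"
    by (intro nn_integral_cong) (simp add: indicator_def)
  also have "(\<integral>\<^sup>+\<tau>. (indicator S \<tau> * N \<tau>)\<^sup>2 \<partial>lborel) = (\<integral>\<^sup>+\<tau>. indicator S \<tau> * (N \<tau>)\<^sup>2 \<partial>lborel)"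
    by (intro nn_integral_cong) (simp add: indicator_def)
  also have "(\<integral>\<^sup>+\<tau>. indicator S \<tau> \<partial>lborel) * (\<integral>\<^sup>+\<tau>. indicator S \<tau> * (N \<tau>)\<^sup>2 \<partial>lborel) \<le> ennreal (a\<^sup>2) * ennreal (b\<^sup>2)"
    using S b by (intro mult_mono) auto
  finally show "(\<integral>\<^sup>+\<tau>. indicator S \<tau> * N \<tau> \<partial>lborel)\<^sup>2 \<le> ennreal (a\<^sup>2) * ennreal (b\<^sup>2)" .
qed (use S b in auto)

lemma energy_tail:
  assumes "0 < b" shows "\<exists>T>0. (\<integral>\<^sup>+\<tau>. indicator {T<..} \<tau> * (N \<tau>)\<^sup>2 \<partial>lborel) \<le> ennreal b"
proof -
  define \<nu> where "\<nu> = density lborel (\<lambda>\<tau>. (N \<tau>)\<^sup>2)"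
  have em: "emeasure \<nu> A = (\<integral>\<^sup>+\<tau>. indicator A \<tau> * (N \<tau>)\<^sup>2 \<partial>lborel)" if "A \<in> sets borel" for A
    unfolding \<nu>_def using that by (subst emeasure_density) (auto simp: mult.commute)
  have fin: "emeasure \<nu> A \<noteq> \<infinity>" if "A \<in> sets borel" for A
  proof -
    have "emeasure \<nu> A \<le> (\<integral>\<^sup>+\<tau>. (N \<tau>)\<^sup>2 \<partial>lborel)"
      unfolding em[OF that] by (intro nn_integral_mono) (simp add: indicator_def)
    also have "\<dots> < \<infinity>" using energy unfolding N_def by (rule le_less_trans) simp
    finally show ?thesis by simp
  qed
  have sets: "sets \<nu> = sets borel" by (simp add: \<nu>_def)
  have "(\<lambda>n. emeasure \<nu> {real n<..}) \<longlonglongrightarrow> emeasure \<nu> (\<Inter>n. {real n<..})"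
    by (rule Lim_emeasure_decseq) (use fin in \<open>auto simp: sets decseq_def\<close>)
  moreover have "(\<Inter>n. {real n<..}) = {}"
  proof -
    have "x \<notin> (\<Inter>n. {real n<..})" for x :: real
    proof -
      obtain n :: nat where "x \<le> real n" using real_arch_simple by blast
      then have "x \<notin> {real n<..}" by simp
      then show ?thesis by blast
    qed
    then show ?thesis by blast
  qed
  ultimately have "(\<lambda>n. emeasure \<nu> {real n<..}) \<longlonglongrightarrow> 0" by simp
  then have "\<forall>\<^sub>F n in sequentially. emeasure \<nu> {real n<..} < ennreal b \<and> 0 < n"
    using assms by (intro eventually_conj order_tendstoD(2) eventually_gt_at_top) auto
  then obtain n where "emeasure \<nu> {real n<..} < ennreal b" "0 < n" unfolding eventually_sequentially by blast
  then show ?thesis using em[of "{real n<..}"] by (intro exI[of _ "real n"]) auto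
qed

text \<open>Cauchy--Schwarz on two time ranges: times up to \<open>T0\<close> contribute \<open>O(1)\<close>, and later ones at most
  \<open>\<surd>t\<close> times the square root of a small energy tail.\<close>

lemma nn_integral_N_small:
  assumes e: "0 < e"
  shows "\<exists>T>0. \<forall>t\<ge>T. (\<integral>\<^sup>+\<tau>. (if \<tau> < t then N \<tau> else 0) \<partial>lborel) \<le> ennreal (e * sqrt t)"
proof -
  obtain T0 where T0: "0 < T0" "(\<integral>\<^sup>+\<tau>. indicator {T0<..} \<tau> * (N \<tau>)\<^sup>2 \<partial>lborel) \<le> ennreal ((e / 2)\<^sup>2)"
    using energy_tail[of "(e / 2)\<^sup>2"] e by auto
  define T where "T = max T0 ((2 * (sqrt T0 * E) / e)\<^sup>2)"
  have "(\<integral>\<^sup>+\<tau>. (if \<tau> < t then N \<tau> else 0) \<partial>lborel) \<le> ennreal (e * sqrt t)" if t: "T \<le> t" for t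
  proof -
    have t0: "T0 \<le> t" "(2 * (sqrt T0 * E) / e)\<^sup>2 \<le> t" "0 < t" using t T0 by (auto simp: T_def)
    have "(\<integral>\<^sup>+\<tau>. (if \<tau> < t then N \<tau> else 0) \<partial>lborel) \<le> (\<integral>\<^sup>+\<tau>. indicator {0<..T0} \<tau> * N \<tau> + indicator {T0<..<t} \<tau> * N \<tau> \<partial>lborel)"
    proof (rule nn_integral_mono)
      fix \<tau>
      show "(if \<tau> < t then N \<tau> else 0) \<le> indicator {0<..T0} \<tau> * N \<tau> + indicator {T0<..<t} \<tau> * N \<tau>"
        by (cases "0 < \<tau>"; cases "\<tau> \<le> T0") (auto simp: N_past)
    qed
    also have "\<dots> = (\<integral>\<^sup>+\<tau>. indicator {0<..T0} \<tau> * N \<tau> \<partial>lborel) + (\<integral>\<^sup>+\<tau>. indicator {T0<..<t} \<tau> * N \<tau> \<partial>lborel)"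
      by (rule nn_integral_add) measurable
    also have "\<dots> \<le> ennreal (sqrt T0 * E) + ennreal (sqrt t * (e / 2))"
    proof (rule add_mono; rule nn_integral_N_le)
      have "(\<integral>\<^sup>+\<tau>. indicator {0<..T0} \<tau> * (N \<tau>)\<^sup>2 \<partial>lborel) \<le> (\<integral>\<^sup>+\<tau>. (N \<tau>)\<^sup>2 \<partial>lborel)"
        by (intro nn_integral_mono) (simp add: indicator_def)
      then show "(\<integral>\<^sup>+\<tau>. indicator {0<..T0} \<tau> * (N \<tau>)\<^sup>2 \<partial>lborel) \<le> ennreal (E\<^sup>2)"
        using energy unfolding N_def by (rule order_trans)
      have "(\<integral>\<^sup>+\<tau>. indicator {T0<..<t} \<tau> * (N \<tau>)\<^sup>2 \<partial>lborel) \<le> (\<integral>\<^sup>+\<tau>. indicator {T0<..} \<tau> * (N \<tau>)\<^sup>2 \<partial>lborel)"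
        by (intro nn_integral_mono) (simp add: indicator_def)
      then show "(\<integral>\<^sup>+\<tau>. indicator {T0<..<t} \<tau> * (N \<tau>)\<^sup>2 \<partial>lborel) \<le> ennreal ((e / 2)\<^sup>2)"
        using T0(2) by (rule order_trans)
      show "emeasure lborel {T0<..<t} \<le> ennreal ((sqrt t)\<^sup>2)" using t0 T0 by (simp add: ennreal_leI)
    qed (use t0 T0 pos e in auto)
    also have "\<dots> = ennreal (sqrt T0 * E + sqrt t * (e / 2))" using T0 t0 pos e by (intro ennreal_plus[symmetric]) auto
    also have "\<dots> \<le> ennreal (e * sqrt t)"
    proof (rule ennreal_leI)
      have "2 * (sqrt T0 * E) / e \<le> sqrt t" using t0(2) real_le_rsqrt by blast
      then show "sqrt T0 * E + sqrt t * (e / 2) \<le> e * sqrt t" using e by (simp add: field_simps)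
    qed
    finally show ?thesis .
  qed
  moreover have "0 < T" using T0 by (simp add: T_def)
  ultimately show ?thesis by blast
qed

text \<open>The bound of order \<open>k + 1\<close> from \<open>decay_bound\<close> is fed back into the Duhamel integral. The factor
  \<open>\<bar>\<xi>\<bar>\<close> costs one order and returns \<open>1/\<surd>t\<close>.\<close>

lemma duhamel_term_decay:
  "\<exists>C\<ge>0. \<forall>t>0. \<forall>\<xi>. ennreal (c * norm \<xi>) * (\<integral>\<^sup>+\<tau>. heat_factor \<mu> t \<tau> (norm \<xi>) * self_conv V \<tau> \<xi> \<partial>lborel)
     \<le> ennreal (C * decay k t (norm \<xi>) / sqrt t) * (\<integral>\<^sup>+\<tau>. (if \<tau> < t then N \<tau> else 0) \<partial>lborel)"
proof -
  obtain C where C: "0 \<le> C" "AE t in lborel. 0 < t \<longrightarrow> (AE \<xi> in lborel. V (t, \<xi>) \<le> ennreal (C * decay (Suc k) t (norm \<xi>)))"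
    using decay_bound[of "Suc k"] by blast
  obtain ck where ck: "ck \<ge> 1" "\<And>t \<tau> r. 0 \<le> \<tau> \<Longrightarrow> \<tau> \<le> t \<Longrightarrow>
      exp (- (\<mu> * (t - \<tau>) * r\<^sup>2)) * decay (Suc k) \<tau> r \<le> ck * (exp (- (\<mu> / 2 * (t - \<tau>) * r\<^sup>2)) * decay (Suc k) t r)"
    using decay_transport[OF pos(1), of "Suc k"] by blast
  define A where "A = 2 * 4 ^ Suc k * C * ck"
  have A: "0 \<le> A" using C(1) ck(1) by (simp add: A_def)
  have "ennreal (c * norm \<xi>) * (\<integral>\<^sup>+\<tau>. heat_factor \<mu> t \<tau> (norm \<xi>) * self_conv V \<tau> \<xi> \<partial>lborel)
     \<le> ennreal (c * A * decay k t (norm \<xi>) / sqrt t) * (\<integral>\<^sup>+\<tau>. (if \<tau> < t then N \<tau> else 0) \<partial>lborel)" if t: "0 < t" for t \<xi>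
  proof -
    define r where "r = norm \<xi>"
    have r: "0 \<le> r" by (simp add: r_def)
    have "(\<integral>\<^sup>+\<tau>. heat_factor \<mu> t \<tau> r * self_conv V \<tau> \<xi> \<partial>lborel) \<le> (\<integral>\<^sup>+\<tau>. ennreal (A * decay (Suc k) t r) * (if \<tau> < t then N \<tau> else 0) \<partial>lborel)"
    proof (rule nn_integral_mono_AE, use C(2) in eventually_elim)
      case (elim \<tau>)
      show ?case
      proof (cases "0 < \<tau> \<and> \<tau> < t")
        case True
        with elim have "AE \<eta> in lborel. V (\<tau>, \<eta>) \<le> ennreal (C * decay (Suc k) \<tau> (norm \<eta>)) + 0" by simp
        then have "self_conv V \<tau> \<xi> \<le> ennreal (2 * 4 ^ Suc k * C * decay (Suc k) \<tau> r) * N \<tau> + 2 * (\<integral>\<^sup>+\<eta>. 0 * V (\<tau>, \<xi> - \<eta>) \<partial>lborel)"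
          unfolding self_conv_def N_def r_def using True C(1) by (intro self_convolution_decay) auto
        then have sc: "self_conv V \<tau> \<xi> \<le> ennreal (2 * 4 ^ Suc k * C * decay (Suc k) \<tau> r) * N \<tau>" by simp
        have "exp (- (\<mu> * (t - \<tau>) * r\<^sup>2)) * (2 * 4 ^ Suc k * C * decay (Suc k) \<tau> r) = (2 * 4 ^ Suc k * C) * (exp (- (\<mu> * (t - \<tau>) * r\<^sup>2)) * decay (Suc k) \<tau> r)"
          by (simp only: mult_ac)
        also have "\<dots> \<le> (2 * 4 ^ Suc k * C) * (ck * (exp (- (\<mu> / 2 * (t - \<tau>) * r\<^sup>2)) * decay (Suc k) t r))"
          using True C(1) by (intro mult_left_mono ck) auto
        also have "\<dots> \<le> (2 * 4 ^ Suc k * C) * (ck * (1 * decay (Suc k) t r))"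
          using True C(1) ck(1) pos t by (intro mult_left_mono mult_right_mono) (auto simp: decay_nonneg)
        finally have le: "exp (- (\<mu> * (t - \<tau>) * r\<^sup>2)) * (2 * 4 ^ Suc k * C * decay (Suc k) \<tau> r) \<le> A * decay (Suc k) t r"
          by (simp add: A_def mult_ac)
        have "heat_factor \<mu> t \<tau> r * self_conv V \<tau> \<xi> \<le> heat_factor \<mu> t \<tau> r * (ennreal (2 * 4 ^ Suc k * C * decay (Suc k) \<tau> r) * N \<tau>)"
          by (rule mult_left_mono[OF sc]) simp
        also have "\<dots> = (heat_factor \<mu> t \<tau> r * ennreal (2 * 4 ^ Suc k * C * decay (Suc k) \<tau> r)) * N \<tau>" by (simp only: mult.assoc)
        also have "heat_factor \<mu> t \<tau> r * ennreal (2 * 4 ^ Suc k * C * decay (Suc k) \<tau> r) = ennreal (exp (- (\<mu> * (t - \<tau>) * r\<^sup>2)) * (2 * 4 ^ Suc k * C * decay (Suc k) \<tau> r))"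
          using True C(1) by (simp add: heat_factor_def ennreal_mult decay_nonneg)
        also have "\<dots> * N \<tau> \<le> ennreal (A * decay (Suc k) t r) * N \<tau>" by (intro mult_right_mono ennreal_leI le) simp
        finally show ?thesis using True by simp
      next
        case False
        then have "heat_factor \<mu> t \<tau> r = 0 \<or> self_conv V \<tau> \<xi> = 0"
          by (auto simp: heat_factor_def self_conv_def V_past)
        then show ?thesis by auto
      qed
    qed
    also have "\<dots> = ennreal (A * decay (Suc k) t r) * (\<integral>\<^sup>+\<tau>. (if \<tau> < t then N \<tau> else 0) \<partial>lborel)"
      by (rule nn_integral_cmult) measurable
    finally have "ennreal (c * r) * (\<integral>\<^sup>+\<tau>. heat_factor \<mu> t \<tau> r * self_conv V \<tau> \<xi> \<partial>lborel)
        \<le> ennreal (c * r) * (ennreal (A * decay (Suc k) t r) * (\<integral>\<^sup>+\<tau>. (if \<tau> < t then N \<tau> else 0) \<partial>lborel))"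
      by (rule mult_left_mono) simp
    also have "\<dots> = ennreal (c * A * (r * decay (Suc k) t r)) * (\<integral>\<^sup>+\<tau>. (if \<tau> < t then N \<tau> else 0) \<partial>lborel)"
      using A pos r t by (simp add: ennreal_mult decay_nonneg mult_ac)
    also have "\<dots> \<le> ennreal (c * A * (decay k t r / sqrt t)) * (\<integral>\<^sup>+\<tau>. (if \<tau> < t then N \<tau> else 0) \<partial>lborel)"
    proof (intro mult_right_mono ennreal_leI mult_left_mono)
      \<comment> \<open>one power of the decay pays for \<open>\<surd>t \<bar>\<xi>\<bar> \<le> 1 + t \<bar>\<xi>\<bar>\<^sup>2\<close>\<close>
      have "2 * (sqrt t * r) \<le> 1 + (sqrt t * r)\<^sup>2" using sum_squares_bound[of 1 "sqrt t * r"] by simp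
      then have "sqrt t * r \<le> 1 + t * r\<^sup>2" using t r by (simp add: power_mult_distrib) (smt (verit) mult_nonneg_nonneg real_sqrt_ge_zero)
      then have le: "r \<le> (1 + t * r\<^sup>2) / sqrt t" using t by (simp add: field_simps)
      have p: "0 < 1 + t * r\<^sup>2" "0 < (1 + t * r\<^sup>2) ^ k" using t by (auto simp: add_pos_nonneg)
      have "r / ((1 + t * r\<^sup>2) * (1 + t * r\<^sup>2) ^ k) \<le> ((1 + t * r\<^sup>2) / sqrt t) / ((1 + t * r\<^sup>2) * (1 + t * r\<^sup>2) ^ k)"
        using p by (intro divide_right_mono le) auto
      also have "\<dots> = 1 / (1 + t * r\<^sup>2) ^ k / sqrt t" using p by simp
      finally show "r * decay (Suc k) t r \<le> decay k t r / sqrt t" by (simp add: decay_def)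
    qed (use A pos in auto)
    finally show ?thesis unfolding r_def by simp
  qed
  then show ?thesis using A pos by (intro exI[of _ "c * A"]) auto
qed

end

section \<open>The initial datum and the Oseen field\<close>

lemma hconj_1 [simp]: "hconj 1 = top"
  by (simp add: hconj_def)

text \<open>At a nonzero frequency only dyadic blocks \<open>j\<close> within distance \<open>1\<close> of \<open>log\<^sub>2 \<bar>\<xi>\<bar>\<close> are active, and
  they add up to the field; each of them is bounded by the norm.\<close>

lemma herz_bound:
  fixes \<phi> :: "real^'d::finite \<Rightarrow> real" and u0 :: "('d dist)^'d"
  assumes lp: "littlewood_paley \<phi>" and u0: "u0 \<in> herz_space \<phi> 0 1 \<infinity>"
  shows "\<exists>K\<ge>0. AE \<xi> in lborel. norm (vhat u0 \<xi>) \<le> K"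
proof -
  have cl: "hat_class u0" and fin: "herz_norm \<phi> 0 1 \<infinity> u0 < \<infinity>" using u0 by (auto simp: herz_space_def)
  let ?h = "\<lambda>j::int. ennreal (2 powr (0 * of_int j)) * hatL_norm 1 (dyadic_block \<phi> j u0)"
  have "herz_norm \<phi> 0 1 \<infinity> u0 = esssup (count_space UNIV) ?h" by (simp add: herz_norm_def Lq_norm_def)
  moreover have "AE j in count_space UNIV. ?h j \<le> esssup (count_space UNIV) ?h" by (rule esssup_AE)
  ultimately have le: "hatL_norm 1 (dyadic_block \<phi> j u0) \<le> herz_norm \<phi> 0 1 \<infinity> u0" for j
    by (simp add: AE_count_space)
  obtain S where S: "0 \<le> S" "herz_norm \<phi> 0 1 \<infinity> u0 = ennreal S" using fin by (cases "herz_norm \<phi> 0 1 \<infinity> u0") auto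
  have [measurable]: "\<phi> \<in> borel_measurable borel"
    using smooth_fun_continuous[OF littlewood_paleyD(1)[OF lp]] by (rule borel_measurable_continuous_onI)
  obtain M0 where M: "\<And>x. norm (complex_of_real (\<phi> (1 *\<^sub>R (x - 0)))) \<le> M0"
    using test_function_bounded[OF test_function_bump[OF lp, of 1 0]] by auto
  have block: "AE \<xi> in lborel. \<phi> ((2 powi (- j)) *\<^sub>R \<xi>) * norm (vhat u0 \<xi>) \<le> S" for j
  proof -
    have "hatL_norm 1 (dyadic_block \<phi> j u0) < \<infinity>" using le[of j] S by (simp add: le_less_trans)
    then have dcl: "hat_class (dyadic_block \<phi> j u0)" by (rule hatL_norm_finite_class)
    have "hatL_norm 1 (dyadic_block \<phi> j u0) = esssup lborel (\<lambda>\<xi>. ennreal (norm (vhat (dyadic_block \<phi> j u0) \<xi>)))"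
      using dcl by (simp add: hatL_norm_def Lq_norm_def)
    moreover have "AE \<xi> in lborel. ennreal (norm (vhat (dyadic_block \<phi> j u0) \<xi>)) \<le> esssup lborel (\<lambda>\<xi>. ennreal (norm (vhat (dyadic_block \<phi> j u0) \<xi>)))"
      by (rule esssup_AE)
    ultimately have b: "AE \<xi> in lborel. ennreal (norm (vhat (dyadic_block \<phi> j u0) \<xi>)) \<le> ennreal S"
      using le[of j] S(2) by (auto elim!: eventually_mono)
    have "AE \<xi> in lborel. \<forall>i\<in>UNIV. hat (dyadic_block \<phi> j u0 $ i) \<xi> = complex_of_real (\<phi> ((2 powi (- j)) *\<^sub>R \<xi>)) * hat (u0 $ i) \<xi>"
    proof (rule AE_finite_allI[OF finite])
      fix i
      have "locally_integrable (\<lambda>\<xi>. complex_of_real (\<phi> ((2 powi (- j)) *\<^sub>R \<xi>)) * hat (u0 $ i) \<xi>)"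
      proof (rule locally_integrable_mult[OF has_hat_locally_integrable[OF hat_class_has_hat[OF cl]]])
        show "\<exists>B. \<forall>x. norm x \<le> R \<longrightarrow> cmod (complex_of_real (\<phi> (2 powi - j *\<^sub>R x))) \<le> B" for R
          using M by (intro exI[of _ M0]) simp
      qed measurable
      then have "has_hat (dyadic_block \<phi> j u0 $ i) (\<lambda>\<xi>. complex_of_real (\<phi> ((2 powi (- j)) *\<^sub>R \<xi>)) * hat (u0 $ i) \<xi>)"
        unfolding dyadic_block_def fourier_mult_def vec_lambda_beta by (rule has_hat_inv_fourier_dist)
      then show "AE \<xi> in lborel. hat (dyadic_block \<phi> j u0 $ i) \<xi> = complex_of_real (\<phi> ((2 powi (- j)) *\<^sub>R \<xi>)) * hat (u0 $ i) \<xi>"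
        by (rule hat_AE[OF lp])
    qed
    with b show ?thesis
    proof eventually_elim
      case (elim \<xi>)
      have "vhat (dyadic_block \<phi> j u0) \<xi> = \<phi> ((2 powi (- j)) *\<^sub>R \<xi>) *\<^sub>R vhat u0 \<xi>"
        using elim(2) by (simp add: vhat_def vec_eq_iff scaleR_conv_of_real[where 'a=complex])
      then show ?case using elim(1) S(1) littlewood_paleyD(2)[OF lp, of "(2 powi (- j)) *\<^sub>R \<xi>"] by simp
    qed
  qed
  have blocks: "AE \<xi> in lborel. \<forall>j::int. \<phi> ((2 powi (- j)) *\<^sub>R \<xi>) * norm (vhat u0 \<xi>) \<le> S"
    unfolding AE_all_countable by (intro allI block)
  have "AE \<xi> in lborel. norm (vhat u0 \<xi>) \<le> 4 * S"
    using blocks AE_lborel_singleton[of "0::real^'d"]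
  proof eventually_elim
    case (elim \<xi>)
    define j0 where "j0 = \<lfloor>log 2 (norm \<xi>)\<rfloor>"
    \<comment> \<open>A superset of the active blocks; its size is all that matters.\<close>
    define J where "J = {j0 - 1..j0 + 2}"
    have x: "0 < norm \<xi>" using elim by simp
    have off: "\<phi> ((2 powi (- j)) *\<^sub>R \<xi>) = 0" if "j \<notin> J" for j
    proof (rule ccontr)
      assume "\<phi> ((2 powi (- j)) *\<^sub>R \<xi>) \<noteq> 0"
      then have b: "1 / 2 \<le> norm ((2 powi (- j)) *\<^sub>R \<xi>)" "norm ((2 powi (- j)) *\<^sub>R \<xi>) \<le> 2"
        using lp unfolding littlewood_paley_def by blast+
      have n: "norm ((2 powi (- j)) *\<^sub>R \<xi>) = 2 powr (log 2 (norm \<xi>) - real_of_int j)"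
        using x by (simp add: powr_diff powr_real_of_int' power_int_minus field_simps)
      have "2 powr (-1) \<le> (2::real) powr (log 2 (norm \<xi>) - real_of_int j)" using b(1) n by (simp add: powr_minus)
      then have "-1 \<le> log 2 (norm \<xi>) - real_of_int j" by (subst (asm) powr_le_cancel_iff) simp_all
      then have "real_of_int j \<le> log 2 (norm \<xi>) + 1" by simp
      moreover have "(2::real) powr (log 2 (norm \<xi>) - real_of_int j) \<le> 2 powr 1" using b(2) n by simp
      then have "log 2 (norm \<xi>) - real_of_int j \<le> 1" by (subst (asm) powr_le_cancel_iff) simp_all
      then have "log 2 (norm \<xi>) - 1 \<le> real_of_int j" by simp
      ultimately have "j0 - 1 \<le> j" "j \<le> j0 + 2" unfolding j0_def by linarith+
      then show False using that by (simp add: J_def)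
    qed
    have "((\<lambda>j. \<phi> ((2 powi (- j)) *\<^sub>R \<xi>)) has_sum 1) UNIV" using littlewood_paleyD(4)[OF lp] elim by simp
    moreover have "((\<lambda>j. \<phi> ((2 powi (- j)) *\<^sub>R \<xi>)) has_sum 1) J \<longleftrightarrow> ((\<lambda>j. \<phi> ((2 powi (- j)) *\<^sub>R \<xi>)) has_sum 1) UNIV"
      by (rule has_sum_cong_neutral) (use off in auto)
    ultimately have J1: "((\<lambda>j. \<phi> ((2 powi (- j)) *\<^sub>R \<xi>)) has_sum 1) J" by blast
    have "finite J" by (simp add: J_def)
    then have "(\<Sum>j\<in>J. \<phi> ((2 powi (- j)) *\<^sub>R \<xi>)) = 1"
      by (intro has_sum_unique[OF has_sum_finite J1])
    then have "norm (vhat u0 \<xi>) = (\<Sum>j\<in>J. \<phi> ((2 powi (- j)) *\<^sub>R \<xi>) * norm (vhat u0 \<xi>))"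
      by (simp add: sum_distrib_right[symmetric])
    also have "\<dots> \<le> (\<Sum>j\<in>J. S)" using elim by (intro sum_mono) auto
    also have "\<dots> = 4 * S" by (simp add: J_def)
    finally show ?case .
  qed
  then show ?thesis using S(1) by (intro exI[of _ "4 * S"]) auto
qed

lemma integrable_heat_factor:
  assumes "0 < a"
  shows "integrable lborel (\<lambda>\<xi>::'a::euclidean_space. exp (- (a * (norm \<xi>)\<^sup>2)))"
proof -
  have "integrable lborel (\<lambda>\<xi>::'a. gauss (0 + sqrt (2 * a) *\<^sub>R \<xi>))"
    using assms by (intro lborel_integrable_affine gauss_integrable) auto
  then show ?thesis using assms by (simp add: gauss_def power_mult_distrib)
qed

text \<open>The kernel is an inverse Fourier integral of an integrable function, namely of a Gaussian times the
  bounded Leray symbol, hence bounded.\<close>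

lemma oseen_hat:
  fixes \<phi> :: "real^'d::finite \<Rightarrow> real" and M :: "real^'d"
  assumes lp: "littlewood_paley \<phi>" and "0 < \<mu>" "0 < t"
  shows "hat_class (oseen_apply \<mu> t M)"
    "AE \<xi> in lborel. vhat (oseen_apply \<mu> t M) \<xi> = exp (- (\<mu> * t * (norm \<xi>)\<^sup>2)) *\<^sub>R complex_vec (leray_symbol \<xi> *v M)"
proof -
  define G where "G i m \<xi> = complex_of_real (exp (- (\<mu> * t * (norm \<xi>)\<^sup>2)) * leray_symbol \<xi> $ i $ m)" for i m and \<xi> :: "real^'d"
  have G_int: "integrable lborel (G i m)" for i m
  proof (rule Bochner_Integration.integrable_bound)
    show "integrable lborel (\<lambda>\<xi>::real^'d. 2 * exp (- (\<mu> * t * (norm \<xi>)\<^sup>2)))"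
      using assms by (intro integrable_mult_right integrable_heat_factor) simp
    show "G i m \<in> borel_measurable lborel" unfolding G_def[abs_def] by measurable
    show "AE \<xi> in lborel. norm (G i m \<xi>) \<le> norm (2 * exp (- (\<mu> * t * (norm \<xi>)\<^sup>2)))"
      using leray_symbol_bound by (auto simp: G_def abs_mult norm_mult)
  qed
  define g where "g i \<xi> = (\<Sum>m\<in>UNIV. G i m \<xi> * of_real (M $ m))" for i \<xi>
  have g_eq: "g i \<xi> = complex_of_real (exp (- (\<mu> * t * (norm \<xi>)\<^sup>2))) * complex_vec (leray_symbol \<xi> *v M) $ i" for i \<xi>
    by (simp add: g_def G_def complex_vec_def matrix_vector_mult_def sum_distrib_left mult.assoc)
  have g_int: "integrable lborel (g i)" for i
    unfolding g_def[abs_def] by (intro Bochner_Integration.integrable_sum integrable_mult_left G_int)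
  have "(oseen_kernel \<mu> t x *v complex_vec M) $ i = inv_fourier (g i) x" for x i
  proof -
    have int: "integrable lborel (\<lambda>\<xi>. wave x \<xi> * G i m \<xi> * of_real (M $ m))" for m
      using integrable_wave_mult(3)[OF G_int] by (intro integrable_mult_left) 
    have eq: "inv_fourier (G i m) x * of_real (M $ m) = of_real (fourier_const TYPE('d)) * (LINT \<xi>|lborel. wave x \<xi> * G i m \<xi> * of_real (M $ m))" for m
      unfolding inv_fourier_def integral_mult_left_zero by (rule mult.assoc)
    have "(oseen_kernel \<mu> t x *v complex_vec M) $ i = (\<Sum>m\<in>UNIV. inv_fourier (G i m) x * of_real (M $ m))"
      by (simp add: oseen_kernel_def matrix_vector_mult_def complex_vec_def G_def[abs_def])
    also have "\<dots> = of_real (fourier_const TYPE('d)) * (\<Sum>m\<in>UNIV. LINT \<xi>|lborel. wave x \<xi> * G i m \<xi> * of_real (M $ m))"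
      by (simp only: eq sum_distrib_left)
    also have "(\<Sum>m\<in>UNIV. LINT \<xi>|lborel. wave x \<xi> * G i m \<xi> * of_real (M $ m))
      = (LINT \<xi>|lborel. (\<Sum>m\<in>UNIV. wave x \<xi> * G i m \<xi> * of_real (M $ m)))"
      by (rule Bochner_Integration.integral_sum[symmetric]) (rule int)
    finally show ?thesis by (simp add: inv_fourier_def g_def sum_distrib_left mult.assoc)
  qed
  then have os: "oseen_apply \<mu> t M $ i = dist_of_fun (inv_fourier (g i))" for i
    by (simp add: oseen_apply_def)
  have hg: "has_hat (oseen_apply \<mu> t M $ i) (g i)" for i
    unfolding os by (rule has_hat_dist_of_inv_fourier[OF g_int])
  have te: "tempered (oseen_apply \<mu> t M $ i)" for i
    unfolding os
  proof (rule tempered_dist_of_bounded)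
    have [measurable]: "g i \<in> borel_measurable borel" using borel_measurable_integrable[OF g_int] by simp
    show "inv_fourier (g i) \<in> borel_measurable borel" unfolding inv_fourier_def[abs_def] by measurable
  qed (rule fourier_bound(2))
  show "hat_class (oseen_apply \<mu> t M)" unfolding hat_class_def using hg te by blast
  have "AE \<xi> in lborel. \<forall>i\<in>UNIV. hat (oseen_apply \<mu> t M $ i) \<xi> = g i \<xi>"
    by (rule AE_finite_allI[OF finite]) (rule hat_AE[OF lp hg])
  then show "AE \<xi> in lborel. vhat (oseen_apply \<mu> t M) \<xi> = exp (- (\<mu> * t * (norm \<xi>)\<^sup>2)) *\<^sub>R complex_vec (leray_symbol \<xi> *v M)"
    by eventually_elim (simp add: vhat_def g_eq vec_eq_iff scaleR_conv_of_real[where 'a=complex])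
qed

lemma norm_leray_mult:
  fixes M :: "real^'d::finite"
  shows "norm (complex_vec (leray_symbol \<xi> *v M)) \<le> (\<Sum>i\<in>(UNIV::'d set). \<Sum>m\<in>UNIV. 2 * \<bar>M $ m\<bar>)"
proof -
  have "norm (complex_vec (leray_symbol \<xi> *v M)) \<le> (\<Sum>i\<in>UNIV. norm (complex_vec (leray_symbol \<xi> *v M) $ i))"
    by (rule norm_le_sum_components)
  also have "\<dots> \<le> (\<Sum>i\<in>(UNIV::'d set). \<Sum>m\<in>UNIV. 2 * \<bar>M $ m\<bar>)"
  proof (intro sum_mono)
    fix i :: 'd
    have "norm (complex_vec (leray_symbol \<xi> *v M) $ i) = \<bar>\<Sum>m\<in>UNIV. leray_symbol \<xi> $ i $ m * M $ m\<bar>"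
      by (simp only: complex_vec_def matrix_vector_mult_def vec_lambda_beta norm_of_real)
    also have "\<dots> \<le> (\<Sum>m\<in>UNIV. \<bar>leray_symbol \<xi> $ i $ m * M $ m\<bar>)" by (rule sum_abs)
    also have "\<dots> \<le> (\<Sum>m\<in>UNIV. 2 * \<bar>M $ m\<bar>)"
      unfolding abs_mult by (intro sum_mono mult_right_mono leray_symbol_bound) simp
    finally show "norm (complex_vec (leray_symbol \<xi> *v M) $ i) \<le> (\<Sum>m\<in>UNIV. 2 * \<bar>M $ m\<bar>)" .
  qed
  finally show ?thesis .
qed

section \<open>Large time asymptotics\<close>

text \<open>The data agree near frequency zero, and away from it the Gaussian is exponentially small; this
  settles the linear part. The nonlinear part is \<open>o(1)\<close> times the decay rate by \<open>duhamel_term_decay\<close>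
  and \<open>nn_integral_N_small\<close>.\<close>

lemma difference_decay:
  fixes \<phi> :: "real^'d::finite \<Rightarrow> real" and u0 :: "('d dist)^'d" and u :: "real \<Rightarrow> ('d dist)^'d" and M :: "real^'d"
  assumes lp: "littlewood_paley \<phi>" and \<mu>: "0 < \<mu>" and u0: "u0 \<in> herz_space \<phi> 0 1 \<infinity>" and mild: "global_mild_solution \<mu> u0 u"
    and low: "\<forall>e>0. \<exists>\<delta>>0. AE \<xi> in lborel. 0 < norm \<xi> \<and> norm \<xi> < \<delta> \<longrightarrow> norm (vhat u0 \<xi> - complex_vec (leray_symbol \<xi> *v M)) < e"
  shows "\<And>t. 0 < t \<Longrightarrow> hat_class (vdiff (u t) (oseen_apply \<mu> t M))"
    and "\<And>k e. 0 < e \<Longrightarrow> \<exists>T>0. \<forall>t\<ge>T. AE \<xi> in lborel. norm (vhat (vdiff (u t) (oseen_apply \<mu> t M)) \<xi>) \<le> e * decay k t (norm \<xi>)"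
proof -
  have cl0: "hat_class u0" using u0 by (simp add: herz_space_def)
  obtain V :: "real \<times> (real^'d) \<Rightarrow> ennreal" and B :: "real \<Rightarrow> real^'d \<Rightarrow> complex^'d" and K :: real
    where V: "V \<in> borel_measurable borel" and past: "\<And>t \<xi>. t \<le> 0 \<Longrightarrow> V (t, \<xi>) = 0"
    and energy: "(\<integral>\<^sup>+t. (\<integral>\<^sup>+\<xi>. V (t, \<xi>) \<partial>lborel)\<^sup>2 \<partial>lborel) < \<infinity>" and K: "0 \<le> K"
    and cl: "\<And>t. 0 < t \<Longrightarrow> hat_class (u t)"
    and rep: "\<And>t. 0 < t \<Longrightarrow> AE \<xi> in lborel. vhat (u t) \<xi> = exp (- (\<mu> * t * (norm \<xi>)\<^sup>2)) *\<^sub>R vhat u0 \<xi> - B t \<xi>"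
    and Bb: "\<And>t \<xi>. 0 < t \<Longrightarrow> ennreal (norm (B t \<xi>)) \<le> ennreal (K * norm \<xi>) * (\<integral>\<^sup>+\<tau>. heat_factor \<mu> t \<tau> (norm \<xi>) * self_conv V \<tau> \<xi> \<partial>lborel)"
    and VAE: "AE t in lborel. 0 < t \<longrightarrow> (AE \<xi> in lborel. V (t, \<xi>) = ennreal (norm (vhat (u t) \<xi>)))"
    by (rule mild_solution_fourier[OF lp \<mu> cl0 mild]) (rule that, assumption+)
  obtain K0 where K0: "0 \<le> K0" "AE \<xi> in lborel. norm (vhat u0 \<xi>) \<le> K0" using herz_bound[OF lp u0] by blast
  define E where "E = sqrt (enn2real (\<integral>\<^sup>+t. (\<integral>\<^sup>+\<xi>. V (t, \<xi>) \<partial>lborel)\<^sup>2 \<partial>lborel))"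
  interpret convolution_duhamel V \<mu> K K0 E
  proof
    show "(\<integral>\<^sup>+\<tau>. (\<integral>\<^sup>+\<eta>. V (\<tau>, \<eta>) \<partial>lborel)\<^sup>2 \<partial>lborel) \<le> ennreal (E\<^sup>2)"
      using energy by (simp add: E_def)
    show "AE t in lborel. 0 < t \<longrightarrow> (AE \<xi> in lborel. V (t, \<xi>) \<le> ennreal (K0 * exp (- (\<mu> * t * (norm \<xi>)\<^sup>2))) + ennreal (K * norm \<xi>) *
         (\<integral>\<^sup>+\<tau>. heat_factor \<mu> t \<tau> (norm \<xi>) * self_conv V \<tau> \<xi> \<partial>lborel))"
      using VAE
    proof eventually_elim
      case (elim t)
      show ?case
      proof
        assume t: "0 < t"
        with elim have "AE \<xi> in lborel. V (t, \<xi>) = ennreal (norm (vhat (u t) \<xi>))" by blast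
        with rep[OF t] K0(2) show "AE \<xi> in lborel. V (t, \<xi>) \<le> ennreal (K0 * exp (- (\<mu> * t * (norm \<xi>)\<^sup>2))) + ennreal (K * norm \<xi>) *
         (\<integral>\<^sup>+\<tau>. heat_factor \<mu> t \<tau> (norm \<xi>) * self_conv V \<tau> \<xi> \<partial>lborel)"
        proof eventually_elim
          case (elim \<xi>)
          have "norm (vhat (u t) \<xi>) \<le> norm (exp (- (\<mu> * t * (norm \<xi>)\<^sup>2)) *\<^sub>R vhat u0 \<xi>) + norm (B t \<xi>)"
            unfolding elim(1) by (rule norm_triangle_ineq4)
          also have "norm (exp (- (\<mu> * t * (norm \<xi>)\<^sup>2)) *\<^sub>R vhat u0 \<xi>) \<le> K0 * exp (- (\<mu> * t * (norm \<xi>)\<^sup>2))"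
            using elim(2) by (simp add: mult.commute mult_left_mono)
          finally have "ennreal (norm (vhat (u t) \<xi>)) \<le> ennreal (K0 * exp (- (\<mu> * t * (norm \<xi>)\<^sup>2)) + norm (B t \<xi>))"
            by (simp add: ennreal_leI)
          also have "\<dots> = ennreal (K0 * exp (- (\<mu> * t * (norm \<xi>)\<^sup>2))) + ennreal (norm (B t \<xi>))"
            using K0(1) by (intro ennreal_plus) auto
          also have "\<dots> \<le> ennreal (K0 * exp (- (\<mu> * t * (norm \<xi>)\<^sup>2))) + ennreal (K * norm \<xi>) * (\<integral>\<^sup>+\<tau>. heat_factor \<mu> t \<tau> (norm \<xi>) * self_conv V \<tau> \<xi> \<partial>lborel)"
            by (intro add_left_mono Bb t)
          finally show ?case unfolding elim(3) .
        qed
      qed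
    qed
  qed (use V past \<mu> K K0 in \<open>auto simp: E_def\<close>)
  show clD: "hat_class (vdiff (u t) (oseen_apply \<mu> t M))" if "0 < t" for t
    using hat_class_vdiff[OF cl[OF that] oseen_hat(1)[OF lp \<mu> that]] .
  fix k :: nat and e :: real assume e: "0 < e"
  obtain C where C: "0 \<le> C" "\<And>t \<xi>. 0 < t \<Longrightarrow> ennreal (K * norm \<xi>) * (\<integral>\<^sup>+\<tau>. heat_factor \<mu> t \<tau> (norm \<xi>) * self_conv V \<tau> \<xi> \<partial>lborel)
     \<le> ennreal (C * decay k t (norm \<xi>) / sqrt t) * (\<integral>\<^sup>+\<tau>. (if \<tau> < t then N \<tau> else 0) \<partial>lborel)"
    using duhamel_term_decay[of k] by blast
  define e1 where "e1 = e / (2 * (C + 1))"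
  have e1: "0 < e1" "C * e1 \<le> e / 2" using C(1) e by (auto simp: e1_def field_simps)
  obtain T1 where T1: "0 < T1" "\<And>t. T1 \<le> t \<Longrightarrow> (\<integral>\<^sup>+\<tau>. (if \<tau> < t then N \<tau> else 0) \<partial>lborel) \<le> ennreal (e1 * sqrt t)"
    using nn_integral_N_small[OF e1(1)] by blast
  have nonlinear: "norm (B t \<xi>) \<le> e / 2 * decay k t (norm \<xi>)" if t: "T1 \<le> t" for t \<xi>
  proof -
    have t0: "0 < t" using t T1(1) by simp
    let ?a = "decay k t (norm \<xi>)"
    have a: "0 \<le> ?a" using t0 by (simp add: decay_nonneg)
    have "ennreal (norm (B t \<xi>)) \<le> ennreal (C * ?a / sqrt t) * (\<integral>\<^sup>+\<tau>. (if \<tau> < t then N \<tau> else 0) \<partial>lborel)"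
      using Bb[OF t0] C(2)[OF t0] by (rule order_trans)
    also have "\<dots> \<le> ennreal (C * ?a / sqrt t) * ennreal (e1 * sqrt t)" by (intro mult_left_mono T1(2) t) simp
    also have "\<dots> = ennreal (C * ?a / sqrt t * (e1 * sqrt t))" using a C(1) e1 t0 by (intro ennreal_mult[symmetric]) auto
    also have "C * ?a / sqrt t * (e1 * sqrt t) = C * e1 * ?a" using t0 by simp
    finally have "norm (B t \<xi>) \<le> C * e1 * ?a" using a C(1) e1 by simp
    also have "\<dots> \<le> e / 2 * ?a" using e1(2) a by (rule mult_right_mono)
    finally show ?thesis .
  qed
  obtain C0 where C0: "1 \<le> C0" "\<And>y. 0 \<le> y \<Longrightarrow> (1 + y) ^ k * exp (- (\<mu> / 2 * y)) \<le> C0"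
    using poly_exp_bound[of "\<mu> / 2" k] \<mu> by auto
  define e2 where "e2 = e / (2 * C0)"
  have e2: "0 < e2" "e2 * C0 = e / 2" using e C0(1) by (auto simp: e2_def)
  obtain \<delta> where \<delta>: "0 < \<delta>" "AE \<xi> in lborel. 0 < norm \<xi> \<and> norm \<xi> < \<delta> \<longrightarrow> norm (vhat u0 \<xi> - complex_vec (leray_symbol \<xi> *v M)) < e2"
    using low e2(1) by blast
  define K1 where "K1 = K0 + (\<Sum>i\<in>(UNIV::'d set). \<Sum>m\<in>UNIV. 2 * \<bar>M $ m\<bar>)"
  have K1: "0 \<le> K1" unfolding K1_def by (intro add_nonneg_nonneg K0 sum_nonneg) auto
  \<comment> \<open>from \<open>e\<^sup>-\<^sup>x \<le> 1/x\<close> with \<open>x = \<mu> t \<delta>\<^sup>2 / 2\<close>\<close>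
  define T2 where "T2 = 2 * (K1 + 1) / (e2 * \<mu> * \<delta>\<^sup>2)"
  have T2: "0 < T2" using K1 e2 \<mu> \<delta> by (simp add: T2_def)
  have far: "K1 * exp (- (\<mu> / 2 * (t * \<delta>\<^sup>2))) \<le> e2" if t: "T2 \<le> t" for t
  proof -
    let ?x = "\<mu> / 2 * (t * \<delta>\<^sup>2)"
    have "(K1 + 1) / e2 = \<mu> / 2 * (T2 * \<delta>\<^sup>2)" using \<mu> \<delta>(1) e2(1) by (simp add: T2_def field_simps)
    also have "\<dots> \<le> ?x" using t \<mu> by (intro mult_left_mono mult_right_mono) auto
    finally have "(K1 + 1) / e2 \<le> ?x" .
    moreover have "?x \<le> exp ?x" using exp_ge_add_one_self[of ?x] by linarith
    ultimately have "(K1 + 1) / e2 \<le> exp ?x" by linarith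
    then have "K1 + 1 \<le> e2 * exp ?x" using e2(1) by (simp add: field_simps)
    then have "K1 \<le> e2 * exp ?x" by simp
    then show ?thesis by (simp add: exp_minus field_simps)
  qed
  show "\<exists>T>0. \<forall>t\<ge>T. AE \<xi> in lborel. norm (vhat (vdiff (u t) (oseen_apply \<mu> t M)) \<xi>) \<le> e * decay k t (norm \<xi>)"
  proof (intro exI conjI allI impI)
    show "0 < max T1 T2" using T2 by simp
    fix t assume "max T1 T2 \<le> t"
    then have t: "T1 \<le> t" "T2 \<le> t" "0 < t" using T2 by auto
    show "AE \<xi> in lborel. norm (vhat (vdiff (u t) (oseen_apply \<mu> t M)) \<xi>) \<le> e * decay k t (norm \<xi>)"
      using vhat_vdiff[OF lp cl[OF t(3)] oseen_hat(1)[OF lp \<mu> t(3), of M]] rep[OF t(3)] oseen_hat(2)[OF lp \<mu> t(3), of M] K0(2) \<delta>(2) AE_lborel_singleton[of "0::real^'d"]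
    proof eventually_elim
      case (elim \<xi>)
      define r where "r = norm \<xi>"
      define G where "G = exp (- (\<mu> * t * r\<^sup>2))"
      define w where "w = vhat u0 \<xi> - complex_vec (leray_symbol \<xi> *v M)"
      have r: "0 < r" using elim(6) by (simp add: r_def)
      have eq: "vhat (vdiff (u t) (oseen_apply \<mu> t M)) \<xi> = G *\<^sub>R w - B t \<xi>"
        unfolding elim(1) elim(2) elim(3) w_def G_def r_def by (simp add: algebra_simps)
      have w1: "norm w \<le> K1"
        using norm_triangle_ineq4[of "vhat u0 \<xi>" "complex_vec (leray_symbol \<xi> *v M)"] elim(4) norm_leray_mult[of \<xi> M]
        unfolding w_def K1_def by linarith
      have G2: "G = exp (- (\<mu> / 2 * (t * r\<^sup>2))) * exp (- (\<mu> / 2 * (t * r\<^sup>2)))"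
        unfolding G_def by (simp add: exp_add[symmetric])
      have "norm w * exp (- (\<mu> / 2 * (t * r\<^sup>2))) \<le> e2"
      proof (cases "r < \<delta>")
        case True
        then have "norm w \<le> e2" using elim(5) r unfolding w_def r_def by auto
        moreover have "exp (- (\<mu> / 2 * (t * r\<^sup>2))) \<le> 1" using \<mu> t(3) by simp
        ultimately have "norm w * exp (- (\<mu> / 2 * (t * r\<^sup>2))) \<le> e2 * 1" by (intro mult_mono) (use e2 in auto)
        then show ?thesis by simp
      next
        case False
        then have "\<delta>\<^sup>2 \<le> r\<^sup>2" using \<delta>(1) by (intro power_mono) auto
        then have "exp (- (\<mu> / 2 * (t * r\<^sup>2))) \<le> exp (- (\<mu> / 2 * (t * \<delta>\<^sup>2)))" using \<mu> t(3) by simp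
        then have "norm w * exp (- (\<mu> / 2 * (t * r\<^sup>2))) \<le> K1 * exp (- (\<mu> / 2 * (t * \<delta>\<^sup>2)))"
          using w1 K1 by (intro mult_mono) auto
        also have "\<dots> \<le> e2" by (rule far[OF t(2)])
        finally show ?thesis .
      qed
      moreover have "exp (- (\<mu> / 2 * (t * r\<^sup>2))) \<le> C0 * decay k t r"
      proof -
        have "(1 + t * r\<^sup>2) ^ k > 0" using t(3) by (simp add: add_pos_nonneg)
        then show ?thesis using C0(2)[of "t * r\<^sup>2"] t(3) by (simp add: decay_def field_simps)
      qed
      ultimately have "(norm w * exp (- (\<mu> / 2 * (t * r\<^sup>2)))) * exp (- (\<mu> / 2 * (t * r\<^sup>2))) \<le> e2 * (C0 * decay k t r)"
        using e2(1) by (intro mult_mono) auto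
      then have lin: "norm (G *\<^sub>R w) \<le> e / 2 * decay k t r"
        unfolding e2(2)[symmetric] G2 by (simp add: abs_mult mult_ac)
      have "norm (G *\<^sub>R w - B t \<xi>) \<le> e / 2 * decay k t r + e / 2 * decay k t r"
        using norm_triangle_ineq4[of "G *\<^sub>R w" "B t \<xi>"] lin nonlinear[OF t(1), of \<xi>] unfolding r_def by linarith
      then show ?case unfolding eq r_def by (simp add: field_simps)
    qed
  qed
qed

section \<open>Weighted norms of the decay rate\<close>

lemma ennpow_ennreal: "0 \<le> x \<Longrightarrow> ennpow (ennreal x) a = ennreal (x powr a)"
  by (simp add: ennpow_def)

lemma ennpow_mono:
  assumes "x \<le> y" "0 \<le> a" shows "ennpow x a \<le> ennpow y a"
proof (cases y)
  case (real s)
  then obtain r where r: "x = ennreal r" "0 \<le> r" using assms(1) by (cases x) (auto simp: top_unique)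
  then have "r \<le> s" using assms(1) real by simp
  then show ?thesis using r real assms(2) by (simp add: ennpow_ennreal powr_mono2 ennreal_leI)
qed (simp add: ennpow_def)

text \<open>Substitute \<open>\<xi> = x / \<surd>t\<close>. As \<open>q \<ge> 1\<close> and the decay rate is at most \<open>1\<close>, its \<open>q\<close>-th power is not
  larger than itself, so \<open>nn_integral_weight\<close> with exponent \<open>s q\<close> provides \<open>k\<close>.\<close>

lemma weighted_Lq_decay:
  fixes s q :: real
  assumes q: "1 \<le> q" and s: "s * q > - real DIM('a::euclidean_space)"
  shows "\<exists>k. \<exists>C\<ge>0. \<forall>t>0. \<forall>e\<ge>0. \<forall>h :: 'a \<Rightarrow> ennreal.
     (AE \<xi> in lborel. h \<xi> \<le> ennreal (norm \<xi> powr s * (e * decay k t (norm \<xi>)))) \<longrightarrow>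
     ennpow (\<integral>\<^sup>+\<xi>. ennpow (h \<xi>) q \<partial>lborel) (1 / q) \<le> ennreal (e * C * t powr (- (real DIM('a) / 2 * (1 / q) + s / 2)))"
proof -
  let ?d = "DIM('a)"
  obtain k where k: "(\<integral>\<^sup>+x. ennreal (norm (x::'a) powr (s * q) / (1 + (norm x)\<^sup>2) ^ k) \<partial>lborel) < \<infinity>"
    using nn_integral_weight[OF s] by blast
  define I where "I = enn2real (\<integral>\<^sup>+x. ennreal (norm (x::'a) powr (s * q) / (1 + (norm x)\<^sup>2) ^ k) \<partial>lborel)"
  have I: "0 \<le> I" "(\<integral>\<^sup>+x. ennreal (norm (x::'a) powr (s * q) / (1 + (norm x)\<^sup>2) ^ k) \<partial>lborel) = ennreal I"
    using k by (auto simp: I_def)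
  have "ennpow (\<integral>\<^sup>+\<xi>. ennpow (h \<xi>) q \<partial>lborel) (1 / q) \<le> ennreal (e * I powr (1 / q) * t powr (- (real ?d / 2 * (1 / q) + s / 2)))"
    if t: "0 < t" and e: "0 \<le> e" and h: "AE \<xi> in lborel. h \<xi> \<le> ennreal (norm \<xi> powr s * (e * decay k t (norm \<xi>)))"
    for t e and h :: "'a \<Rightarrow> ennreal"
  proof -
    let ?f = "\<lambda>\<xi>::'a. ennreal (e powr q * (norm \<xi> powr (s * q) / (1 + t * (norm \<xi>)\<^sup>2) ^ k))"
    have "(\<integral>\<^sup>+\<xi>. ennpow (h \<xi>) q \<partial>lborel) \<le> (\<integral>\<^sup>+\<xi>. ?f \<xi> \<partial>lborel)"
    proof (rule nn_integral_mono_AE, use h in eventually_elim)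
      case (elim \<xi>)
      let ?a = "decay k t (norm \<xi>)"
      have a: "0 < ?a" "?a \<le> 1" using t by (auto simp: decay_pos decay_le_1)
      have "?a powr q \<le> ?a powr 1" using a q by (intro powr_mono') auto
      then have aq: "?a powr q \<le> ?a" using a by simp
      have "ennpow (h \<xi>) q \<le> ennpow (ennreal (norm \<xi> powr s * (e * ?a))) q" using elim q by (intro ennpow_mono) auto
      also have "\<dots> = ennreal ((norm \<xi> powr s * (e * ?a)) powr q)" using e a by (intro ennpow_ennreal) auto
      also have "(norm \<xi> powr s * (e * ?a)) powr q = e powr q * (norm \<xi> powr (s * q) * ?a powr q)"
        using e a by (simp add: powr_mult powr_powr mult_ac)
      also have "ennreal \<dots> \<le> ennreal (e powr q * (norm \<xi> powr (s * q) * ?a))"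
        using aq by (intro ennreal_leI mult_left_mono) auto
      finally show ?case by (simp add: decay_def)
    qed
    also have "\<dots> = ennreal (\<bar>1 / sqrt t\<bar> ^ ?d) * (\<integral>\<^sup>+x. ?f (0 + (1 / sqrt t) *\<^sub>R x) \<partial>lborel)"
      using t by (intro lborel_nn_integral_affine) auto
    also have "(\<integral>\<^sup>+x. ?f (0 + (1 / sqrt t) *\<^sub>R x) \<partial>lborel)
       = (\<integral>\<^sup>+x. ennreal (e powr q * t powr (- (s * q / 2))) * ennreal (norm (x::'a) powr (s * q) / (1 + (norm x)\<^sup>2) ^ k) \<partial>lborel)"
    proof (intro nn_integral_cong)
      fix x :: 'a
      have "norm ((1 / sqrt t) *\<^sub>R x) powr (s * q) = (1 / sqrt t) powr (s * q) * norm x powr (s * q)"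
        using t by (simp add: powr_mult powr_divide)
      also have "(1 / sqrt t) powr (s * q) = t powr (- (s * q / 2))"
        using t by (simp add: powr_half_sqrt[symmetric] powr_divide powr_powr powr_minus_divide)
      finally have "norm ((1 / sqrt t) *\<^sub>R x) powr (s * q) = t powr (- (s * q / 2)) * norm x powr (s * q)" .
      moreover have "t * (norm ((1 / sqrt t) *\<^sub>R x))\<^sup>2 = (norm x)\<^sup>2"
        using t by (simp add: power_divide)
      ultimately have "e powr q * (norm (0 + (1 / sqrt t) *\<^sub>R x) powr (s * q) / (1 + t * (norm (0 + (1 / sqrt t) *\<^sub>R x))\<^sup>2) ^ k)
        = e powr q * t powr (- (s * q / 2)) * (norm x powr (s * q) / (1 + (norm x)\<^sup>2) ^ k)"
        by (simp only: add_0_left times_divide_eq_right mult.assoc)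
      then show "?f (0 + (1 / sqrt t) *\<^sub>R x) = ennreal (e powr q * t powr (- (s * q / 2))) * ennreal (norm x powr (s * q) / (1 + (norm x)\<^sup>2) ^ k)"
        by (simp only:) (intro ennreal_mult, auto)
    qed
    also have "\<dots> = ennreal (e powr q * t powr (- (s * q / 2))) * ennreal I"
      unfolding I(2)[symmetric] by (rule nn_integral_cmult) measurable
    also have "ennreal (\<bar>1 / sqrt t\<bar> ^ ?d) * \<dots> = ennreal ((1 / sqrt t) ^ ?d * (e powr q * t powr (- (s * q / 2)) * I))"
      using t I(1) by (simp add: ennreal_mult[symmetric])
    also have "(1 / sqrt t) ^ ?d * (e powr q * t powr (- (s * q / 2)) * I) = e powr q * I * t powr (- (real ?d / 2 + s * q / 2))"
    proof -
      have "(1 / sqrt t) ^ ?d = t powr (- (real ?d / 2))"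
        using t by (simp add: powr_half_sqrt[symmetric] power_divide powr_powr powr_minus_divide powr_realpow[symmetric])
      moreover have "- (real ?d / 2 + s * q / 2) = - (real ?d / 2) + - (s * q / 2)" by simp
      ultimately show ?thesis by (simp only: powr_add mult_ac)
    qed
    finally have le: "(\<integral>\<^sup>+\<xi>. ennpow (h \<xi>) q \<partial>lborel) \<le> ennreal (e powr q * I * t powr (- (real ?d / 2 + s * q / 2)))" .
    have "ennpow (\<integral>\<^sup>+\<xi>. ennpow (h \<xi>) q \<partial>lborel) (1 / q) \<le> ennpow (ennreal (e powr q * I * t powr (- (real ?d / 2 + s * q / 2)))) (1 / q)"
      using le q by (intro ennpow_mono) auto
    also have "\<dots> = ennreal ((e powr q * I * t powr (- (real ?d / 2 + s * q / 2))) powr (1 / q))"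
      using I(1) by (intro ennpow_ennreal) auto
    also have "(e powr q * I * t powr (- (real ?d / 2 + s * q / 2))) powr (1 / q) = e * I powr (1 / q) * t powr (- (real ?d / 2 * (1 / q) + s / 2))"
    proof -
      have "- (real ?d / 2 + s * q / 2) * (1 / q) = - (real ?d / 2 * (1 / q) + s / 2)" using q by (simp add: field_simps)
      then show ?thesis using e I(1) q by (simp add: powr_mult powr_powr)
    qed
    finally show ?thesis .
  qed
  moreover have "0 \<le> I powr (1 / q)" by simp
  ultimately show ?thesis by blast
qed

text \<open>With \<open>r = 1/p\<close>, which is \<open>0\<close> for infinite \<open>p\<close>, the conjugate exponent is \<open>1/(1 - r)\<close>.\<close>

lemma conjugate_exponent:
  assumes "1 < (p::ennreal)"
  obtains q where "1 \<le> q" "hconj p = ennreal q" "1 - enn2real (1 / p) = 1 / q"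
proof -
  have lt: "inverse p < 1"
    using assms by (cases p) (auto simp: inverse_ennreal ennreal_less_one_iff inverse_less_1_iff)
  then obtain r where r: "inverse p = ennreal r" "0 \<le> r" by (cases "inverse p") auto
  have "r < 1" using lt r by (simp add: ennreal_less_one_iff)
  note r = r this
  have "1 - inverse p = ennreal (1 - r)" unfolding r(1) using r(2) by (simp add: ennreal_minus ennreal_1[symmetric] del: ennreal_1)
  then have "hconj p = ennreal (1 / (1 - r))" unfolding hconj_def using r by (simp add: inverse_ennreal inverse_eq_divide)
  moreover have "1 \<le> 1 / (1 - r)" using r by simp
  moreover have "1 - enn2real (1 / p) = 1 / (1 / (1 - r))" using r by (simp add: divide_ennreal_def)
  ultimately show thesis using that by blast
qed

text \<open>A pointwise bound by \<open>e\<close> times the decay rate of large order \<open>k\<close> gives the norm bound at exactly the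
  scaling rate of the conclusion. For \<open>p = 1\<close> the norm is a supremum and \<open>k \<ge> s\<close> suffices. For
  \<open>p > 1\<close> the order comes from \<open>weighted_Lq_decay\<close>, whose condition \<open>s p' > -d\<close> follows for infinite
  \<open>p\<close> from \<open>s \<ge> -1 > -d\<close>.\<close>

lemma hatL_deriv_norm_decay:
  fixes p :: ennreal and s :: real
  assumes d: "CARD('d::finite) \<ge> 2" and p: "1 \<le> p" "p = 1 \<longrightarrow> 0 \<le> s"
    "1 < p \<and> p < \<infinity> \<longrightarrow> s > - (real CARD('d) / enn2real (hconj p))" "p = \<infinity> \<longrightarrow> -1 \<le> s"
  shows "\<exists>k. \<exists>C\<ge>0. \<forall>t>0. \<forall>e\<ge>0. \<forall>f :: ('d dist)^'d. hat_class f \<longrightarrow>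
     (AE \<xi> in lborel. norm (vhat f \<xi>) \<le> e * decay k t (norm \<xi>)) \<longrightarrow>
     ennreal (t powr (real CARD('d) / 2 * (1 - enn2real (1 / p)) + s / 2)) * hatL_deriv_norm s p f \<le> ennreal (e * C)"
proof (cases "p = 1")
  case True
  then have s: "0 \<le> s" using p(2) by simp
  define k where "k = nat \<lceil>s\<rceil>"
  have k: "s \<le> real k" by (simp add: k_def real_nat_ceiling_ge)
  have "ennreal (t powr (real CARD('d) / 2 * (1 - enn2real (1 / p)) + s / 2)) * hatL_deriv_norm s p f \<le> ennreal (e * 1)"
    if t: "0 < t" and e: "0 \<le> e" and cl: "hat_class f" and b: "AE \<xi> in lborel. norm (vhat f \<xi>) \<le> e * decay k t (norm \<xi>)"
    for t e and f :: "('d dist)^'d"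
  proof -
    have [measurable]: "vhat f \<in> borel_measurable borel" by (rule vhat_measurable[OF cl])
    have "esssup lborel (\<lambda>\<xi>. ennreal (norm \<xi> powr s * norm (vhat f \<xi>))) \<le> ennreal (e * t powr (- (s / 2)))"
    proof (rule esssup_I)
      show "AE \<xi> in lborel. ennreal (norm \<xi> powr s * norm (vhat f \<xi>)) \<le> ennreal (e * t powr (- (s / 2)))"
        using b
      proof eventually_elim
        case (elim \<xi>)
        let ?r = "norm \<xi>" and ?w = "1 + t * (norm \<xi>)\<^sup>2"
        have w: "1 \<le> ?w" using t by simp
        have "(sqrt t * ?r) powr s \<le> ?w powr s"
        proof (rule powr_mono2[OF s])
          have "2 * (sqrt t * ?r) \<le> 1 + (sqrt t * ?r)\<^sup>2" using sum_squares_bound[of 1 "sqrt t * ?r"] by simp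
          moreover have "0 \<le> sqrt t * ?r" using t by simp
          moreover have "(sqrt t * ?r)\<^sup>2 = t * ?r\<^sup>2" using t by (simp add: power_mult_distrib)
          ultimately show "sqrt t * ?r \<le> ?w" by linarith
        qed (use t in simp)
        also have "\<dots> \<le> ?w powr real k" using w k by (intro powr_mono) auto
        also have "\<dots> = ?w ^ k" using w by (intro powr_realpow) auto
        finally have "?r powr s * t powr (s / 2) \<le> ?w ^ k"
          using t by (simp add: powr_mult powr_half_sqrt[symmetric] powr_powr mult.commute)
        moreover have "0 < ?w" using w by linarith
        then have "0 < ?w ^ k" by (rule zero_less_power)
        moreover have "0 < t powr (s / 2)" using t by simp
        ultimately have "?r powr s * decay k t ?r \<le> t powr (- (s / 2))"
          by (simp add: decay_def powr_minus field_simps)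
        then have "e * (?r powr s * decay k t ?r) \<le> e * t powr (- (s / 2))" using e by (rule mult_left_mono)
        moreover have "?r powr s * norm (vhat f \<xi>) \<le> ?r powr s * (e * decay k t ?r)" using elim by (rule mult_left_mono) simp
        ultimately show ?case by (intro ennreal_leI) (simp add: mult.left_commute)
      qed
    qed measurable
    then have "hatL_deriv_norm s p f \<le> ennreal (e * t powr (- (s / 2)))"
      using cl True by (simp add: hatL_deriv_norm_def Lq_norm_def)
    then have "ennreal (t powr (s / 2)) * hatL_deriv_norm s p f \<le> ennreal (t powr (s / 2)) * ennreal (e * t powr (- (s / 2)))"
      by (rule mult_left_mono) simp
    also have "\<dots> = ennreal (t powr (s / 2) * (e * t powr (- (s / 2))))" using e by (intro ennreal_mult[symmetric]) auto
    also have "t powr (s / 2) * (e * t powr (- (s / 2))) = e" using t by (simp add: powr_minus)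
    finally show ?thesis using True by simp
  qed
  then show ?thesis by (intro exI[of _ k] exI[of _ 1]) auto
next
  case False
  then have p1: "1 < p" using p(1) by simp
  obtain q where q: "1 \<le> q" "hconj p = ennreal q" "1 - enn2real (1 / p) = 1 / q"
    using conjugate_exponent[OF p1] by blast
  have sq: "s * q > - real DIM(real^'d)"
  proof (cases "p = \<infinity>")
    case True
    then have "ennreal q = 1" using q(2) by simp
    then have "q = 1" using q(1) by simp
    then show ?thesis using p(4) True d by simp
  next
    case False
    then have "s > - (real CARD('d) / q)" using p(3) p1 q by (simp add: less_top)
    then show ?thesis using q(1) by (simp add: field_simps)
  qed
  obtain k C where kC: "0 \<le> C" "\<And>t e h. 0 < t \<Longrightarrow> 0 \<le> e \<Longrightarrow> 
     (AE \<xi> in lborel. h \<xi> \<le> ennreal (norm (\<xi>::real^'d) powr s * (e * decay k t (norm \<xi>)))) \<Longrightarrow>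
     ennpow (\<integral>\<^sup>+\<xi>. ennpow (h \<xi>) q \<partial>lborel) (1 / q) \<le> ennreal (e * C * t powr (- (real DIM(real^'d) / 2 * (1 / q) + s / 2)))"
    using weighted_Lq_decay[OF q(1) sq] by blast
  have "ennreal (t powr (real CARD('d) / 2 * (1 - enn2real (1 / p)) + s / 2)) * hatL_deriv_norm s p f \<le> ennreal (e * C)"
    if t: "0 < t" and e: "0 \<le> e" and cl: "hat_class f" and b: "AE \<xi> in lborel. norm (vhat f \<xi>) \<le> e * decay k t (norm \<xi>)"
    for t e and f :: "('d dist)^'d"
  proof -
    let ?x = "real CARD('d) / 2 * (1 / q) + s / 2"
    have "hatL_deriv_norm s p f = ennpow (\<integral>\<^sup>+\<xi>. ennpow (ennreal (norm \<xi> powr s * norm (vhat f \<xi>))) q \<partial>lborel) (1 / q)"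
      using cl q by (simp add: hatL_deriv_norm_def Lq_norm_def)
    also have "\<dots> \<le> ennreal (e * C * t powr (- (real DIM(real^'d) / 2 * (1 / q) + s / 2)))"
      by (rule kC(2)[OF t e], use b in eventually_elim) (intro ennreal_leI mult_left_mono, auto)
    also have "real DIM(real^'d) = real CARD('d)" by simp
    finally have "ennreal (t powr ?x) * hatL_deriv_norm s p f \<le> ennreal (t powr ?x) * ennreal (e * C * t powr (- ?x))"
      by (rule mult_left_mono) simp
    also have "\<dots> = ennreal (t powr ?x * (e * C * t powr (- ?x)))" using e kC(1) by (intro ennreal_mult[symmetric]) auto
    also have "t powr ?x * (e * C * t powr (- ?x)) = e * C"
    proof -
      have "t powr z * t powr (- z) = 1" for z using t by (simp add: powr_minus)
      from this[of ?x] show ?thesis by (simp only: mult.left_commute mult_1_right)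
    qed
    finally show ?thesis unfolding q(3) .
  qed
  then show ?thesis using kC(1) by blast
qed

section \<open>Convergence to the Oseen field\<close>

theorem theorem2p1:
  fixes \<phi> :: "real^'d::finite \<Rightarrow> real" and \<mu> :: real
  assumes "CARD('d) \<ge> 2" and "\<mu> > 0" and "littlewood_paley \<phi>"
  shows "\<exists>\<epsilon>>0. \<forall>(s::real) (p::ennreal) (u0 :: ('d dist)^'d) (M0 :: real^'d) (u :: real \<Rightarrow> ('d dist)^'d).
    1 \<le> p \<longrightarrow>
    (p = 1 \<longrightarrow> s \<ge> 0) \<longrightarrow>
    (1 < p \<and> p < \<infinity> \<longrightarrow>
       s > - min (real CARD('d) / enn2real (hconj p)) (1 + real CARD('d) / enn2real p)) \<longrightarrow>
    (p = \<infinity> \<longrightarrow> s \<ge> -1) \<longrightarrow>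
    u0 \<in> herz_space \<phi> (-1) \<infinity> 2 \<inter> herz_space \<phi> 0 1 \<infinity> \<longrightarrow>
    real_valued u0 \<longrightarrow>
    div_free u0 \<longrightarrow>
    herz_norm \<phi> (-1) \<infinity> 2 u0 < ennreal \<epsilon> \<longrightarrow>
    M0 \<noteq> 0 \<longrightarrow>
    (\<forall>e>0. \<exists>\<delta>>0. AE \<xi> in lborel. 0 < norm \<xi> \<and> norm \<xi> < \<delta> \<longrightarrow>
       norm (vhat u0 \<xi> - complex_vec (leray_symbol \<xi> *v M0)) < e) \<longrightarrow>
    global_mild_solution \<mu> u0 u \<longrightarrow>
    ((\<lambda>t. ennreal (t powr (real CARD('d) / 2 * (1 - enn2real (1 / p)) + s / 2)) *
           hatL_deriv_norm s p (vdiff (u t) (oseen_apply \<mu> t M0))) \<longlongrightarrow> 0) at_top"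
proof (intro exI[of _ 1] conjI allI impI)
  fix s :: real and p :: ennreal and u0 :: "('d dist)^'d" and M0 :: "real^'d" and u :: "real \<Rightarrow> ('d dist)^'d"
  assume p: "1 \<le> p" "p = 1 \<longrightarrow> s \<ge> 0"
      "1 < p \<and> p < \<infinity> \<longrightarrow> s > - min (real CARD('d) / enn2real (hconj p)) (1 + real CARD('d) / enn2real p)" "p = \<infinity> \<longrightarrow> s \<ge> -1"
    and u0: "u0 \<in> herz_space \<phi> (-1) \<infinity> 2 \<inter> herz_space \<phi> 0 1 \<infinity>"
    and low: "\<forall>e>0. \<exists>\<delta>>0. AE \<xi> in lborel. 0 < norm \<xi> \<and> norm \<xi> < \<delta> \<longrightarrow> norm (vhat u0 \<xi> - complex_vec (leray_symbol \<xi> *v M0)) < e"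
    and mild: "global_mild_solution \<mu> u0 u"
  let ?g = "\<lambda>t. ennreal (t powr (real CARD('d) / 2 * (1 - enn2real (1 / p)) + s / 2)) * hatL_deriv_norm s p (vdiff (u t) (oseen_apply \<mu> t M0))"
  have s: "1 < p \<and> p < \<infinity> \<longrightarrow> s > - (real CARD('d) / enn2real (hconj p))"
    using p(3) min.cobounded1[of "real CARD('d) / enn2real (hconj p)" "1 + real CARD('d) / enn2real p"] by linarith
  obtain k C where kC: "0 \<le> C" "\<And>t e f. 0 < t \<Longrightarrow> 0 \<le> e \<Longrightarrow> hat_class (f :: ('d dist)^'d) \<Longrightarrow>
     (AE \<xi> in lborel. norm (vhat f \<xi>) \<le> e * decay k t (norm \<xi>)) \<Longrightarrow>
     ennreal (t powr (real CARD('d) / 2 * (1 - enn2real (1 / p)) + s / 2)) * hatL_deriv_norm s p f \<le> ennreal (e * C)"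
    using hatL_deriv_norm_decay[OF assms(1) p(1,2) s p(4)] by blast
  have u0': "u0 \<in> herz_space \<phi> 0 1 \<infinity>" using u0 by blast
  note D = difference_decay[OF assms(3,2) u0' mild low]
  show "(?g \<longlongrightarrow> 0) at_top"
  proof (rule order_tendstoI)
    fix a :: ennreal assume "0 < a"
    then obtain b where b: "0 < b" "b < a" using dense by blast
    then obtain r where r: "b = ennreal r" "0 < r" by (cases b) (auto simp: top_unique)
    define e where "e = r / (C + 1)"
    have e: "0 < e" "e * C \<le> r" using r kC(1) by (auto simp: e_def field_simps)
    obtain T where T: "0 < T" "\<And>t. T \<le> t \<Longrightarrow> AE \<xi> in lborel. norm (vhat (vdiff (u t) (oseen_apply \<mu> t M0)) \<xi>) \<le> e * decay k t (norm \<xi>)"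
      using D(2)[OF e(1), of k] by blast
    show "\<forall>\<^sub>F t in at_top. ?g t < a"
      using eventually_ge_at_top[of T]
    proof eventually_elim
      case (elim t)
      then have t: "0 < t" using T(1) by simp
      have "?g t \<le> ennreal (e * C)" using e by (intro kC(2) t D(1) T(2) elim) auto
      also have "\<dots> \<le> b" unfolding r(1) by (rule ennreal_leI[OF e(2)])
      also have "\<dots> < a" by (rule b(2))
      finally show ?case .
    qed
  qed simp
qed simp

end
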